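(* Let $r\in\{0,1\}$, with the Fock representation $\rho_r$ and the normal ordering corresponding to $r$. Let $\chi_0\in\mathbb C$ and let $\mathcal V$, $\lambda$, $B^1_{-1}$ be as in the context, so that $\beta(z),\beta^1(z)$ are the formal distributions given by the representation $\rho$ of the elliptic Heisenberg algebra on $\mathbb C[\mathbf y]\otimes\mathcal V$ in which $\mathbf 1_0$ acts as $\chi_0$ and $\mathbf 1_\pm$ act as $0$. Put $\kappa_0:=\chi_0+4\delta_{r,0}$. Then the following formulas define a representation $\theta$ of the elliptic affine algebra $\hat{\mathfrak g}$ on $\mathbb C[\mathbf x]\otimes\mathbb C[\mathbf y]\otimes\mathcal V$: \begin{align*} \theta(\omega_\pm)&=0,\qquad \theta(\omega_0)=\kappa_0,\\ \theta(f(z))&=-\alpha(z),\qquad \theta(f^1(z))=-\alpha^1(z),\\ \theta(h(z))&=2\left(:\alpha(z)\alpha^*(z):+:\alpha^1(z)\alpha^{1*}(z):\right)+\beta(z),\\ \theta(h^1(z))&=2\left(:\alpha^1(z)\alpha^*(z):+z(1-2bz+z^2):\alpha(z)\alpha^{1*}(z):\right)+\beta^1(z),\\ \theta(e^1(z))&=:\alpha^1(z)\alpha^*(z)^2:+z(z^2-2bz+1)\left(:\alpha^1(z)\alpha^{1*}(z)^2:+2:\alpha(z)\alpha^*(z)\alpha^{1*}(z):\right)\\ &\quad+\beta^1(z)\alpha^*(z)+z(z^2-2bz+1)\beta(z)\alpha^{1*}(z)\\ &\quad+\kappa_0\,z(1-2bz+z^2)\,\partial_z\alpha^{1*}(z)+\tfrac12\kappa_0\,\partial_z\!\left[z(1-2bz+z^2)\right]\alpha^{1*}(z),\\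 \theta(e(z))&=:\alpha(z)\alpha^*(z)^2:+z(1-2bz+z^2):\alpha(z)\alpha^{1*}(z)^2:+2:\alpha^1(z)\alpha^*(z)\alpha^{1*}(z):\\ &\quad+\beta(z)\alpha^*(z)+\beta^1(z)\alpha^{1*}(z)+\kappa_0\,\partial_z\alpha^*(z). \end{align*}
   Context: **The algebra.** Fix $b\in\mathbb C$ and let $R=\mathbb C[t,t^{-1},u\mid u^2=t^3-2bt^2+t]$. Let $\mathfrak g=\mathfrak{sl}(2,\mathbb C)$ with standard basis $e,h,f$ and invariant form $(x,y)=\operatorname{tr}(xy)$, so $(h,h)=2$, $(e,f)=1$. Let $\Omega_R/dR$ be the space of Kähler differentials of $R$ over $\mathbb C$ modulo exact forms; $\overline{a}$ denotes the class of $a\in\Omega_R$. It has basis $\omega_0=\overline{t^{-1}dt}$, $\omega_-=\overline{t^{-2}u\,dt}$, $\omega_+=\overline{t^{-1}u\,dt}$. The elliptic affine algebra is $\hat{\mathfrak g}=(\mathfrak g\otimes R)\oplus(\Omega_R/dR)$ with $$[x\otimes p,y\otimes q]=[x,y]\otimes pq+(x,y)\,\overline{p\,dq},\qquad [\hat{\mathfrak g},\Omega_R/dR]=0$$ for $x,y\in\mathfrak g$, $p,q\in R$. For $x\in\mathfrak g$ set $x(z)=\sum_{m\in\mathbb Z}(x\otimes t^m)z^{-m-1}$ and $x^1(z)=\sum_{m\in\mathbb Z}(x\otimes t^mu)z^{-m-1}$. A formula for $\theta$ of a formal distribution prescribes $\theta$ on each coefficient. **The $\beta$-$\gamma$ system.**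 Let $\hat{\mathfrak a}$ be the Lie algebra with generators $a_n,a_n^*,a_n^1,a_n^{1*}$ ($n\in\mathbb Z$) and central $\mathbf 1$, with $[a_n,a_m^*]=[a_n^1,a_m^{1*}]=\delta_{m+n,0}\mathbf 1$ and all other brackets of generators zero. Let $\mathbb C[\mathbf x]=\mathbb C[x_n,x_n^1\mid n\in\mathbb Z]$. For $r\in\{0,1\}$ define $\rho_r$ on $\mathbb C[\mathbf x]$ by $\rho_r(\mathbf 1)=1$ and, for $(c,X)=(a,x)$ or $(a^1,x^1)$: $\rho_r(c_m)=\partial/\partial X_m$ if $m\ge0$ and $r=0$, and $\rho_r(c_m)=X_m$ otherwise; $\rho_r(c_m^* )=X_{-m}$ if $m\le0$ and $r=0$, and $\rho_r(c_m^* )=-\partial/\partial X_{-m}$ otherwise. With $r$ fixed and $\rho_r$ suppressed, set $$\alpha(z)=\sum_n a_nz^{-n-1},\quad \alpha^*(z)=\sum_n a_n^*z^{-n},\quad \alpha^1(z)=\sum_n a_n^1z^{-n-1},\quad \alpha^{1*}(z)=\sum_n a_n^{1*}z^{-n}.$$ **Normal ordering.** $:a(z)b(w):\,=a(z)_+b(w)+b(w)a(z)_-$; longer products are defined recursively by $:a^1\cdots a^k:\,=\,:a^1(:a^2(\cdots):):$, followed by setting all variables equal. For $r=0$ the usual ordering is used: for $a(z)=\sum_m a_{(m)}z^{-m-1}$, $a(z)_-=\sum_{m\ge0}a_{(m)}z^{-m-1}$ and $a(z)_+=\sum_{m<0}a_{(m)}z^{-m-1}$ (thus $\alpha^*(z)_-=\sum_{n\ge1}a^*_nz^{-n}$,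 and similarly for $\alpha^{1*}$). For $r=1$ the natural ordering is used: $\alpha_+=\alpha$, $\alpha_-=0$, $\alpha^1_+=\alpha^1$, $\alpha^1_-=0$, $\alpha^*_+=0$, $\alpha^*_-=\alpha^*$, $\alpha^{1*}_+=0$, $\alpha^{1*}_-=\alpha^{1*}$. **The Heisenberg part.** Let $\mathcal V=\mathbb C\mathbf v_0\oplus\mathbb C\mathbf v_1$, let $\lambda,\mu,\nu,\varkappa\in\mathbb C$, and let $B^1_{-1}\in\operatorname{End}(\mathcal V)$ be given by $B^1_{-1}\mathbf v_0=\mu\mathbf v_0+\nu\mathbf v_1$, $B^1_{-1}\mathbf v_1=\varkappa\mathbf v_0+\mu\mathbf v_1$. Let $\mathbb C[\mathbf y]=\mathbb C[y_{-n},y^1_{-m}\mid m,n\ge1]$. On $\mathbb C[\mathbf y]\otimes\mathcal V$ define, for $k>0$, \begin{align*} \rho(b_k)&=-y_{-k},\quad \rho(b_{-k})=-2k\chi_0\,\partial_{y_{-k}},\quad \rho(b_0)=\lambda,\quad \rho(b^1_{-k-1})=y^1_{-k-1},\\ \rho(b^1_k)&=-\left((2k+1)\partial_{y^1_{-k-1}}-4(k+1)b\,\partial_{y^1_{-k-2}}+(2k+3)\partial_{y^1_{-k-3}}\right)\chi_0,\\ \rho(b^1_0)&=-\left(\partial_{y^1_{-1}}-4b\,\partial_{y^1_{-2}}+3\,\partial_{y^1_{-3}}\right)\chi_0,\qquad \rho(b^1_{-1})=y^1_{-1}-\chi_0\partial_{y^1_{-2}}+B^1_{-1}. \end{align*}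 Set $\beta(z)=\sum_{n\in\mathbb Z}\rho(b_n)z^{-n-1}$ and $\beta^1(z)=\sum_{n\in\mathbb Z}\rho(b^1_n)z^{-n-1}$. The $\alpha$'s act on the factor $\mathbb C[\mathbf x]$, and $\beta,\beta^1$ act on $\mathbb C[\mathbf y]\otimes\mathcal V$.
   Formalization: For r=0 the coefficients of β(z)α*(z) send 1⊗v to an infinite sum of distinct monomials, so θ(e(z)) is undefined on C[x]⊗C[y]⊗V; for r=0 that space is replaced by a completion in the variables y_{-n} containing it. For r=1 the space is as stated. *)

theory Defs
  imports
    "HOL-Analysis.Analysis"
    "HOL-Library.Function_Algebras"
    "HOL-Library.Poly_Mapping"
begin

section \<open>The coordinate ring\<close>

type_synonym laurent = "int \<Rightarrow>\<^sub>0 complex"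

text \<open>The pair \<open>(p, q)\<close> stands for \<open>p + q u\<close>. The ring
  \<open>R = C[t, 1/t, u | u\<^sup>2 = t\<^sup>3 - 2 b t\<^sup>2 + t]\<close> is free over the Laurent polynomials with basis
  \<open>1, u\<close>; only the multiplication depends on \<open>b\<close>.\<close>
type_synonym coord = "laurent \<times> laurent"

text \<open>\<open>curve b\<close> is \<open>t\<^sup>3 - 2 b t\<^sup>2 + t\<close>. It also serves as the coefficient
  \<open>z (1 - 2 b z + z\<^sup>2)\<close> of the distributions below.\<close>
definition curve :: "complex \<Rightarrow> laurent" where
  "curve b = Poly_Mapping.single 3 1 + Poly_Mapping.single 2 (- 2 * b) + Poly_Mapping.single 1 1"

definition rmul :: "complex \<Rightarrow> coord \<Rightarrow> coord \<Rightarrow> coord" where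
  "rmul b x y = (fst x * fst y + curve b * snd x * snd y, fst x * snd y + snd x * fst y)"

definition rone :: coord where
  "rone = (1, 0)"

definition pscale :: "complex \<Rightarrow> ('a \<Rightarrow>\<^sub>0 complex) \<Rightarrow> ('a \<Rightarrow>\<^sub>0 complex)" where
  "pscale c = Poly_Mapping.map ((*) c)"

definition rscale :: "complex \<Rightarrow> coord \<Rightarrow> coord" where
  "rscale c x = (pscale c (fst x), pscale c (snd x))"

definition tpow :: "int \<Rightarrow> coord" where
  "tpow m = (Poly_Mapping.single m 1, 0)"

definition tupow :: "int \<Rightarrow> coord" where
  "tupow m = (0, Poly_Mapping.single m 1)"

section \<open>Differentials modulo exact forms\<close>

text \<open>The free complex vector space on the symbols \<open>p dq\<close> with \<open>p, q\<close> in \<open>R\<close>.\<close>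
type_synonym form = "(coord \<times> coord) \<Rightarrow>\<^sub>0 complex"

definition dform :: "coord \<Rightarrow> coord \<Rightarrow> form" where
  "dform p q = Poly_Mapping.single (p, q) 1"

text \<open>The subspace to be divided out. The rules \<open>left_add\<close> to \<open>leibniz\<close> present the module of
  Kaehler differentials of \<open>R\<close> over the complex numbers (they are stable under multiplication
  by \<open>R\<close> in the first argument, and \<open>dc = 0\<close> for a scalar \<open>c\<close> is a consequence);
  \<open>exact\<close> kills the image of \<open>d\<close>.\<close>
inductive_set trivial_forms :: "complex \<Rightarrow> form set" for b :: complex where
  zero: "0 \<in> trivial_forms b"
| add: "v \<in> trivial_forms b \<Longrightarrow> w \<in> trivial_forms b \<Longrightarrow> v + w \<in> trivial_forms b"
| scale: "w \<in> trivial_forms b \<Longrightarrow> pscale c w \<in> trivial_forms b"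
| left_add: "dform (p + p') q - dform p q - dform p' q \<in> trivial_forms b"
| left_scale: "dform (rscale c p) q - pscale c (dform p q) \<in> trivial_forms b"
| right_add: "dform p (q + q') - dform p q - dform p q' \<in> trivial_forms b"
| right_scale: "dform p (rscale c q) - pscale c (dform p q) \<in> trivial_forms b"
| leibniz: "dform p (rmul b q q') - dform (rmul b p q) q' - dform (rmul b p q') q \<in> trivial_forms b"
| exact: "dform rone q \<in> trivial_forms b"

definition cls :: "complex \<Rightarrow> form \<Rightarrow> form set" where
  "cls b w = {w'. w' - w \<in> trivial_forms b}"

definition Omega_mod_exact :: "complex \<Rightarrow> form set set" where
  "Omega_mod_exact b = range (cls b)"

definition omega_zero :: "complex \<Rightarrow> form set" where
  "omega_zero b = cls b (dform (tpow (- 1)) (tpow 1))"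

definition omega_minus :: "complex \<Rightarrow> form set" where
  "omega_minus b = cls b (dform (tupow (- 2)) (tpow 1))"

definition omega_plus :: "complex \<Rightarrow> form set" where
  "omega_plus b = cls b (dform (tupow (- 1)) (tpow 1))"

section \<open>The elliptic affine algebra\<close>

datatype sl2 = SE | SH | SF

fun sl2_mat :: "sl2 \<Rightarrow> complex^2^2" where
  "sl2_mat SE = vector [vector [0, 1], vector [0, 0]]"
| "sl2_mat SH = vector [vector [1, 0], vector [0, - 1]]"
| "sl2_mat SF = vector [vector [0, 0], vector [1, 0]]"

text \<open>Coordinates of a traceless matrix in the basis \<open>e, h, f\<close>.\<close>
fun sl2_coord :: "complex^2^2 \<Rightarrow> sl2 \<Rightarrow> complex" where
  "sl2_coord A SE = A $ 1 $ 2"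
| "sl2_coord A SH = A $ 1 $ 1"
| "sl2_coord A SF = A $ 2 $ 1"

definition sl2_br :: "sl2 \<Rightarrow> sl2 \<Rightarrow> sl2 \<Rightarrow> complex" where
  "sl2_br i j = sl2_coord (sl2_mat i ** sl2_mat j - sl2_mat j ** sl2_mat i)"

definition sl2_form :: "sl2 \<Rightarrow> sl2 \<Rightarrow> complex" where
  "sl2_form i j = trace (sl2_mat i ** sl2_mat j)"

record 'g lie_alg =
  lie_carrier :: "'g set"
  lie_add :: "'g \<Rightarrow> 'g \<Rightarrow> 'g"
  lie_scale :: "complex \<Rightarrow> 'g \<Rightarrow> 'g"
  lie_bracket :: "'g \<Rightarrow> 'g \<Rightarrow> 'g"

text \<open>A function \<open>A :: sl2 \<Rightarrow> coord\<close> stands for the tensor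
  \<open>e \<otimes> A SE + h \<otimes> A SH + f \<otimes> A SF\<close>; the second component is an element of the space
  of differentials modulo exact forms, that is, a coset of \<open>trivial_forms b\<close>.\<close>
type_synonym ghat = "(sl2 \<Rightarrow> coord) \<times> form set"

definition elliptic_affine :: "complex \<Rightarrow> ghat lie_alg" where
  "elliptic_affine b =
    \<lparr> lie_carrier = UNIV \<times> Omega_mod_exact b,
      lie_add = (\<lambda>(A, c) (A', c'). (A + A', \<Union>w\<in>c. \<Union>w'\<in>c'. cls b (w + w'))),
      lie_scale = (\<lambda>s (A, c). (\<lambda>i. rscale s (A i), \<Union>w\<in>c. cls b (pscale s w))),
      lie_bracket = (\<lambda>(A, c) (A', c').
        (\<lambda>k. \<Sum>i\<in>{SE, SH, SF}. \<Sum>j\<in>{SE, SH, SF}. rscale (sl2_br i j k) (rmul b (A i) (A' j)),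
         cls b (\<Sum>i\<in>{SE, SH, SF}. \<Sum>j\<in>{SE, SH, SF}. pscale (sl2_form i j) (dform (A i) (A' j))))) \<rparr>"

definition tensor :: "complex \<Rightarrow> sl2 \<Rightarrow> coord \<Rightarrow> ghat" where
  "tensor b x p = ((\<lambda>i. if i = x then p else 0), cls b 0)"

definition central :: "form set \<Rightarrow> ghat" where
  "central c = (0, c)"

text \<open>A formal distribution is given by the function sending \<open>n\<close> to its coefficient of \<open>z\<^sup>n\<close>
  (not of \<open>z\<^bsup>-n-1\<^esup>\<close>). These are \<open>x(z)\<close> and \<open>x\<^sup>1(z)\<close>.\<close>
definition current :: "complex \<Rightarrow> sl2 \<Rightarrow> int \<Rightarrow> ghat" where
  "current b x n = tensor b x (tpow (- n - 1))"

definition current1 :: "complex \<Rightarrow> sl2 \<Rightarrow> int \<Rightarrow> ghat" where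
  "current1 b x n = tensor b x (tupow (- n - 1))"

section \<open>Fock spaces\<close>

text \<open>\<open>X n\<close> and \<open>X1 n\<close> are \<open>x\<^sub>n\<close> and \<open>x\<^sup>1\<^sub>n\<close>. To have exactly the variables with index at most
  \<open>-1\<close>, \<open>Y k\<close> and \<open>Y1 k\<close> denote \<open>y\<close> and \<open>y\<^sup>1\<close> with index \<open>-k-1\<close>.\<close>
datatype var = X int | X1 int | Y nat | Y1 nat

text \<open>The variables \<open>y\<close>, \<open>y\<^sup>1\<close> with index \<open>-k\<close>, for \<open>k \<ge> 1\<close>.\<close>
definition yvar :: "int \<Rightarrow> var" where
  "yvar k = Y (nat (k - 1))"

definition y1var :: "int \<Rightarrow> var" where
  "y1var k = Y1 (nat (k - 1))"

type_synonym monomial = "var \<Rightarrow>\<^sub>0 nat"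

text \<open>Formal series in monomials with coefficients in \<open>V\<close>, where \<open>V\<close> is \<open>complex^2\<close> with
  basis \<open>v\<^sub>0 = axis 1 1\<close> and \<open>v\<^sub>1 = axis 2 1\<close>.\<close>
type_synonym series = "monomial \<Rightarrow> complex^2"

text \<open>\<open>C[x] \<otimes> C[y] \<otimes> V\<close>.\<close>
definition polynomials :: "series set" where
  "polynomials = {G. finite {M. G M \<noteq> 0}}"

fun is_neg_x :: "var \<Rightarrow> bool" where
  "is_neg_x (X n) = (n < 0)"
| "is_neg_x (X1 n) = (n < 0)"
| "is_neg_x (Y k) = False"
| "is_neg_x (Y1 k) = False"

fun is_y :: "var \<Rightarrow> bool" where
  "is_y (Y k) = True"
| "is_y _ = False"

definition mon_part :: "(var \<Rightarrow> bool) \<Rightarrow> monomial \<Rightarrow> var \<Rightarrow> nat" where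
  "mon_part S M v = (if S v then Poly_Mapping.lookup M v else 0)"

text \<open>Formal power series in the variables \<open>y\<close> alone, with coefficients polynomial in all other
  variables, and involving only finitely many monomials in the \<open>x\<^sub>n, x\<^sup>1\<^sub>n\<close> with \<open>n < 0\<close>.\<close>
definition y_completion :: "series set" where
  "y_completion = {G. finite (mon_part is_neg_x ` {M. G M \<noteq> 0}) \<and>
                      (\<forall>N. finite {M. G M \<noteq> 0 \<and> mon_part is_y M = N})}"

text \<open>The representation space is \<open>C[x] \<otimes> C[y] \<otimes> V\<close> for \<open>r = 1\<close>. For \<open>r = 0\<close> it is the
  completion of that space above: there \<open>b\<^sub>k = - y\<^bsub>-k\<^esub>\<close> for \<open>k > 0\<close> and
  \<open>a\<^sup>*\<^sub>n = x\<^bsub>-n\<^esub>\<close> for \<open>n \<le> 0\<close>, so each coefficient of \<open>\<beta>(z) \<alpha>\<^sup>*(z)\<close> sends a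
  constant to an infinite sum of distinct monomials (lemma \<open>beta_alphaS_not_polynomial\<close> below)
  and \<open>\<theta>(e(z))\<close> has no meaning on polynomials.\<close>
definition fock :: "nat \<Rightarrow> series set" where
  "fock r = (if r = 1 then polynomials else y_completion)"

lemma polynomials_subset_y_completion: "polynomials \<subseteq> y_completion"
  unfolding polynomials_def y_completion_def by auto

definition vscale :: "complex \<Rightarrow> series \<Rightarrow> series" where
  "vscale c G = (\<lambda>M. c *s G M)"

definition vmul :: "var \<Rightarrow> series \<Rightarrow> series" where
  "vmul v G = (\<lambda>M. if Poly_Mapping.lookup M v = 0 then 0 else G (M - Poly_Mapping.single v 1))"

definition vder :: "var \<Rightarrow> series \<Rightarrow> series" where
  "vder v G = (\<lambda>M. of_nat (Poly_Mapping.lookup M v + 1) *s G (M + Poly_Mapping.single v 1))"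

definition lie_rep :: "'g lie_alg \<Rightarrow> series set \<Rightarrow> ('g \<Rightarrow> series \<Rightarrow> series) \<Rightarrow> bool" where
  "lie_rep L W \<theta> \<longleftrightarrow>
    (\<forall>g\<in>lie_carrier L. \<forall>G\<in>W. \<theta> g G \<in> W) \<and>
    (\<forall>g\<in>lie_carrier L. \<forall>G\<in>W. \<forall>H\<in>W. \<theta> g (G + H) = \<theta> g G + \<theta> g H) \<and>
    (\<forall>g\<in>lie_carrier L. \<forall>c. \<forall>G\<in>W. \<theta> g (vscale c G) = vscale c (\<theta> g G)) \<and>
    (\<forall>g\<in>lie_carrier L. \<forall>h\<in>lie_carrier L. \<forall>G\<in>W. \<theta> (lie_add L g h) G = \<theta> g G + \<theta> h G) \<and>
    (\<forall>c. \<forall>g\<in>lie_carrier L. \<forall>G\<in>W. \<theta> (lie_scale L c g) G = vscale c (\<theta> g G)) \<and>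
    (\<forall>g\<in>lie_carrier L. \<forall>h\<in>lie_carrier L. \<forall>G\<in>W.
       \<theta> (lie_bracket L g h) G = \<theta> g (\<theta> h G) - \<theta> h (\<theta> g G))"

section \<open>The modes\<close>

text \<open>For \<open>Z = X\<close> (resp. \<open>X1\<close>) these are \<open>a\<^sub>m, a\<^sup>*\<^sub>m\<close> (resp. \<open>a\<^sup>1\<^sub>m, a\<^bsup>1*\<^esup>\<^sub>m\<close>)
  in the representation \<open>\<rho>\<^sub>r\<close>.\<close>
definition rho_a :: "nat \<Rightarrow> (int \<Rightarrow> var) \<Rightarrow> int \<Rightarrow> series \<Rightarrow> series" where
  "rho_a r Z m = (if m \<ge> 0 \<and> r = 0 then vder (Z m) else vmul (Z m))"

definition rho_aS :: "nat \<Rightarrow> (int \<Rightarrow> var) \<Rightarrow> int \<Rightarrow> series \<Rightarrow> series" where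
  "rho_aS r Z m = (if m \<le> 0 \<and> r = 0 then vmul (Z (- m)) else - vder (Z (- m)))"

definition rho_b :: "complex \<Rightarrow> complex \<Rightarrow> int \<Rightarrow> series \<Rightarrow> series" where
  "rho_b chi0 lam m =
    (if m > 0 then - vmul (yvar m)
     else if m < 0 then (\<lambda>G. vscale (- 2 * of_int (- m) * chi0) (vder (yvar (- m)) G))
     else vscale lam)"

text \<open>The endomorphism with \<open>v\<^sub>0 \<mapsto> \<mu> v\<^sub>0 + \<nu> v\<^sub>1\<close> and \<open>v\<^sub>1 \<mapsto> \<kappa> v\<^sub>0 + \<mu> v\<^sub>1\<close>.\<close>
definition B_op :: "complex \<Rightarrow> complex \<Rightarrow> complex \<Rightarrow> series \<Rightarrow> series" where
  "B_op \<mu> \<nu> \<kappa> G = (\<lambda>M. (vector [vector [\<mu>, \<kappa>], vector [\<nu>, \<mu>]] :: complex^2^2) *v G M)"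

text \<open>For \<open>m = 0\<close> the last formula is the one prescribed for \<open>b\<^sup>1\<^sub>0\<close>.\<close>
definition rho_b1 :: "complex \<Rightarrow> complex \<Rightarrow> complex \<Rightarrow> complex \<Rightarrow> complex \<Rightarrow> int \<Rightarrow> series \<Rightarrow> series"
  where
  "rho_b1 b chi0 \<mu> \<nu> \<kappa> m G =
    (if m \<le> - 2 then vmul (y1var (- m)) G
     else if m = - 1 then vmul (y1var 1) G - vscale chi0 (vder (y1var 2) G) + B_op \<mu> \<nu> \<kappa> G
     else - vscale chi0
            (vscale (of_int (2 * m + 1)) (vder (y1var (m + 1)) G)
             - vscale (4 * of_int (m + 1) * b) (vder (y1var (m + 2)) G)
             + vscale (of_int (2 * m + 3)) (vder (y1var (m + 3)) G)))"

section \<open>Formal distributions\<close>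

type_synonym distr = "int \<Rightarrow> series \<Rightarrow> series"

datatype bg_field = Alpha | Alpha1 | AlphaS | Alpha1S

fun field_distr :: "nat \<Rightarrow> bg_field \<Rightarrow> distr" where
  "field_distr r Alpha n = rho_a r X (- n - 1)"
| "field_distr r Alpha1 n = rho_a r X1 (- n - 1)"
| "field_distr r AlphaS n = rho_aS r X (- n)"
| "field_distr r Alpha1S n = rho_aS r X1 (- n)"

definition beta :: "complex \<Rightarrow> complex \<Rightarrow> distr" where
  "beta chi0 lam n = rho_b chi0 lam (- n - 1)"

definition beta1 :: "complex \<Rightarrow> complex \<Rightarrow> complex \<Rightarrow> complex \<Rightarrow> complex \<Rightarrow> distr" where
  "beta1 b chi0 \<mu> \<nu> \<kappa> n = rho_b1 b chi0 \<mu> \<nu> \<kappa> (- n - 1)"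

text \<open>Whether the coefficient of \<open>z\<^sup>n\<close> belongs to the plus part. In the usual ordering
  (\<open>r = 0\<close>) the minus part consists of the \<open>z\<^bsup>-m-1\<^esup>\<close> with \<open>m \<ge> 0\<close>, that is, of the negative powers.\<close>
definition in_plus :: "nat \<Rightarrow> bg_field \<Rightarrow> int \<Rightarrow> bool" where
  "in_plus r g n \<longleftrightarrow> (if r = 0 then n \<ge> 0 else g = Alpha \<or> g = Alpha1)"

definition plus_part :: "nat \<Rightarrow> bg_field \<Rightarrow> distr" where
  "plus_part r g n = (if in_plus r g n then field_distr r g n else 0)"

definition minus_part :: "nat \<Rightarrow> bg_field \<Rightarrow> distr" where
  "minus_part r g n = (if in_plus r g n then 0 else field_distr r g n)"

text \<open>\<open>nprod r [a\<^sub>1, \<dots>, a\<^sub>k] [n\<^sub>1, \<dots>, n\<^sub>k]\<close> is the coefficient of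
  \<open>z\<^sub>1^n\<^sub>1 \<dots> z\<^sub>k^n\<^sub>k\<close> in \<open>:a\<^sub>1(z\<^sub>1) \<dots> a\<^sub>k(z\<^sub>k):\<close>.\<close>
fun nprod :: "nat \<Rightarrow> bg_field list \<Rightarrow> int list \<Rightarrow> series \<Rightarrow> series" where
  "nprod r [g] [n] G = field_distr r g n G"
| "nprod r (g # g' # gs) (n # ns) G =
     plus_part r g n (nprod r (g' # gs) ns G) + nprod r (g' # gs) ns (minus_part r g n G)"
| "nprod r _ _ G = 0"

text \<open>The product without normal ordering, in two separate variables.\<close>
fun pair_prod :: "distr \<Rightarrow> distr \<Rightarrow> int list \<Rightarrow> series \<Rightarrow> series" where
  "pair_prod A B [m, n] G = A m (B n G)"
| "pair_prod A B _ G = 0"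

definition indices :: "nat \<Rightarrow> int \<Rightarrow> int list set" where
  "indices k n = {ns. length ns = k \<and> sum_list ns = n}"

text \<open>Setting all \<open>k\<close> variables equal to \<open>z\<close>: the infinite sum defining the coefficient of \<open>z\<^sup>n\<close>
  is taken coefficientwise in the monomials.\<close>
definition diag :: "nat \<Rightarrow> (int list \<Rightarrow> series \<Rightarrow> series) \<Rightarrow> distr" where
  "diag k D n G = (\<lambda>M. \<Sum>ns\<in>{ns \<in> indices k n. D ns G M \<noteq> 0}. D ns G M)"

text \<open>The sums in \<open>diag\<close> make sense on \<open>fock r\<close>: for \<open>r = 1\<close> only finitely many terms act
  nontrivially on a given vector; for \<open>r = 0\<close> only finitely many contribute to a given monomial.\<close>
definition diag_defined :: "nat \<Rightarrow> nat \<Rightarrow> (int list \<Rightarrow> series \<Rightarrow> series) \<Rightarrow> bool" where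
  "diag_defined r k D \<longleftrightarrow> (\<forall>n. \<forall>G\<in>fock r.
     (if r = 1 then finite {ns \<in> indices k n. D ns G \<noteq> 0}
      else \<forall>M. finite {ns \<in> indices k n. D ns G M \<noteq> 0}))"

definition nord :: "nat \<Rightarrow> bg_field list \<Rightarrow> distr" where
  "nord r gs = diag (length gs) (nprod r gs)"

definition dprod :: "distr \<Rightarrow> distr \<Rightarrow> distr" where
  "dprod A B = diag 2 (pair_prod A B)"

definition dscale :: "complex \<Rightarrow> distr \<Rightarrow> distr" where
  "dscale c A = (\<lambda>n G. vscale c (A n G))"

definition dz :: "distr \<Rightarrow> distr" where
  "dz A = (\<lambda>n G. vscale (of_int (n + 1)) (A (n + 1) G))"

definition lmult :: "laurent \<Rightarrow> distr \<Rightarrow> distr" where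
  "lmult p A = (\<lambda>n G. \<Sum>k\<in>Poly_Mapping.keys p. vscale (Poly_Mapping.lookup p k) (A (n - k) G))"

definition lderiv :: "laurent \<Rightarrow> laurent" where
  "lderiv p = (\<Sum>k\<in>Poly_Mapping.keys p.
     Poly_Mapping.single (k - 1) (of_int k * Poly_Mapping.lookup p k))"

definition const_series :: "complex^2 \<Rightarrow> series" where
  "const_series v = (\<lambda>M. if M = 0 then v else 0)"

lemma beta_alphaS_not_polynomial:
  assumes "v \<noteq> 0"
  shows "dprod (beta chi0 lam) (field_distr 0 AlphaS) n (const_series v) \<notin> polynomials"
proof -
  let ?D = "pair_prod (beta chi0 lam) (field_distr 0 AlphaS)"
  let ?A = "\<lambda>j. field_distr 0 AlphaS j (const_series v)"
  define mon where
    "mon k = Poly_Mapping.single (yvar k) (1::nat) + Poly_Mapping.single (X (n + k + 1)) 1" for k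
  have supp: "Poly_Mapping.lookup M (Y i) = 0" if "?A j M \<noteq> 0" for j i M
  proof (cases "j \<ge> 0")
    case True
    then have "M - Poly_Mapping.single (X j) 1 = 0"
      using that by (auto simp: rho_aS_def vmul_def const_series_def split: if_splits)
    then have "Poly_Mapping.lookup (M - Poly_Mapping.single (X j) 1) (Y i) = 0" by simp
    then show ?thesis by (simp add: lookup_minus lookup_single)
  next
    case False
    have "M + Poly_Mapping.single (X j) 1 \<noteq> 0"
    proof
      assume "M + Poly_Mapping.single (X j) 1 = 0"
      then have "Poly_Mapping.lookup (M + Poly_Mapping.single (X j) 1) (X j) = 0" by simp
      then show False by (simp add: lookup_add lookup_single)
    qed
    then show ?thesis using that False by (simp add: rho_aS_def vder_def const_series_def)
  qed
  have at_mon: "dprod (beta chi0 lam) (field_distr 0 AlphaS) n (const_series v) (mon k) = - v"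
    if k: "k > 0" "n + k + 1 \<ge> 0" for k
  proof -
    have y: "Poly_Mapping.lookup (mon k) (yvar k) = 1"
      by (simp add: mon_def lookup_add lookup_single yvar_def)
    have val: "?D [- k - 1, n + k + 1] (const_series v) (mon k) = - v"
    proof -
      have "?A (n + k + 1) = vmul (X (n + k + 1)) (const_series v)"
        unfolding field_distr.simps rho_aS_def minus_minus using k by (simp del: minus_add_distrib)
      moreover have "beta chi0 lam (- k - 1) = - vmul (yvar k)"
        using k by (simp add: beta_def rho_b_def)
      moreover have "mon k - Poly_Mapping.single (yvar k) 1 = Poly_Mapping.single (X (n + k + 1)) 1"
        by (simp add: mon_def)
      ultimately show ?thesis
        using y by (simp add: vmul_def const_series_def)
    qed
    have only: "ns = [- k - 1, n + k + 1]"
      if ns: "ns \<in> indices 2 n" "?D ns (const_series v) (mon k) \<noteq> 0" for ns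
    proof -
      obtain i j where ij: "ns = [i, j]" "i + j = n"
        using ns(1) by (auto simp: indices_def numeral_2_eq_2 length_Suc_conv)
      have nz: "rho_b chi0 lam (- i - 1) (?A j) (mon k) \<noteq> 0"
        using ns(2) ij by (simp add: beta_def)
      have y': "Poly_Mapping.lookup (mon k) (Y (nat (k - 1))) = 1"
        using y by (simp add: yvar_def)
      have z1: "?A j (mon k) = 0"
        using supp[of j "mon k" "nat (k - 1)"] y' by auto
      have z2: "?A j (mon k + Poly_Mapping.single w 1) = 0" for w
        using supp[of j "mon k + Poly_Mapping.single w 1" "nat (k - 1)"] y'
        by (auto simp: lookup_add)
      have "- i - 1 > 0"
        using nz z1 z2 by (auto simp: rho_b_def vscale_def vder_def split: if_splits)
      moreover from this have "Poly_Mapping.lookup (mon k) (yvar (- i - 1)) \<noteq> 0"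
        using nz by (auto simp: rho_b_def vmul_def split: if_splits)
      then have "yvar (- i - 1) = yvar k"
        by (auto simp: mon_def lookup_add lookup_single yvar_def when_def split: if_splits)
      ultimately have "- i - 1 = k" using k by (simp add: yvar_def nat_eq_iff)
      then show ?thesis using ij by auto
    qed
    have "{ns \<in> indices 2 n. ?D ns (const_series v) (mon k) \<noteq> 0} = {[- k - 1, n + k + 1]}"
      using only val assms by (auto simp: indices_def)
    then show ?thesis
      using val by (simp add: dprod_def diag_def)
  qed
  have "inj_on mon {k. k > 0 \<and> n + k + 1 \<ge> 0}"
  proof (rule inj_onI)
    fix k l
    assume kl: "k \<in> {k. k > 0 \<and> n + k + 1 \<ge> 0}" "l \<in> {k. k > 0 \<and> n + k + 1 \<ge> 0}" "mon k = mon l"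
    have "Poly_Mapping.lookup (mon k) (X (n + k + 1)) = 1"
      by (simp add: mon_def lookup_add lookup_single yvar_def)
    then have "Poly_Mapping.lookup (mon l) (X (n + k + 1)) = 1" using kl by simp
    then show "k = l"
      by (auto simp: mon_def lookup_add lookup_single yvar_def when_def split: if_splits)
  qed
  moreover have "infinite {k::int. k > 0 \<and> n + k + 1 \<ge> 0}"
  proof
    assume "finite {k::int. k > 0 \<and> n + k + 1 \<ge> 0}"
    then have "finite {\<bar>n\<bar> + 1..}" by (rule rev_finite_subset) auto
    then show False by (simp add: infinite_Ici)
  qed
  ultimately have "infinite (mon ` {k. k > 0 \<and> n + k + 1 \<ge> 0})"
    by (simp add: finite_image_iff)
  moreover have "mon ` {k. k > 0 \<and> n + k + 1 \<ge> 0} \<subseteq>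
      {M. dprod (beta chi0 lam) (field_distr 0 AlphaS) n (const_series v) M \<noteq> 0}"
    using at_mon assms by auto
  ultimately show ?thesis
    unfolding polynomials_def using finite_subset by blast
qed

end

theory Submission
  imports Defs
begin

text \<open>
  Write \<open>u\<^sup>2 = P(t)\<close>. The formulas become transparent over the ring \<open>R\<close>: put
  \<open>A = \<alpha>\<^sup>* + u \<alpha>\<^bsup>1*\<^esup>\<close> and, for \<open>p + q u\<close> in \<open>R\<close>, let \<open>\<alpha>(p + q u) = p \<alpha> + q \<alpha>\<^sup>1\<close>, and likewise for
  \<open>\<beta>\<close>. Up to normal ordering the currents at \<open>p\<close> are then \<open>f = - \<alpha>(p)\<close>, \<open>h = 2 \<alpha>(p A) + \<beta>(p)\<close> and
  \<open>e = \<alpha>(p A\<^sup>2) + \<beta>(p A) + \<kappa>\<^sub>0 (p dA)\<close>, where only the part of \<open>p dA\<close> without \<open>u\<close> is kept and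
  \<open>du = P' / (2 u) dz\<close>: this is the Wakimoto construction for \<open>sl\<^sub>2\<close>, with functions on the line
  replaced by functions on the double cover.

  Only two brackets have to be computed directly, \<open>[h, f]\<close> and \<open>[e, f]\<close>. As \<open>f\<close> is linear in the
  modes of \<open>\<alpha>\<close> and \<open>\<alpha>\<^sup>1\<close>, the bracket of a normally ordered product with \<open>f\<close> is a sum of single
  contractions and is again normally ordered (\<open>contract_nord_pair\<close>, \<open>contract_nord_triple\<close>,
  \<open>contract_dprod\<close>). The other brackets follow from these. The Jacobi identity shows that
  \<open>[h, h] - scalar\<close>, \<open>[h, e] - 2 e\<close> and \<open>[e, e]\<close> commute with all modes of \<open>\<alpha>\<close> and \<open>\<alpha>\<^sup>1\<close>. Give the
  variables by which these modes multiply the weight \<open>-1\<close>, and those with respect to which they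
  differentiate the weight \<open>1\<close>. An operator that commutes with these modes and raises
  the weight by a positive number is zero, and one that preserves the weight is zero once it vanishes
  on the vectors without \<open>x\<close>-variables (\<open>vanish\<close>). Since \<open>e\<close> has weight \<open>1\<close> and \<open>h\<close> has weight \<open>0\<close>,
  this disposes of \<open>[h, e]\<close> and \<open>[e, e]\<close>, and \<open>[h, h]\<close> has to be evaluated on vectors
  without \<open>x\<close>-variables only. There it consists of the Heisenberg relation of \<open>\<beta>, \<beta>\<^sup>1\<close>, of level \<open>\<chi>\<^sub>0\<close>, and of
  double contractions (\<open>vacuum_double_contraction\<close>), which are absent in the natural
  ordering and add \<open>4\<close> to the level in the usual one.

  The coefficients of the fields are infinite sums of operators, taken coefficientwise. The notion
  \<open>admissible\<close> collects what is needed for such a sum to be an operator on the Fock space, and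
  \<open>admissible_commute\<close> allows commutators with the modes of \<open>\<alpha>\<close> to be taken term by term.

  The centre acts through the residue at \<open>t = 0\<close> of the part without \<open>u\<close>, which is a
  functional on the differentials modulo exact forms. Conversely \<open>[e \<otimes> p, f \<otimes> q]\<close> is
  \<open>h \<otimes> p q\<close> plus the class of \<open>p dq\<close>, so the action of the currents determines that of the centre
  (\<open>representation_unique\<close>).
\<close>

abbreviation "lookup \<equiv> Poly_Mapping.lookup"
abbreviation "single \<equiv> Poly_Mapping.single"
abbreviation "keys \<equiv> Poly_Mapping.keys"

section \<open>Coefficientwise sums of series\<close>

lemma vscale_apply [simp]: "vscale c G M = c *s G M"
  by (simp add: vscale_def)

lemma vscale_simps [simp]:
  "vscale c 0 = 0" "vscale 0 G = 0" "vscale 1 G = G" "vscale c (vscale d G) = vscale (c * d) G"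
  by (auto simp: fun_eq_iff vec_eq_iff)

lemma vscale_distribs:
  "vscale c (G + H) = vscale c G + vscale c H" "vscale c (G - H) = vscale c G - vscale c H"
  "vscale (c + d) G = vscale c G + vscale d G" "vscale (c - d) G = vscale c G - vscale d G"
  "vscale (- c) G = - vscale c G" "vscale c (- G) = - vscale c G"
  by (auto simp: fun_eq_iff vec_eq_iff algebra_simps)

lemma sum_series_apply: "(sum f A :: series) M = (\<Sum>i\<in>A. f i M)"
  by (induction A rule: infinite_finite_induct) simp_all

lemma vscale_sum: "vscale c (sum f A) = (\<Sum>i\<in>A. vscale c (f i))"
  by (auto simp: fun_eq_iff vec_eq_iff sum_series_apply sum_distrib_left)

definition fsum :: "'i set \<Rightarrow> ('i \<Rightarrow> series) \<Rightarrow> series" where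
  "fsum I F = (\<lambda>M. \<Sum>i\<in>{i\<in>I. F i M \<noteq> 0}. F i M)"

definition fsummable :: "'i set \<Rightarrow> ('i \<Rightarrow> series) \<Rightarrow> bool" where
  "fsummable I F \<longleftrightarrow> (\<forall>M. finite {i\<in>I. F i M \<noteq> 0})"

lemma diag_eq_fsum: "diag k D n G = fsum (indices k n) (\<lambda>ns. D ns G)"
  by (simp add: diag_def fsum_def)

lemma fsum_eq_sum:
  assumes "finite S" "S \<subseteq> I" "\<And>i. i \<in> I \<Longrightarrow> F i M \<noteq> 0 \<Longrightarrow> i \<in> S"
  shows "fsum I F M = (\<Sum>i\<in>S. F i M)"
  unfolding fsum_def using assms by (intro sum.mono_neutral_left) auto

lemma minus_plus_single:
  assumes "lookup M v \<noteq> 0"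
  shows "M - single v 1 + single v 1 = (M :: 'a \<Rightarrow>\<^sub>0 nat)"
  using assms
  by (intro poly_mapping_eqI) (auto simp: lookup_add lookup_minus lookup_single when_def)

lemma fsum_eq_0: "(\<And>i. i \<in> I \<Longrightarrow> F i M = 0) \<Longrightarrow> fsum I F M = 0"
  by (auto simp: fsum_def)

lemma fsum_cong: "(\<And>i. i \<in> I \<Longrightarrow> F i = F' i) \<Longrightarrow> fsum I F = fsum I F'"
  unfolding fsum_def by (intro ext sum.cong) auto

lemma fsummable_cong: "(\<And>i. i \<in> I \<Longrightarrow> F i = F' i) \<Longrightarrow> fsummable I F = fsummable I F'"
  unfolding fsummable_def by (intro arg_cong[where f = All] ext arg_cong[where f = finite]) auto

lemma fsum_zero [simp]: "fsum I (\<lambda>i. 0) = 0"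
  by (simp add: fsum_def fun_eq_iff)

lemma fsummable_add:
  assumes "fsummable I F" "fsummable I F'"
  shows "fsummable I (\<lambda>i. F i + F' i)"
proof -
  have "{i\<in>I. (F i + F' i) M \<noteq> 0} \<subseteq> {i\<in>I. F i M \<noteq> 0} \<union> {i\<in>I. F' i M \<noteq> 0}" for M by auto
  then show ?thesis
    using assms unfolding fsummable_def by (meson finite_Un finite_subset)
qed

lemma fsummable_vscale: "fsummable I F \<Longrightarrow> fsummable I (\<lambda>i. vscale (c i) (F i))"
  unfolding fsummable_def
  by (intro allI, rule_tac B = "{i\<in>I. F i M \<noteq> 0}" in finite_subset) auto

lemma fsum_add:
  assumes "fsummable I F" "fsummable I F'"
  shows "fsum I (\<lambda>i. F i + F' i) = fsum I F + fsum I F'"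
proof
  fix M
  let ?S = "{i\<in>I. F i M \<noteq> 0} \<union> {i\<in>I. F' i M \<noteq> 0}"
  have fin: "finite ?S" using assms by (auto simp: fsummable_def)
  have "fsum I (\<lambda>i. F i + F' i) M = (\<Sum>i\<in>?S. (F i + F' i) M)"
    using fin by (intro fsum_eq_sum) auto
  moreover have "fsum I F M = (\<Sum>i\<in>?S. F i M)" "fsum I F' M = (\<Sum>i\<in>?S. F' i M)"
    using fin by (intro fsum_eq_sum; auto)+
  ultimately show "fsum I (\<lambda>i. F i + F' i) M = (fsum I F + fsum I F') M"
    by (simp add: sum.distrib)
qed

lemma fsum_reindex:
  assumes "inj_on h J" "h ` J \<subseteq> I" "\<And>i. i \<in> I \<Longrightarrow> i \<notin> h ` J \<Longrightarrow> F i = 0"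
  shows "fsum I F = fsum J (\<lambda>j. F (h j))"
proof
  fix M
  have "{i\<in>I. F i M \<noteq> 0} = h ` {j\<in>J. F (h j) M \<noteq> 0}"
  proof (intro set_eqI iffI)
    fix i assume i: "i \<in> {i\<in>I. F i M \<noteq> 0}"
    then have "i \<in> h ` J" using assms(3)[of i] by (metis (mono_tags) mem_Collect_eq zero_fun_apply)
    then show "i \<in> h ` {j\<in>J. F (h j) M \<noteq> 0}" using i by auto
  next
    fix i assume "i \<in> h ` {j\<in>J. F (h j) M \<noteq> 0}"
    then show "i \<in> {i\<in>I. F i M \<noteq> 0}" using assms(2) by auto
  qed
  moreover have "inj_on h {j\<in>J. F (h j) M \<noteq> 0}"
    using assms(1) by (rule inj_on_subset) auto
  ultimately show "fsum I F M = fsum J (\<lambda>j. F (h j)) M"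
    by (simp add: fsum_def sum.reindex)
qed

lemma fsum_one_term:
  assumes "i0 \<in> I" "\<And>i. i \<in> I \<Longrightarrow> i \<noteq> i0 \<Longrightarrow> F i = 0"
  shows "fsum I F = F i0"
proof -
  have "fsum I F = fsum {i0} F"
    using assms by (subst fsum_reindex[where h = id and J = "{i0}"]) auto
  also have "\<dots> = F i0"
  proof
    fix M
    show "fsum {i0} F M = F i0 M"
      by (subst fsum_eq_sum[where S = "{i0}"]) auto
  qed
  finally show ?thesis .
qed

lemma fsummable_reindex:
  assumes "fsummable J (\<lambda>j. F (h j))" "\<And>i. i \<in> I \<Longrightarrow> i \<notin> h ` J \<Longrightarrow> F i = 0"
  shows "fsummable I F"
  unfolding fsummable_def
proof
  fix M
  have "{i\<in>I. F i M \<noteq> 0} \<subseteq> h ` {j\<in>J. F (h j) M \<noteq> 0}"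
  proof
    fix i assume i: "i \<in> {i\<in>I. F i M \<noteq> 0}"
    then have "i \<in> h ` J" using assms(2)[of i] by (metis (mono_tags) mem_Collect_eq zero_fun_apply)
    then show "i \<in> h ` {j\<in>J. F (h j) M \<noteq> 0}" using i by auto
  qed
  then show "finite {i\<in>I. F i M \<noteq> 0}"
    using assms(1) unfolding fsummable_def by (meson finite_imageI finite_subset)
qed

text \<open>Multiplication by a variable and differentiation have this form, and an operator of this form can be
  exchanged with every coefficientwise sum.\<close>
definition local_op :: "(series \<Rightarrow> series) \<Rightarrow> bool" where
  "local_op A \<longleftrightarrow> (\<exists>c \<phi>. \<forall>G M. A G M = c M *s G (\<phi> M))"

lemma local_op_vmul: "local_op (vmul v)"
  unfolding local_op_def vmul_def
  by (rule exI[of _ "\<lambda>M. if lookup M v = 0 then 0 else 1"],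
      rule exI[of _ "\<lambda>M. M - single v 1"]) auto

lemma local_op_vder: "local_op (vder v)"
  unfolding local_op_def vder_def
  by (rule exI[of _ "\<lambda>M. of_nat (lookup M v + 1)"],
      rule exI[of _ "\<lambda>M. M + single v 1"]) simp

lemma local_op_uminus: "local_op A \<Longrightarrow> local_op (- A)"
proof -
  assume "local_op A"
  then obtain c \<phi> where "\<And>G M. A G M = c M *s G (\<phi> M)" unfolding local_op_def by blast
  then show ?thesis unfolding local_op_def
    by (intro exI[of _ "\<lambda>M. - c M"] exI[of _ \<phi>]) (auto simp: vec_eq_iff)
qed

lemma local_op_fsum:
  assumes "local_op A" "fsummable I F"
  shows "A (fsum I F) = fsum I (\<lambda>i. A (F i))" "fsummable I (\<lambda>i. A (F i))"
proof -
  obtain c \<phi> where A: "\<And>G M. A G M = c M *s G (\<phi> M)"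
    using assms(1) unfolding local_op_def by blast
  have fin: "finite {i\<in>I. F i M \<noteq> 0}" for M using assms(2) by (simp add: fsummable_def)
  show "A (fsum I F) = fsum I (\<lambda>i. A (F i))"
  proof
    fix M
    have "fsum I (\<lambda>i. A (F i)) M = (\<Sum>i\<in>{i\<in>I. F i (\<phi> M) \<noteq> 0}. A (F i) M)"
      using fin by (intro fsum_eq_sum) (auto simp: A)
    then show "A (fsum I F) M = fsum I (\<lambda>i. A (F i)) M"
      by (simp add: A fsum_def vec_eq_iff sum_distrib_left)
  qed
  show "fsummable I (\<lambda>i. A (F i))"
    unfolding fsummable_def
  proof
    fix M
    show "finite {i\<in>I. A (F i) M \<noteq> 0}"
      by (rule finite_subset[OF _ fin[of "\<phi> M"]]) (auto simp: A)
  qed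
qed

definition linear_op :: "(series \<Rightarrow> series) \<Rightarrow> bool" where
  "linear_op A \<longleftrightarrow> (\<forall>G H. A (G + H) = A G + A H) \<and> (\<forall>c G. A (vscale c G) = vscale c (A G))"

lemma linear_opD:
  assumes "linear_op A"
  shows "A (G + H) = A G + A H" "A (vscale c G) = vscale c (A G)" "A 0 = 0"
    "A (- G) = - A G" "A (G - H) = A G - A H"
proof -
  show add: "A (G + H) = A G + A H" for G H using assms by (auto simp: linear_op_def)
  show sc: "A (vscale c G) = vscale c (A G)" for c G using assms by (auto simp: linear_op_def)
  show "A 0 = 0" using sc[of 0 0] by simp
  have neg: "A (- G) = - A G" for G
    using sc[of "-1" G] by (simp add: vscale_distribs)
  show "A (- G) = - A G" by (rule neg)
  show "A (G - H) = A G - A H"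
    using add[of G "- H"] neg[of H] by simp
qed

lemma linear_op_local: "local_op A \<Longrightarrow> linear_op A"
  unfolding local_op_def linear_op_def by (auto simp: fun_eq_iff vec_eq_iff algebra_simps)

lemmas linear_op_vmul = linear_op_local[OF local_op_vmul]
  and linear_op_vder = linear_op_local[OF local_op_vder]
lemmas vmul_linear = linear_opD[OF linear_op_vmul] and vder_linear = linear_opD[OF linear_op_vder]

lemma linear_op_simple:
  "linear_op (vscale c)" "linear_op 0"
  "linear_op A \<Longrightarrow> linear_op (- A)"
  "linear_op A \<Longrightarrow> linear_op B \<Longrightarrow> linear_op (\<lambda>G. A (B G))"
  "linear_op A \<Longrightarrow> linear_op B \<Longrightarrow> linear_op (\<lambda>G. A G + B G)"
  "linear_op A \<Longrightarrow> linear_op B \<Longrightarrow> linear_op (\<lambda>G. A G - B G)"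
  "linear_op A \<Longrightarrow> linear_op (\<lambda>G. vscale c (A G))"
  "linear_op A \<Longrightarrow> linear_op (\<lambda>G. - A G)"
  by (auto simp: linear_op_def vscale_distribs mult.commute)

lemma vder_vmul:
  "vder v (vmul w G) = vmul w (vder v G) + (if v = w then G else 0)"
proof
  fix M
  let ?e = "\<lambda>v. single v (1::nat)"
  show "vder v (vmul w G) M = (vmul w (vder v G) + (if v = w then G else 0)) M"
  proof (cases "v = w")
    case True
    show ?thesis
    proof (cases "lookup M v = 0")
      case True
      with \<open>v = w\<close> show ?thesis by (auto simp: vder_def vmul_def lookup_add)
    next
      case False
      then have "M - ?e v + ?e v = M" by (rule minus_plus_single)
      moreover obtain k where "lookup M v = Suc k" using False not0_implies_Suc by blast
      ultimately show ?thesis using \<open>v = w\<close>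
        by (auto simp: vder_def vmul_def lookup_add lookup_minus vec_eq_iff algebra_simps)
    qed
  next
    case False
    have "M + ?e v - ?e w = M - ?e w + ?e v" if "lookup M w \<noteq> 0"
      using that False
      by (intro poly_mapping_eqI) (auto simp: lookup_add lookup_minus lookup_single when_def)
    then show ?thesis using False
      by (auto simp: vder_def vmul_def lookup_add lookup_minus lookup_single vec_eq_iff)
  qed
qed

lemma vmul_commute: "vmul v (vmul w G) = vmul w (vmul v G)"
proof
  fix M
  let ?e = "\<lambda>v. single v (1::nat)"
  have "M - ?e v - ?e w = M - ?e w - ?e v"
    by (intro poly_mapping_eqI) (auto simp: lookup_minus)
  then show "vmul v (vmul w G) M = vmul w (vmul v G) M"
    by (auto simp: vmul_def lookup_minus lookup_single when_def)
qed

lemma vder_commute: "vder v (vder w G) = vder w (vder v G)"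
  by (rule ext)
     (auto simp: vder_def lookup_add lookup_single when_def vec_eq_iff algebra_simps)

section \<open>Supports and weights in the Fock spaces\<close>

fun is_x :: "var \<Rightarrow> bool" where
  "is_x (X n) = True"
| "is_x (X1 n) = True"
| "is_x (Y k) = False"
| "is_x (Y1 k) = False"

text \<open>The \<open>x\<close>-variables by which the modes of \<open>\<alpha>\<close> and \<open>\<alpha>\<^sup>1\<close> multiply. With respect to the other
  \<open>x\<close>-variables they differentiate, and there it is \<open>\<alpha>\<^sup>*\<close> and \<open>\<alpha>\<^bsup>1*\<^esup>\<close> that multiply.\<close>
definition a_creation :: "nat \<Rightarrow> var \<Rightarrow> bool" where
  "a_creation r v \<longleftrightarrow> (if r = 0 then is_neg_x v else is_x v)"

definition aS_creation :: "nat \<Rightarrow> var \<Rightarrow> bool" where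
  "aS_creation r v \<longleftrightarrow> is_x v \<and> \<not> a_creation r v"

text \<open>For \<open>r = 1\<close> all monomials have the same \<open>y\<close>-part, so a finiteness condition on the monomials of given
  \<open>y\<close>-part is one on all monomials. This gives \<open>fock 0\<close> and \<open>fock 1\<close> a common description, \<open>fock_iff\<close>.\<close>
definition y_part :: "nat \<Rightarrow> monomial \<Rightarrow> var \<Rightarrow> nat" where
  "y_part r = mon_part (\<lambda>v. r = 0 \<and> is_y v)"

text \<open>A uniform bound in place of the finiteness of a set of partial monomials: products and derivatives
  inherit it, and whole families of vectors can share it.\<close>
definition a_bounded :: "nat \<Rightarrow> var set \<Rightarrow> nat \<Rightarrow> series \<Rightarrow> bool" where
  "a_bounded r F B G \<longleftrightarrow> (\<forall>M v. G M \<noteq> 0 \<longrightarrow> a_creation r v \<longrightarrow>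
     lookup M v \<le> B \<and> (lookup M v \<noteq> 0 \<longrightarrow> v \<in> F))"

lemma a_creation_is_x: "a_creation r v \<Longrightarrow> is_x v"
  by (cases v) (auto simp: a_creation_def split: if_splits)

lemma y_part_add_single:
  "y_part r (M + single v 1) =
   (\<lambda>w. y_part r M w + (if w = v \<and> r = 0 \<and> is_y v then 1 else 0))"
  by (auto simp: y_part_def mon_part_def lookup_add lookup_single when_def fun_eq_iff)

lemma y_part_add_single_other:
  "\<not> is_y v \<Longrightarrow> y_part r (M + single v 1) = y_part r M"
  unfolding y_part_add_single by (auto simp: fun_eq_iff)

lemma finite_a_parts_iff:
  "finite (mon_part (a_creation r) ` {M. G M \<noteq> 0}) \<longleftrightarrow> (\<exists>F B. finite F \<and> a_bounded r F B G)"
proof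
  assume "finite (mon_part (a_creation r) ` {M. G M \<noteq> 0})"
  then obtain A where A: "finite A"
    "mon_part (a_creation r) ` {M. G M \<noteq> 0} = mon_part (a_creation r) ` A"
    using finite_subset_image[OF _ subset_refl] by metis
  define F where "F = (\<Union>M\<in>A. keys M)"
  define B where "B = (\<Sum>M\<in>A. \<Sum>v\<in>keys M. lookup M v)"
  have "a_bounded r F B G"
    unfolding a_bounded_def
  proof (intro allI impI)
    fix M v assume M: "G M \<noteq> 0" "a_creation r v"
    then obtain M' where M': "M' \<in> A" "mon_part (a_creation r) M = mon_part (a_creation r) M'"
      using A(2) by blast
    have eq: "lookup M v = lookup M' v"
      using fun_cong[OF M'(2), of v] M(2) by (simp add: mon_part_def)
    have "lookup M' v \<le> B" if "lookup M' v \<noteq> 0"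
    proof -
      have "lookup M' v \<le> (\<Sum>v\<in>keys M'. lookup M' v)"
        using that by (intro member_le_sum) (auto simp: in_keys_iff)
      also have "\<dots> \<le> B"
        unfolding B_def using M'(1) A(1)
        by (intro member_le_sum[of M' A "\<lambda>M. \<Sum>v\<in>keys M. lookup M v"]) auto
      finally show ?thesis .
    qed
    then show "lookup M v \<le> B \<and> (lookup M v \<noteq> 0 \<longrightarrow> v \<in> F)"
      using eq M'(1) by (cases "lookup M' v = 0") (auto simp: F_def in_keys_iff)
  qed
  moreover have "finite F" using A(1) by (simp add: F_def)
  ultimately show "\<exists>F B. finite F \<and> a_bounded r F B G" by blast
next
  assume "\<exists>F B. finite F \<and> a_bounded r F B G"
  then obtain F B where FB: "finite F" "a_bounded r F B G" by blast
  have "mon_part (a_creation r) ` {M. G M \<noteq> 0} \<subseteq>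
      {f. \<forall>x. (x \<in> F \<longrightarrow> f x \<in> {..B}) \<and> (x \<notin> F \<longrightarrow> f x = 0)}"
  proof (intro subsetI CollectI allI)
    fix f v assume "f \<in> mon_part (a_creation r) ` {M. G M \<noteq> 0}"
    then obtain M where M: "G M \<noteq> 0" "f = mon_part (a_creation r) M" by blast
    show "(v \<in> F \<longrightarrow> f v \<in> {..B}) \<and> (v \<notin> F \<longrightarrow> f v = 0)"
      using FB(2)[unfolded a_bounded_def, rule_format, OF M(1), of v] M(2)
      by (auto simp: mon_part_def)
  qed
  then show "finite (mon_part (a_creation r) ` {M. G M \<noteq> 0})"
    by (rule finite_subset) (intro finite_set_of_finite_funs FB(1) finite_atMost)
qed

lemma fock_iff:
  assumes "r \<in> {0, 1}"
  shows "G \<in> fock r \<longleftrightarrow> (\<exists>F B. finite F \<and> a_bounded r F B G) \<and>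
    (\<forall>N. finite {M. G M \<noteq> 0 \<and> y_part r M = N})"
proof (cases "r = 0")
  case True
  have "a_creation 0 = is_neg_x" by (auto simp: a_creation_def fun_eq_iff)
  then show ?thesis
    using True by (simp add: fock_def y_completion_def y_part_def finite_a_parts_iff[of 0, symmetric, simplified])
next
  case False
  have y: "y_part 1 M = (\<lambda>_. 0)" for M by (simp add: y_part_def mon_part_def fun_eq_iff)
  have "(\<forall>N. finite {M. G M \<noteq> 0 \<and> y_part r M = N}) \<longleftrightarrow> finite {M. G M \<noteq> 0}"
  proof
    assume "\<forall>N. finite {M. G M \<noteq> 0 \<and> y_part r M = N}"
    then have "finite {M. G M \<noteq> 0 \<and> y_part r M = (\<lambda>_. 0)}" by blast
    then show "finite {M. G M \<noteq> 0}" using False assms y by simp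
  qed (auto elim: rev_finite_subset)
  moreover have "\<exists>F B. finite F \<and> a_bounded r F B G" if "finite {M. G M \<noteq> 0}"
    unfolding finite_a_parts_iff[symmetric] using that by (rule finite_imageI)
  moreover have "G \<in> fock r \<longleftrightarrow> finite {M. G M \<noteq> 0}"
    using False assms by (simp add: fock_def polynomials_def)
  ultimately show ?thesis by argo
qed

lemma a_boundedD:
  "a_bounded r F B G \<Longrightarrow> G M \<noteq> 0 \<Longrightarrow> a_creation r v \<Longrightarrow>
     lookup M v \<le> B \<and> (lookup M v \<noteq> 0 \<longrightarrow> v \<in> F)"
  unfolding a_bounded_def by blast

lemma a_boundedI:
  "(\<And>M v. G M \<noteq> 0 \<Longrightarrow> a_creation r v \<Longrightarrow>
     lookup M v \<le> B \<and> (lookup M v \<noteq> 0 \<longrightarrow> v \<in> F)) \<Longrightarrow> a_bounded r F B G"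
  unfolding a_bounded_def by blast

lemma a_bounded_mono:
  "a_bounded r F B G \<Longrightarrow> F \<subseteq> F' \<Longrightarrow> B \<le> B' \<Longrightarrow> a_bounded r F' B' G"
  by (rule a_boundedI) (use a_boundedD[of r F B G] order_trans in blast)

lemma a_bounded_vmul:
  assumes "a_bounded r F B G"
  shows "a_bounded r (insert v F) (B + 1) (vmul v G)"
  unfolding a_bounded_def
proof (intro allI impI)
  fix M w assume "vmul v G M \<noteq> 0" and w: "a_creation r w"
  then have "G (M - single v 1) \<noteq> 0" by (auto simp: vmul_def split: if_splits)
  then have "lookup (M - single v 1) w \<le> B"
    "lookup (M - single v 1) w \<noteq> 0 \<Longrightarrow> w \<in> F"
    using assms w unfolding a_bounded_def by blast+
  then show "lookup M w \<le> B + 1 \<and> (lookup M w \<noteq> 0 \<longrightarrow> w \<in> insert v F)"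
    by (auto simp: lookup_minus lookup_single when_def split: if_splits)
qed

lemma a_bounded_vmul_other:
  assumes "a_bounded r F B G" "\<not> a_creation r v"
  shows "a_bounded r F B (vmul v G)"
  unfolding a_bounded_def
proof (intro allI impI)
  fix M w assume "vmul v G M \<noteq> 0" and w: "a_creation r w"
  then have "G (M - single v 1) \<noteq> 0" by (auto simp: vmul_def split: if_splits)
  moreover have "w \<noteq> v" using w assms(2) by blast
  ultimately show "lookup M w \<le> B \<and> (lookup M w \<noteq> 0 \<longrightarrow> w \<in> F)"
    using a_boundedD[OF assms(1) _ w, of "M - single v 1"]
    by (auto simp: lookup_minus lookup_single when_def)
qed

lemma a_bounded_vder:
  assumes "a_bounded r F B G"
  shows "a_bounded r F B (vder v G)"
  unfolding a_bounded_def
proof (intro allI impI)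
  fix M w assume "vder v G M \<noteq> 0" and w: "a_creation r w"
  then have "G (M + single v 1) \<noteq> 0" by (auto simp: vder_def)
  from a_boundedD[OF assms this w]
  show "lookup M w \<le> B \<and> (lookup M w \<noteq> 0 \<longrightarrow> w \<in> F)"
    by (simp add: lookup_add)
qed

lemma a_bounded_zero [simp]: "a_bounded r F B 0"
  by (simp add: a_bounded_def)

lemma a_bounded_uminus: "a_bounded r F B G \<Longrightarrow> a_bounded r F B (- G)"
  by (auto simp: a_bounded_def)

lemma a_bounded_add: "a_bounded r F B G \<Longrightarrow> a_bounded r F B H \<Longrightarrow> a_bounded r F B (G + H)"
  unfolding a_bounded_def by (metis add.right_neutral plus_fun_apply)

context
  fixes r :: nat
  assumes r: "r \<in> {0, 1}"
begin

lemma fock_support: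
  assumes "G \<in> fock r" "\<And>M. H M \<noteq> 0 \<Longrightarrow> G M \<noteq> 0"
  shows "H \<in> fock r"
proof -
  obtain F B where FB: "finite F" "a_bounded r F B G"
    and fin: "\<And>N. finite {M. G M \<noteq> 0 \<and> y_part r M = N}"
    using assms(1) unfolding fock_iff[OF r] by blast
  have "finite {M. H M \<noteq> 0 \<and> y_part r M = N}" for N
    using fin[of N] by (rule rev_finite_subset) (use assms(2) in auto)
  moreover have "a_bounded r F B H"
    using FB(2) assms(2) by (auto simp: a_bounded_def)
  ultimately show ?thesis unfolding fock_iff[OF r] using FB(1) by blast
qed

lemma fock_zero: "0 \<in> fock r"
  unfolding fock_iff[OF r] by (auto simp: a_bounded_def)

lemma fock_vscale: "G \<in> fock r \<Longrightarrow> vscale c G \<in> fock r"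
  by (erule fock_support) auto

lemma fock_uminus: "G \<in> fock r \<Longrightarrow> - G \<in> fock r"
  by (erule fock_support) auto

lemma fock_add:
  assumes "G \<in> fock r" "H \<in> fock r"
  shows "G + H \<in> fock r"
proof -
  obtain F B F' B' where FB: "finite F" "a_bounded r F B G" "finite F'" "a_bounded r F' B' H"
    using assms unfolding fock_iff[OF r] by blast
  have "a_bounded r (F \<union> F') (B + B') (G + H)"
    using a_bounded_mono[OF FB(2), of "F \<union> F'" "B + B'"] a_bounded_mono[OF FB(4), of "F \<union> F'" "B + B'"]
    by (intro a_bounded_add) auto
  moreover have "finite {M. (G + H) M \<noteq> 0 \<and> y_part r M = N}" for N
  proof (rule finite_subset)
    show "{M. (G + H) M \<noteq> 0 \<and> y_part r M = N} \<subseteq>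
      {M. G M \<noteq> 0 \<and> y_part r M = N} \<union> {M. H M \<noteq> 0 \<and> y_part r M = N}" by auto
    show "finite ({M. G M \<noteq> 0 \<and> y_part r M = N} \<union> {M. H M \<noteq> 0 \<and> y_part r M = N})"
      using assms unfolding fock_iff[OF r] by blast
  qed
  ultimately show ?thesis using FB unfolding fock_iff[OF r] by blast
qed

lemma fock_diff: "G \<in> fock r \<Longrightarrow> H \<in> fock r \<Longrightarrow> G - H \<in> fock r"
  using fock_add[of G "- H"] fock_uminus[of H] by simp

lemma fock_sum: "(\<And>i. i \<in> A \<Longrightarrow> f i \<in> fock r) \<Longrightarrow> sum f A \<in> fock r"
  by (induction A rule: infinite_finite_induct) (auto simp: fock_zero fock_add)

lemma fock_vmul:
  assumes "G \<in> fock r"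
  shows "vmul v G \<in> fock r"
proof -
  obtain F B where FB: "finite F" "a_bounded r F B G" using assms unfolding fock_iff[OF r] by blast
  have "finite {M. vmul v G M \<noteq> 0 \<and> y_part r M = N}" for N
  proof (rule finite_subset)
    let ?N = "\<lambda>w. N w - (if w = v \<and> r = 0 \<and> is_y v then 1 else 0)"
    show "{M. vmul v G M \<noteq> 0 \<and> y_part r M = N} \<subseteq>
      (\<lambda>M. M + single v 1) ` {M. G M \<noteq> 0 \<and> y_part r M = ?N}"
    proof
      fix M assume M: "M \<in> {M. vmul v G M \<noteq> 0 \<and> y_part r M = N}"
      let ?M = "M - single v 1"
      have nz: "lookup M v \<noteq> 0" "G ?M \<noteq> 0"
        using M by (auto simp: vmul_def split: if_splits)
      have eq: "M = ?M + single v 1" using minus_plus_single[OF nz(1)] by simp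
      have "N = y_part r (?M + single v 1)" using M eq by simp
      then have "y_part r ?M = ?N" unfolding y_part_add_single by (auto simp: fun_eq_iff)
      then show "M \<in> (\<lambda>M. M + single v 1) ` {M. G M \<noteq> 0 \<and> y_part r M = ?N}"
        using eq nz(2) by blast
    qed
    show "finite ((\<lambda>M. M + single v 1) ` {M. G M \<noteq> 0 \<and> y_part r M = ?N})"
      using assms unfolding fock_iff[OF r] by blast
  qed
  then show ?thesis
    unfolding fock_iff[OF r] using a_bounded_vmul[OF FB(2)] FB(1) by blast
qed

lemma fock_shift:
  assumes "G \<in> fock r" "\<And>M. H M \<noteq> 0 \<Longrightarrow> G (M + single v 1) \<noteq> 0"
  shows "H \<in> fock r"
proof -
  obtain F B where FB: "finite F" "a_bounded r F B G" using assms unfolding fock_iff[OF r] by blast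
  have "a_bounded r F B H"
    unfolding a_bounded_def
  proof (intro allI impI)
    fix M w assume "H M \<noteq> 0" and w: "a_creation r w"
    then have "G (M + single v 1) \<noteq> 0" using assms(2) by blast
    from a_boundedD[OF FB(2) this w]
    show "lookup M w \<le> B \<and> (lookup M w \<noteq> 0 \<longrightarrow> w \<in> F)"
      by (simp add: lookup_add)
  qed
  moreover have "finite {M. H M \<noteq> 0 \<and> y_part r M = N}" for N
  proof (rule finite_subset)
    let ?N = "\<lambda>w. N w + (if w = v \<and> r = 0 \<and> is_y v then 1 else 0)"
    show "{M. H M \<noteq> 0 \<and> y_part r M = N} \<subseteq>
      (\<lambda>M. M + single v 1) -` {M. G M \<noteq> 0 \<and> y_part r M = ?N}"
      using assms(2) by (auto simp: y_part_add_single fun_eq_iff simp del: One_nat_def)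
    show "finite ((\<lambda>M. M + single v 1) -` {M. G M \<noteq> 0 \<and> y_part r M = ?N})"
      using assms(1) unfolding fock_iff[OF r] by (intro finite_vimageI) (auto simp: inj_def)
  qed
  ultimately show ?thesis unfolding fock_iff[OF r] using FB(1) by blast
qed

lemma fock_vder: "G \<in> fock r \<Longrightarrow> vder v G \<in> fock r"
  by (erule fock_shift[where v = v]) (auto simp: vder_def)

end

text \<open>Modes of \<open>\<alpha>\<close> and \<open>\<alpha>\<^sup>1\<close> lower the weight by one, whether they multiply or differentiate, and
  modes of \<open>\<alpha>\<^sup>*\<close> and \<open>\<alpha>\<^bsup>1*\<^esup>\<close> raise it by one.\<close>
definition weight :: "nat \<Rightarrow> monomial \<Rightarrow> int" where
  "weight r M = (\<Sum>v\<in>keys M.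
     (if aS_creation r v then 1 else if a_creation r v then - 1 else 0) * int (lookup M v))"

lemma weight_add: "weight r (M + M') = weight r M + weight r M'"
proof -
  let ?s = "\<lambda>v. if aS_creation r v then 1 else if a_creation r v then - 1 else (0::int)"
  let ?K = "keys M \<union> keys M'"
  have *: "weight r L = (\<Sum>v\<in>?K. ?s v * int (lookup L v))"
    if "keys L \<subseteq> ?K" for L
    unfolding weight_def using that by (intro sum.mono_neutral_left) (auto simp: in_keys_iff)
  show ?thesis
    using keys_add[of M M'] by (subst (1 2 3) *) (auto simp: lookup_add algebra_simps sum.distrib)
qed

lemma weight_single:
  "weight r (single v 1) =
     (if aS_creation r v then 1 else if a_creation r v then - 1 else 0)"
  by (simp add: weight_def)

definition weight_part :: "nat \<Rightarrow> int \<Rightarrow> series \<Rightarrow> series" where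
  "weight_part r w G = (\<lambda>M. if weight r M = w then G M else 0)"

lemma weight_part_linear: "linear_op (weight_part r w)"
  by (auto simp: linear_op_def weight_part_def fun_eq_iff)

lemma fock_weight_part: "r \<in> {0, 1} \<Longrightarrow> G \<in> fock r \<Longrightarrow> weight_part r w G \<in> fock r"
  by (rule fock_support[of r G]) (auto simp: weight_part_def split: if_splits)

lemma weight_part_vmul:
  "vmul v (weight_part r w G) = weight_part r (w + weight r (single v 1)) (vmul v G)"
proof
  fix M
  let ?e = "single v (1::nat)"
  have "weight r M = weight r (M - ?e) + weight r ?e" if "lookup M v \<noteq> 0"
  proof -
    have "M = M - ?e + ?e" using minus_plus_single[OF that] by simp
    then show ?thesis by (metis weight_add)
  qed
  then show "vmul v (weight_part r w G) M =
      weight_part r (w + weight r (single v 1)) (vmul v G) M"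
    by (auto simp: weight_part_def vmul_def)
qed

lemma weight_part_vder:
  "vder v (weight_part r w G) = weight_part r (w - weight r (single v 1)) (vder v G)"
  by (auto simp: fun_eq_iff weight_part_def vder_def weight_add)

section \<open>Modes of the fields\<close>

fun star :: "bg_field \<Rightarrow> bool" where
  "star Alpha = False"
| "star Alpha1 = False"
| "star AlphaS = True"
| "star Alpha1S = True"

fun sheet :: "bg_field \<Rightarrow> int \<Rightarrow> var" where
  "sheet Alpha = X"
| "sheet Alpha1 = X1"
| "sheet AlphaS = X"
| "sheet Alpha1S = X1"

text \<open>The variable that occurs in the coefficient of \<open>z\<^sup>n\<close>. The shift is due to \<open>\<alpha>(z)\<close> having the mode
  number \<open>-n-1\<close> there, and \<open>\<alpha>\<^sup>*(z)\<close> the mode number \<open>-n\<close>.\<close>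
definition mode_var :: "bg_field \<Rightarrow> int \<Rightarrow> var" where
  "mode_var g n = sheet g (if star g then n else - n - 1)"

lemma sheet_inject: "sheet g m = sheet g' n \<longleftrightarrow> sheet g = sheet g' \<and> m = n"
  by (cases g; cases g') (auto dest: fun_cong)

lemma mode_var_is_x [simp]: "is_x (mode_var g n)" "\<not> is_y (mode_var g n)"
  by (cases g; simp add: mode_var_def)+

lemma mode_var_star_eq:
  "star s \<Longrightarrow> \<not> star g \<Longrightarrow> mode_var s n = mode_var g m \<longleftrightarrow> sheet s = sheet g \<and> n + m = - 1"
  by (auto simp: mode_var_def sheet_inject)

text \<open>Both Fock representations and both orderings are covered by one rule: the modes in the plus part
  multiply and the others differentiate.\<close>
lemma field_distr_eq:
  "r \<in> {0, 1} \<Longrightarrow> field_distr r g n =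
     (if in_plus r g n then vmul (mode_var g n)
      else if star g then - vder (mode_var g n) else vder (mode_var g n))"
  by (cases g) (auto simp: rho_a_def rho_aS_def in_plus_def mode_var_def)

lemma mode_var_creation:
  assumes "r \<in> {0, 1}"
  shows "a_creation r (mode_var g n) \<longleftrightarrow> (star g \<longleftrightarrow> \<not> in_plus r g n)"
    and "aS_creation r (mode_var g n) \<longleftrightarrow> (star g \<longleftrightarrow> in_plus r g n)"
  using assms
  by (cases g; auto simp: a_creation_def aS_creation_def mode_var_def in_plus_def)+

lemma weight_mode_var:
  "r \<in> {0, 1} \<Longrightarrow>
   weight r (single (mode_var g n) 1) = (if star g \<longleftrightarrow> in_plus r g n then 1 else - 1)"
  unfolding weight_single mode_var_creation by auto

lemma vder_vmul_commute:
  "v \<noteq> w \<Longrightarrow> vder v (vmul w G) = vmul w (vder v G)"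
  "v \<noteq> w \<Longrightarrow> vmul w (vder v G) = vder v (vmul w G)"
  by (simp_all add: vder_vmul)

lemma plus_minus: "plus_part r g n G + minus_part r g n G = field_distr r g n G"
  by (simp add: plus_part_def minus_part_def)

context
  fixes r :: nat
  assumes r: "r \<in> {0, 1}"
begin

lemma local_op_field: "local_op (field_distr r g n)"
  unfolding field_distr_eq[OF r] by (auto intro: local_op_vmul local_op_vder local_op_uminus)

lemma linear_op_field: "linear_op (field_distr r g n)"
  by (rule linear_op_local[OF local_op_field])

lemma fock_field: "G \<in> fock r \<Longrightarrow> field_distr r g n G \<in> fock r"
  unfolding field_distr_eq[OF r] by (auto intro: fock_vmul[OF r] fock_vder[OF r] fock_uminus[OF r] simp: uminus_apply[of "vder v" for v])

lemma linear_op_parts: "linear_op (plus_part r g n)" "linear_op (minus_part r g n)"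
  unfolding plus_part_def minus_part_def by (auto intro: linear_op_field linear_op_simple)

lemma fock_parts:
  "G \<in> fock r \<Longrightarrow> plus_part r g n G \<in> fock r" "G \<in> fock r \<Longrightarrow> minus_part r g n G \<in> fock r"
  unfolding plus_part_def minus_part_def by (auto intro: fock_field fock_zero[OF r])

lemma alpha_alpha_commute:
  assumes "\<not> star g" "\<not> star g'"
  shows "field_distr r g m (field_distr r g' n G) = field_distr r g' n (field_distr r g m G)"
proof -
  have "mode_var g m \<noteq> mode_var g' n" if "in_plus r g m \<noteq> in_plus r g' n"
    using that assms mode_var_creation(1)[OF r] by metis
  then show ?thesis using assms
    by (auto simp: field_distr_eq[OF r] vmul_commute vder_commute vder_vmul_commute(1))
qed

lemma alphaS_alphaS_commute:
  assumes "star g" "star g'"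
  shows "field_distr r g m (field_distr r g' n G) = field_distr r g' n (field_distr r g m G)"
proof -
  have "mode_var g m \<noteq> mode_var g' n" if "in_plus r g m \<noteq> in_plus r g' n"
    using that assms mode_var_creation(1)[OF r] by metis
  then show ?thesis using assms
    by (auto simp: field_distr_eq[OF r] vmul_commute vder_commute vder_vmul_commute(1)
        vmul_linear vder_linear)
qed

text \<open>Of two modes that involve the same variable exactly one multiplies, and in either case the sign in
  the definition of \<open>\<alpha>\<^sup>*\<close> makes the commutator \<open>-1\<close>.\<close>
lemma alphaS_alpha_commutator:
  assumes "star s" "\<not> star g"
  shows "field_distr r s n (field_distr r g m G) =
    field_distr r g m (field_distr r s n G) -
      (if sheet s = sheet g \<and> n + m = - 1 then G else 0)"
proof (cases "mode_var s n = mode_var g m")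
  case True
  then have "in_plus r s n \<noteq> in_plus r g m"
    using assms mode_var_creation(1)[OF r] by metis
  moreover have "sheet s = sheet g \<and> n + m = - 1"
    using True mode_var_star_eq[OF assms] by blast
  ultimately show ?thesis using assms True
    by (auto simp: field_distr_eq[OF r] vder_vmul vmul_linear)
next
  case False
  then have "\<not> (sheet s = sheet g \<and> n + m = - 1)"
    using mode_var_star_eq[OF assms] by blast
  then show ?thesis using assms False
    by (auto simp: field_distr_eq[OF r] vmul_commute vder_commute vder_vmul_commute(1)
        vmul_linear vder_linear)
qed

lemma alpha_parts_commute:
  assumes "\<not> star g" "\<not> star g'"
  shows "plus_part r g m (field_distr r g' n G) = field_distr r g' n (plus_part r g m G)"
    and "minus_part r g m (field_distr r g' n G) = field_distr r g' n (minus_part r g m G)"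
  using alpha_alpha_commute[OF assms] linear_opD(3)[OF linear_op_field]
  by (auto simp: plus_part_def minus_part_def)

lemma weight_part_field:
  "field_distr r g n (weight_part r w G) =
     weight_part r (w + (if star g then 1 else - 1)) (field_distr r g n G)"
  unfolding field_distr_eq[OF r]
  by (auto simp: weight_part_vmul weight_part_vder weight_mode_var[OF r]
      linear_opD(4)[OF weight_part_linear] simp del: One_nat_def)

lemma weight_part_parts:
  "plus_part r g n (weight_part r w G) =
     weight_part r (w + (if star g then 1 else - 1)) (plus_part r g n G)"
  "minus_part r g n (weight_part r w G) =
     weight_part r (w + (if star g then 1 else - 1)) (minus_part r g n G)"
  using weight_part_field linear_opD(3)[OF weight_part_linear]
  by (auto simp: plus_part_def minus_part_def)

section \<open>Normally ordered products of modes\<close>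

lemma nprod_induct [case_names single Cons other]:
  assumes "\<And>g n G. P [g] [n] G"
    "\<And>g g' gs n ns G. (\<And>G. P (g' # gs) ns G) \<Longrightarrow> P (g # g' # gs) (n # ns) G"
    "\<And>gs ns G. (\<And>G. nprod r gs ns G = 0) \<Longrightarrow> P gs ns G"
  shows "P gs ns G"
proof (induction gs arbitrary: ns G)
  case Nil
  show ?case by (rule assms(3)) (cases ns; simp)
next
  case (Cons g gs)
  show ?case
  proof (cases gs)
    case Nil
    show ?thesis
    proof (cases "\<exists>n. ns = [n]")
      case True
      then show ?thesis using Nil assms(1) by auto
    next
      case False
      then have "nprod r [g] ns G = 0" for G by (cases ns; cases "tl ns") auto
      then show ?thesis using Nil assms(3) by blast
    qed
  next
    case (Cons g' gs')
    show ?thesis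
    proof (cases ns)
      case Nil
      then show ?thesis using Cons by (auto intro: assms(3))
    next
      case (Cons n ns')
      then show ?thesis using \<open>gs = g' # gs'\<close> assms(2) Cons.IH by simp
    qed
  qed
qed

lemma linear_op_nprod: "linear_op (nprod r gs ns)"
proof -
  have "nprod r gs ns (G + H) = nprod r gs ns G + nprod r gs ns H \<and>
    nprod r gs ns (vscale c G) = vscale c (nprod r gs ns G)" for G H c
  proof (induction gs ns G arbitrary: H c rule: nprod_induct)
    case (Cons g g' gs n ns G)
    have IH: "nprod r (g' # gs) ns (G + H) = nprod r (g' # gs) ns G + nprod r (g' # gs) ns H"
      "nprod r (g' # gs) ns (vscale c G) = vscale c (nprod r (g' # gs) ns G)" for G H c
      using Cons by blast+
    show ?case
      by (simp only: nprod.simps IH linear_opD[OF linear_op_parts(1)]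
          linear_opD[OF linear_op_parts(2)] vscale_distribs ac_simps simp_thms)
  qed (simp_all add: linear_opD[OF linear_op_field])
  then show ?thesis by (simp add: linear_op_def)
qed

lemma fock_nprod: "G \<in> fock r \<Longrightarrow> nprod r gs ns G \<in> fock r"
  by (induction gs ns G rule: nprod_induct)
     (auto intro: fock_field fock_parts fock_add[OF r] fock_zero[OF r])

lemma weight_part_nprod:
  "nprod r gs ns (weight_part r w G) =
     weight_part r (w + (\<Sum>g\<leftarrow>gs. if star g then 1 else - 1)) (nprod r gs ns G)"
proof (induction gs ns G arbitrary: w rule: nprod_induct)
  case (Cons g g' gs n ns G)
  show ?case
    by (simp only: nprod.simps weight_part_parts Cons linear_opD(1)[OF weight_part_linear]
        list.map sum_list.Cons ac_simps)
qed (simp_all add: weight_part_field linear_opD[OF weight_part_linear])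

text \<open>A mode outside the plus part differentiates, so its variable has to be present in the vector. This is
  why only finitely many index lists contribute to a coefficient.\<close>
lemma nprod_support:
  assumes "nprod r gs ns G M \<noteq> 0"
  shows "length ns = length gs \<and> (\<exists>M'. G M' \<noteq> 0 \<and> y_part r M' = y_part r M \<and>
    (\<forall>(g, n)\<in>set (zip gs ns). in_plus r g n \<or> mode_var g n \<in> keys M'))"
  using assms
proof (induction gs ns G arbitrary: M rule: nprod_induct)
  case (single g n G)
  show ?case
  proof (cases "in_plus r g n")
    case True
    then have nz: "lookup M (mode_var g n) \<noteq> 0"
      "G (M - single (mode_var g n) 1) \<noteq> 0"
      using single by (auto simp: field_distr_eq[OF r] vmul_def split: if_splits)
    let ?M = "M - single (mode_var g n) 1"
    have "M = ?M + single (mode_var g n) 1"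
      using minus_plus_single[OF nz(1)] by simp
    then have "y_part r M = y_part r ?M"
      by (metis y_part_add_single_other mode_var_is_x(2))
    then show ?thesis using True nz(2) by (intro conjI exI[of _ ?M]) auto
  next
    case False
    let ?M = "M + single (mode_var g n) 1"
    have "G ?M \<noteq> 0"
      using single False by (auto simp: field_distr_eq[OF r] vder_def split: if_splits)
    moreover have "mode_var g n \<in> keys ?M"
      by (simp add: in_keys_iff lookup_add)
    moreover have "y_part r ?M = y_part r M" by (intro y_part_add_single_other mode_var_is_x)
    ultimately show ?thesis by (intro conjI exI[of _ ?M]) auto
  qed
next
  case (Cons g g' gs n ns G)
  have "plus_part r g n (nprod r (g' # gs) ns G) M \<noteq> 0 \<or>
      nprod r (g' # gs) ns (minus_part r g n G) M \<noteq> 0"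
    using Cons.prems by auto
  then show ?case
  proof
    assume *: "plus_part r g n (nprod r (g' # gs) ns G) M \<noteq> 0"
    let ?M = "M - single (mode_var g n) 1"
    have in_plus: "in_plus r g n" using * by (auto simp: plus_part_def split: if_splits)
    have nz: "lookup M (mode_var g n) \<noteq> 0" "nprod r (g' # gs) ns G ?M \<noteq> 0"
      using * in_plus by (auto simp: plus_part_def field_distr_eq[OF r] vmul_def split: if_splits)
    have "M = ?M + single (mode_var g n) 1"
      using minus_plus_single[OF nz(1)] by simp
    then have "y_part r M = y_part r ?M"
      by (metis y_part_add_single_other mode_var_is_x(2))
    then show ?thesis using Cons.IH[OF nz(2)] in_plus by auto
  next
    assume *: "nprod r (g' # gs) ns (minus_part r g n G) M \<noteq> 0"
    from Cons.IH[OF *] obtain M' where M': "length ns = length (g' # gs)"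
      "minus_part r g n G M' \<noteq> 0" "y_part r M' = y_part r M"
      "\<forall>(g, n)\<in>set (zip (g' # gs) ns). in_plus r g n \<or> mode_var g n \<in> keys M'"
      by blast
    have in_plus: "\<not> in_plus r g n" using M'(2) by (auto simp: minus_part_def split: if_splits)
    let ?M = "M' + single (mode_var g n) 1"
    have "G ?M \<noteq> 0"
      using M'(2) in_plus
      by (auto simp: minus_part_def field_distr_eq[OF r] vder_def split: if_splits)
    moreover have "keys M' \<subseteq> keys ?M" "mode_var g n \<in> keys ?M"
      by (auto simp: in_keys_iff lookup_add)
    moreover have "y_part r ?M = y_part r M"
      unfolding M'(3)[symmetric] by (intro y_part_add_single_other mode_var_is_x)
    ultimately show ?thesis using M'(1,4) by (intro conjI exI[of _ ?M]) auto
  qed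
qed auto

text \<open>If a mode of \<open>\<alpha>\<^sup>*\<close> multiplies, it is by a variable that \<open>a_bounded\<close> does not restrict.\<close>
lemma a_bounded_star_field:
  assumes "star s" "a_bounded r F B G"
  shows "a_bounded r F B (field_distr r s n G)"
proof (cases "in_plus r s n")
  case True
  then have "field_distr r s n G = vmul (mode_var s n) G" by (simp add: field_distr_eq[OF r])
  moreover have "\<not> a_creation r (mode_var s n)" using True assms(1) mode_var_creation[OF r] by blast
  ultimately show ?thesis using a_bounded_vmul_other assms(2) by metis
next
  case False
  then have "field_distr r s n G = - vder (mode_var s n) G"
    using assms(1) by (simp add: field_distr_eq[OF r])
  then show ?thesis using a_bounded_uminus[OF a_bounded_vder[OF assms(2)]] by simp
qed

lemma a_bounded_star_nprod:
  assumes "\<forall>s\<in>set gs. star s" "a_bounded r F B G"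
  shows "a_bounded r F B (nprod r gs ns G)"
  using assms
proof (induction gs ns G rule: nprod_induct)
  case (single g n G)
  then show ?case using a_bounded_star_field by simp
next
  case (Cons g g' gs n ns G)
  have *: "a_bounded r F B (plus_part r g n H)" "a_bounded r F B (minus_part r g n H)"
    if "a_bounded r F B H" for H
    using that Cons.prems a_bounded_star_field[of g F B H n]
    by (simp_all add: plus_part_def minus_part_def)
  have "a_bounded r F B (nprod r (g' # gs) ns H)" if "a_bounded r F B H" for H
    using Cons.IH[of H] Cons.prems(1) that by simp
  then show ?case using * Cons.prems(2) by (simp only: nprod.simps) (blast intro: a_bounded_add)
next
  case (other gs ns G)
  then show ?case using a_bounded_zero by metis
qed

end

section \<open>Families of operators that can be summed\<close>

text \<open>The two finiteness conditions make the sum over \<open>I\<close> an operator on the Fock space: the first one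
  concerns one \<open>y\<close>-part at a time, as in the definition of the completion, and the second one bounds the
  exponents of the variables of \<open>\<alpha>\<close> uniformly in \<open>i\<close>.\<close>
definition admissible :: "nat \<Rightarrow> 'i set \<Rightarrow> ('i \<Rightarrow> series \<Rightarrow> series) \<Rightarrow> bool" where
  "admissible r I D \<longleftrightarrow> (\<forall>i. linear_op (D i)) \<and> (\<forall>G\<in>fock r.
     (\<forall>i\<in>I. D i G \<in> fock r) \<and>
     (\<forall>N. finite {i\<in>I. \<exists>M. y_part r M = N \<and> D i G M \<noteq> 0}) \<and>
     (\<exists>F B. finite F \<and> (\<forall>i\<in>I. a_bounded r F B (D i G))))"

definition fock_op :: "nat \<Rightarrow> (series \<Rightarrow> series) \<Rightarrow> bool" where
  "fock_op r T \<longleftrightarrow> (\<forall>G\<in>fock r. T G \<in> fock r \<and> (\<forall>H\<in>fock r. T (G + H) = T G + T H) \<and>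
     (\<forall>c. T (vscale c G) = vscale c (T G)))"

lemma fock_op_linear_op: "linear_op T \<Longrightarrow> (\<And>G. G \<in> fock r \<Longrightarrow> T G \<in> fock r) \<Longrightarrow> fock_op r T"
  unfolding fock_op_def linear_op_def by blast

lemma fock_opI:
  assumes "\<And>G. G \<in> fock r \<Longrightarrow> T G \<in> fock r"
    "\<And>G H. G \<in> fock r \<Longrightarrow> H \<in> fock r \<Longrightarrow> T (G + H) = T G + T H"
    "\<And>c G. G \<in> fock r \<Longrightarrow> T (vscale c G) = vscale c (T G)"
  shows "fock_op r T"
  using assms unfolding fock_op_def by blast

context
  fixes r :: nat
  assumes r: "r \<in> {0, 1}"
begin

lemma fock_opD:
  assumes "fock_op r T" "G \<in> fock r"
  shows "T G \<in> fock r" "T (vscale c G) = vscale c (T G)" "T 0 = 0" "T (- G) = - T G"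
    "H \<in> fock r \<Longrightarrow> T (G + H) = T G + T H" "H \<in> fock r \<Longrightarrow> T (G - H) = T G - T H"
proof -
  show in_fock: "T G \<in> fock r" using assms by (simp add: fock_op_def)
  have sc: "T (vscale c G) = vscale c (T G)" if "G \<in> fock r" for c G
    using assms(1) that by (simp add: fock_op_def)
  show "T (vscale c G) = vscale c (T G)" by (rule sc[OF assms(2)])
  show "T 0 = 0" using sc[OF assms(2), of 0] by simp
  have neg: "T (- G) = - T G" if "G \<in> fock r" for G
    using sc[OF that, of "-1"] by (simp only: vscale_distribs vscale_simps)
  show "T (- G) = - T G" by (rule neg[OF assms(2)])
  have add: "T (G + H) = T G + T H" if "H \<in> fock r" for H
    using assms that by (simp add: fock_op_def)
  show "H \<in> fock r \<Longrightarrow> T (G + H) = T G + T H" by (rule add)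
  show "H \<in> fock r \<Longrightarrow> T (G - H) = T G - T H"
    using add[of "- H"] neg[of H] fock_uminus[OF r, of H] by simp
qed

lemma fock_op_sum_fock: 
  assumes "fock_op r T" "\<And>i. i \<in> S \<Longrightarrow> f i \<in> fock r"
  shows "T (sum f S) = (\<Sum>i\<in>S. T (f i))"
  using assms(2)
proof (induction S rule: infinite_finite_induct)
  case (insert i S)
  then have "T (f i + sum f S) = T (f i) + T (sum f S)"
    by (intro fock_opD(5)[OF assms(1)] fock_sum[OF r]) auto
  moreover have "T (sum f S) = (\<Sum>i\<in>S. T (f i))" using insert by blast
  ultimately show ?case unfolding sum.insert[OF insert(1,2)] by metis
qed (use fock_opD(3)[OF assms(1) fock_zero[OF r]] in auto)

lemma fock_op_comp: "fock_op r S \<Longrightarrow> fock_op r T \<Longrightarrow> fock_op r (\<lambda>G. S (T G))"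
  unfolding fock_op_def by metis

lemma fock_op_zero: "fock_op r (\<lambda>G. 0)"
  by (rule fock_opI) (auto intro: fock_zero[OF r])

lemma fock_op_add:
  assumes "fock_op r S" "fock_op r T"
  shows "fock_op r (\<lambda>G. S G + T G)"
proof (rule fock_opI)
  fix G assume G: "G \<in> fock r"
  show "S G + T G \<in> fock r" using fock_add[OF r] fock_opD(1) assms G by blast
  show "S (vscale c G) + T (vscale c G) = vscale c (S G + T G)" for c
    unfolding fock_opD(2)[OF assms(1) G] fock_opD(2)[OF assms(2) G] vscale_distribs by (rule refl)
  show "S (G + H) + T (G + H) = S G + T G + (S H + T H)" if "H \<in> fock r" for H
    unfolding fock_opD(5)[OF assms(1) G that] fock_opD(5)[OF assms(2) G that]
    by (simp only: ac_simps)
qed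

lemma fock_op_vscale:
  assumes "fock_op r S"
  shows "fock_op r (\<lambda>G. vscale c (S G))"
proof (rule fock_opI)
  fix G assume G: "G \<in> fock r"
  show "vscale c (S G) \<in> fock r" using fock_vscale[OF r] fock_opD(1) assms G by blast
  show "vscale c (S (vscale d G)) = vscale d (vscale c (S G))" for d
    unfolding fock_opD(2)[OF assms(1) G] vscale_simps by (simp only: mult.commute)
  show "vscale c (S (G + H)) = vscale c (S G) + vscale c (S H)" if "H \<in> fock r" for H
    unfolding fock_opD(5)[OF assms(1) G that] vscale_distribs by (rule refl)
qed

lemma fock_op_diff:
  assumes "fock_op r S" "fock_op r T"
  shows "fock_op r (\<lambda>G. S G - T G)"
  using fock_op_add[OF assms(1) fock_op_vscale[OF assms(2), of "-1"]]
  unfolding vscale_distribs vscale_simps by simp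

lemma fock_op_sum: "(\<And>i. i \<in> S \<Longrightarrow> fock_op r (T i)) \<Longrightarrow> fock_op r (\<lambda>G. \<Sum>i\<in>S. T i G)"
proof (induction S rule: infinite_finite_induct)
  case (insert i S)
  then have "fock_op r (\<lambda>G. T i G + (\<Sum>i\<in>S. T i G))" by (intro fock_op_add) auto
  then show ?case unfolding sum.insert[OF insert(1,2)] .
next
  case empty
  show ?case unfolding sum.empty by (rule fock_op_zero)
next
  case (infinite S)
  show ?case unfolding sum.infinite[OF infinite(1)] by (rule fock_op_zero)
qed

lemma admissible_fsummable:
  assumes "admissible r I D" "G \<in> fock r"
  shows "fsummable I (\<lambda>i. D i G)"
  unfolding fsummable_def
proof
  fix M
  have "finite {i\<in>I. \<exists>M'. y_part r M' = y_part r M \<and> D i G M' \<noteq> 0}"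
    using assms by (simp add: admissible_def)
  then show "finite {i\<in>I. D i G M \<noteq> 0}" by (rule rev_finite_subset) auto
qed

lemma admissible_fock_op:
  assumes D: "admissible r I D"
  shows "fock_op r (\<lambda>G. fsum I (\<lambda>i. D i G))"
  unfolding fock_op_def
proof (intro ballI conjI allI)
  fix G assume G: "G \<in> fock r"
  obtain F B where FB: "finite F" "\<forall>i\<in>I. a_bounded r F B (D i G)"
    using D G unfolding admissible_def by blast
  have nz: "\<exists>i\<in>I. D i G M \<noteq> 0" if "fsum I (\<lambda>i. D i G) M \<noteq> 0" for M
    using that fsum_eq_0[of I "\<lambda>i. D i G"] by blast
  have "a_bounded r F B (fsum I (\<lambda>i. D i G))"
    by (rule a_boundedI) (use nz FB(2) a_boundedD in blast)
  moreover have "finite {M. fsum I (\<lambda>i. D i G) M \<noteq> 0 \<and> y_part r M = N}" for N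
  proof (rule finite_subset)
    let ?S = "{i\<in>I. \<exists>M. y_part r M = N \<and> D i G M \<noteq> 0}"
    show "{M. fsum I (\<lambda>i. D i G) M \<noteq> 0 \<and> y_part r M = N} \<subseteq>
      (\<Union>i\<in>?S. {M. D i G M \<noteq> 0 \<and> y_part r M = N})" using nz by blast
    have "finite ?S" "\<forall>i\<in>I. D i G \<in> fock r" using D G unfolding admissible_def by blast+
    then show "finite (\<Union>i\<in>?S. {M. D i G M \<noteq> 0 \<and> y_part r M = N})"
      unfolding fock_iff[OF r] by blast
  qed
  ultimately show "fsum I (\<lambda>i. D i G) \<in> fock r"
    unfolding fock_iff[OF r] using FB(1) by blast
  show "fsum I (\<lambda>i. D i (G + H)) = fsum I (\<lambda>i. D i G) + fsum I (\<lambda>i. D i H)" if "H \<in> fock r" for H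
  proof -
    have "fsum I (\<lambda>i. D i (G + H)) = fsum I (\<lambda>i. D i G + D i H)"
      using D by (intro fsum_cong) (simp add: admissible_def linear_op_def)
    also have "\<dots> = fsum I (\<lambda>i. D i G) + fsum I (\<lambda>i. D i H)"
      by (intro fsum_add admissible_fsummable[OF D] G that)
    finally show ?thesis .
  qed
  show "fsum I (\<lambda>i. D i (vscale c G)) = vscale c (fsum I (\<lambda>i. D i G))" for c
  proof -
    have "local_op (vscale c)"
      unfolding local_op_def by (intro exI[of _ "\<lambda>_. c"] exI[of _ "\<lambda>M. M"]) simp
    then have "vscale c (fsum I (\<lambda>i. D i G)) = fsum I (\<lambda>i. vscale c (D i G))"
      using admissible_fsummable[OF D G] by (rule local_op_fsum)
    also have "\<dots> = fsum I (\<lambda>i. D i (vscale c G))"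
      using D by (intro fsum_cong) (simp add: admissible_def linear_op_def)
    finally show ?thesis by simp
  qed
qed

lemma diag_defined_of_admissible:
  assumes "\<And>n. admissible r (indices k n) D"
  shows "diag_defined r k D"
  unfolding diag_defined_def
proof (intro allI ballI)
  fix n G assume G: "G \<in> fock r"
  have "finite {ns \<in> indices k n. D ns G \<noteq> 0}" if "r = 1"
  proof -
    have "y_part r M = (\<lambda>_. 0)" for M using that by (simp add: y_part_def mon_part_def fun_eq_iff)
    then have "{ns \<in> indices k n. D ns G \<noteq> 0} \<subseteq>
        {ns \<in> indices k n. \<exists>M. y_part r M = (\<lambda>_. 0) \<and> D ns G M \<noteq> 0}"
      by (auto simp: fun_eq_iff)
    moreover have "finite {ns \<in> indices k n. \<exists>M. y_part r M = (\<lambda>_. 0) \<and> D ns G M \<noteq> 0}"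
      using assms[of n] G unfolding admissible_def by blast
    ultimately show ?thesis by (rule finite_subset)
  qed
  moreover have "finite {ns \<in> indices k n. D ns G M \<noteq> 0}" for M
    using admissible_fsummable[OF assms G] unfolding fsummable_def by blast
  ultimately show "if r = 1 then finite {ns \<in> indices k n. D ns G \<noteq> 0}
      else \<forall>M. finite {ns \<in> indices k n. D ns G M \<noteq> 0}" by simp
qed

text \<open>Commutators of the currents with the modes of \<open>\<alpha>\<close> can be computed term by term.\<close>
lemma admissible_commute:
  assumes "admissible r I D" "local_op A" "G \<in> fock r" "A G \<in> fock r"
    and K: "\<And>i. i \<in> I \<Longrightarrow> D i (A G) = A (D i G) + K i"
  shows "fsum I (\<lambda>i. D i (A G)) = A (fsum I (\<lambda>i. D i G)) + fsum I K"
proof -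
  have s1: "fsummable I (\<lambda>i. A (D i G))" "A (fsum I (\<lambda>i. D i G)) = fsum I (\<lambda>i. A (D i G))"
    using local_op_fsum[OF assms(2) admissible_fsummable[OF assms(1,3)]] by auto
  have s2: "fsummable I (\<lambda>i. D i (A G))" by (rule admissible_fsummable[OF assms(1,4)])
  have "fsummable I (\<lambda>i. D i (A G) + vscale (- 1) (A (D i G)))"
    by (intro fsummable_add s2 fsummable_vscale s1)
  then have "fsummable I K"
    by (rule fsummable_cong[THEN iffD1, rotated]) (simp add: K vscale_distribs(5))
  then show ?thesis
    unfolding s1(2) by (subst fsum_add[symmetric]) (auto intro: fsum_cong K s1)
qed

end

section \<open>Summability of the normally ordered products\<close>

lemma mode_bound:
  assumes "finite K"
  obtains B :: int where "B \<ge> 0" "\<And>g n. mode_var g n \<in> K \<Longrightarrow> \<bar>n\<bar> \<le> B"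
proof -
  define S where "S = (\<Union>g\<in>{Alpha, Alpha1, AlphaS, Alpha1S}. mode_var g -` K)"
  have "inj (mode_var g)" for g
    by (cases g) (auto simp: inj_def mode_var_def)
  then have fin: "finite S" unfolding S_def using assms by (intro finite_UN_I finite_vimageI) auto
  have "\<bar>n\<bar> \<le> (\<Sum>n\<in>S. \<bar>n\<bar>)" if "mode_var g n \<in> K" for g n
  proof -
    have "n \<in> S" using that by (cases g) (auto simp: S_def)
    then show ?thesis using fin by (intro member_le_sum) auto
  qed
  moreover have "(\<Sum>n\<in>S. \<bar>n\<bar>) \<ge> 0" by (simp add: sum_nonneg)
  ultimately show ?thesis using that by blast
qed

lemma sum_list_lower_bound:
  fixes xs :: "int list"
  assumes "\<And>x. x \<in> set xs \<Longrightarrow> - B \<le> x"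
  shows "- (B * int (length xs)) \<le> sum_list xs"
  using assms by (induction xs) (force simp: algebra_simps)+

lemma member_upper_bound:
  fixes xs :: "int list"
  assumes "B \<ge> 0" "\<And>x. x \<in> set xs \<Longrightarrow> - B \<le> x" "x \<in> set xs"
  shows "x \<le> sum_list xs + B * int (length xs)"
  using assms(2,3)
proof (induction xs)
  case (Cons y ys)
  have "- (B * int (length ys)) \<le> sum_list ys"
    using Cons.prems by (intro sum_list_lower_bound) auto
  then show ?case using Cons assms(1) by (force simp: algebra_simps)
qed simp

lemma sum_list_abs_bound:
  fixes xs :: "int list"
  assumes "\<And>x. x \<in> set xs \<Longrightarrow> \<bar>x\<bar> \<le> B"
  shows "\<bar>sum_list xs\<bar> \<le> B * int (length xs)"
  using assms by (induction xs) (force simp: algebra_simps)+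

text \<open>In the usual ordering the creation indices are bounded below; in the natural ordering only
  the first factor creates. In both cases, since the sum of the indices is given, a bound on the
  annihilating indices bounds all of them.\<close>
lemma indices_bound:
  assumes r: "r \<in> {0, 1}" and gs: "\<forall>s\<in>set ss. star s"
    and ns: "ns \<in> indices (length (g # ss)) n" and B: "B \<ge> 0"
    and small: "\<forall>(g, n)\<in>set (zip (g # ss) ns). in_plus r g n \<or> \<bar>n\<bar> \<le> B"
    and x: "x \<in> set ns"
  shows "\<bar>x\<bar> \<le> \<bar>n\<bar> + B * int (length (g # ss))"
proof -
  have len: "length ns = length (g # ss)" and sum: "sum_list ns = n"
    using ns by (auto simp: indices_def)
  show ?thesis
  proof (cases "r = 0")
    case True
    have low: "- B \<le> y" if y: "y \<in> set ns" for y
    proof -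
      obtain g' where "(g', y) \<in> set (zip (g # ss) ns)"
        by (rule in_set_impl_in_set_zip2[OF len[symmetric] y])
      then have "in_plus r g' y \<or> \<bar>y\<bar> \<le> B" using small by auto
      then show ?thesis using True B by (auto simp: in_plus_def)
    qed
    have "x \<le> n + B * int (length (g # ss))"
      using member_upper_bound[of B ns x] B low x sum len by auto
    moreover have "B \<le> B * int (length (g # ss))"
      using B mult_left_mono[of 1 "int (length (g # ss))" B] by simp
    ultimately show ?thesis using low[OF x] by linarith
  next
    case False
    obtain m ns' where ns': "ns = m # ns'" "length ns' = length ss" using len by (cases ns) auto
    have low: "\<bar>y\<bar> \<le> B" if y: "y \<in> set ns'" for y
    proof -
      obtain g' where g': "(g', y) \<in> set (zip ss ns')"
        by (rule in_set_impl_in_set_zip2[OF ns'(2)[symmetric] y])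
      then have "in_plus r g' y \<or> \<bar>y\<bar> \<le> B" "star g'"
        using small gs ns' by (auto dest: set_zip_leftD)
      then show ?thesis using False by (cases g') (auto simp: in_plus_def)
    qed
    have "\<bar>sum_list ns'\<bar> \<le> B * int (length ns')" by (intro sum_list_abs_bound low)
    moreover have "m = n - sum_list ns'" using sum ns' by simp
    moreover have "B * int (length ns') \<ge> 0" using B by simp
    moreover have "x = m \<or> \<bar>x\<bar> \<le> B" using x ns' low by auto
    ultimately show ?thesis using B ns' by (auto simp: algebra_simps)
  qed
qed

lemma nord_eq_fsum: "nord r gs n = (\<lambda>G. fsum (indices (length gs) n) (\<lambda>ns. nprod r gs ns G))"
  by (rule ext) (simp only: nord_def diag_eq_fsum)

lemma indices_2: "indices 2 n = (\<lambda>j. [n - j, j]) ` UNIV"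
proof (intro set_eqI iffI)
  fix ns assume "ns \<in> indices 2 n"
  then obtain i j where "ns = [i, j]" "i + j = n"
    by (auto simp: indices_def numeral_2_eq_2 length_Suc_conv)
  then show "ns \<in> (\<lambda>j. [n - j, j]) ` UNIV" by (auto intro!: image_eqI[of _ _ j])
qed (auto simp: indices_def)

context
  fixes r :: nat
  assumes r: "r \<in> {0, 1}"
begin

text \<open>The annihilating indices are bounded by \<open>nprod_support\<close>: for coefficients of given \<open>y\<close>-part, by the
  variables of finitely many monomials; for the exponents of the variables of \<open>\<alpha>\<close>, by the finite
  set of such variables in the vector, because the annihilating modes of \<open>\<alpha>\<^sup>*\<close>
  differentiate with respect to these. Then \<open>indices_bound\<close> applies.\<close>
lemma admissible_nprod:
  assumes g: "\<not> star g" and ss: "\<forall>s\<in>set ss. star s" "ss \<noteq> []"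
  shows "admissible r (indices (length (g # ss)) n) (nprod r (g # ss))"
  unfolding admissible_def
proof (intro conjI allI ballI)
  show "linear_op (nprod r (g # ss) ns)" for ns by (rule linear_op_nprod[OF r])
next
  fix G ns assume "G \<in> fock r"
  then show "nprod r (g # ss) ns G \<in> fock r" by (rule fock_nprod[OF r])
next
  fix G N assume G: "G \<in> fock r"
  let ?A = "{M. G M \<noteq> 0 \<and> y_part r M = N}"
  have "finite (\<Union>M\<in>?A. keys M)" using G unfolding fock_iff[OF r] by auto
  then obtain B where B: "B \<ge> 0" "\<And>g n. mode_var g n \<in> (\<Union>M\<in>?A. keys M) \<Longrightarrow> \<bar>n\<bar> \<le> B"
    using mode_bound by blast
  let ?C = "\<bar>n\<bar> + B * int (length (g # ss))"
  have "{ns \<in> indices (length (g # ss)) n. \<exists>M. y_part r M = N \<and> nprod r (g # ss) ns G M \<noteq> 0} \<subseteq>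
      {ns. set ns \<subseteq> {- ?C..?C} \<and> length ns = length (g # ss)}"
  proof clarify
    fix ns M
    assume ns: "ns \<in> indices (length (g # ss)) n" and N: "N = y_part r M"
      and nz: "nprod r (g # ss) ns G M \<noteq> 0"
    obtain M' where M': "G M' \<noteq> 0" "y_part r M' = y_part r M"
      "\<forall>(g, n)\<in>set (zip (g # ss) ns). in_plus r g n \<or> mode_var g n \<in> keys M'"
      using nprod_support[OF r nz] by blast
    have "M' \<in> ?A" using M' N by simp
    then have "\<forall>(g, n)\<in>set (zip (g # ss) ns). in_plus r g n \<or> \<bar>n\<bar> \<le> B" using M'(3) B(2) by fast
    then have "\<bar>x\<bar> \<le> ?C" if "x \<in> set ns" for x
      using indices_bound[OF r ss(1) ns B(1)] that by blast
    then have "set ns \<subseteq> {- ?C..?C}"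
      by (intro subsetI) (simp only: atLeastAtMost_iff abs_le_iff minus_le_iff)
    then show "set ns \<subseteq> {- ?C..?C} \<and> length ns = length (g # ss)"
      using ns by (simp add: indices_def)
  qed
  then show "finite {ns \<in> indices (length (g # ss)) n.
      \<exists>M. y_part r M = N \<and> nprod r (g # ss) ns G M \<noteq> 0}"
    by (rule finite_subset) (intro finite_lists_length_eq finite_atLeastAtMost_int)
next
  fix G assume G: "G \<in> fock r"
  obtain F b where F: "finite F" "a_bounded r F b G" using G unfolding fock_iff[OF r] by blast
  obtain B where B: "B \<ge> 0" "\<And>g n. mode_var g n \<in> F \<Longrightarrow> \<bar>n\<bar> \<le> B" using mode_bound[OF F(1)] by blast
  let ?C = "\<bar>n\<bar> + B * int (length (g # ss))"
  let ?F = "F \<union> mode_var g ` {- ?C..?C}"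
  have "a_bounded r ?F (b + 1) (nprod r (g # ss) ns G)" if ns: "ns \<in> indices (length (g # ss)) n" for ns
  proof -
    obtain m ns' where ns': "ns = m # ns'" using ns by (cases ns) (auto simp: indices_def)
    obtain s ss' where s: "ss = s # ss'" using ss(2) by (cases ss) auto
    have eq: "nprod r (g # ss) ns G =
        plus_part r g m (nprod r ss ns' G) + nprod r ss ns' (minus_part r g m G)"
      using ns' s by simp
    have "a_bounded r F b (minus_part r g m G)"
      using g F(2) by (simp add: minus_part_def field_distr_eq[OF r] a_bounded_vder)
    then have "a_bounded r F b (nprod r ss ns' (minus_part r g m G))"
      by (rule a_bounded_star_nprod[OF r ss(1)])
    moreover have "a_bounded r ?F (b + 1) (plus_part r g m (nprod r ss ns' G))"
    proof (cases "in_plus r g m \<and> nprod r ss ns' G \<noteq> 0")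
      case False
      then have "plus_part r g m (nprod r ss ns' G) = 0"
        using linear_opD(3)[OF linear_op_field[OF r]] by (auto simp: plus_part_def)
      then show ?thesis by (metis a_bounded_zero)
    next
      case True
      then obtain M where "nprod r ss ns' G M \<noteq> 0" by (auto simp: fun_eq_iff)
      from nprod_support[OF r this] obtain M' where M': "G M' \<noteq> 0"
        "\<forall>(g, n)\<in>set (zip ss ns'). in_plus r g n \<or> mode_var g n \<in> keys M'"
        by blast
      have "\<bar>y\<bar> \<le> B" if y: "(s', y) \<in> set (zip ss ns')" "\<not> in_plus r s' y" for s' y
      proof -
        have "star s'" using y(1) ss(1) by (auto dest: set_zip_leftD)
        then have "a_creation r (mode_var s' y)" using y(2) mode_var_creation(1)[OF r] by blast
        moreover have "lookup M' (mode_var s' y) \<noteq> 0"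
          using M'(2) y by (auto simp: in_keys_iff)
        ultimately have "mode_var s' y \<in> F" using a_boundedD[OF F(2) M'(1)] by blast
        then show ?thesis by (rule B(2))
      qed
      then have "\<forall>(g, n)\<in>set (zip (g # ss) ns). in_plus r g n \<or> \<bar>n\<bar> \<le> B" using True ns' by auto
      then have "\<bar>m\<bar> \<le> ?C" using indices_bound[OF r ss(1) ns B(1)] ns' by auto
      then have "mode_var g m \<in> ?F" by (auto simp: abs_le_iff)
      then have "insert (mode_var g m) F \<subseteq> ?F" by blast
      moreover have "a_bounded r (insert (mode_var g m) F) (b + 1) (vmul (mode_var g m) (nprod r ss ns' G))"
        by (intro a_bounded_vmul a_bounded_star_nprod[OF r ss(1)] F(2))
      ultimately have "a_bounded r ?F (b + 1) (vmul (mode_var g m) (nprod r ss ns' G))"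
        using a_bounded_mono by blast
      then show ?thesis using True by (simp add: plus_part_def field_distr_eq[OF r])
    qed
    ultimately show ?thesis
      unfolding eq by (intro a_bounded_add) (auto elim: a_bounded_mono)
  qed
  moreover have "finite ?F" using F(1) by simp
  ultimately show "\<exists>F b. finite F \<and>
      (\<forall>ns\<in>indices (length (g # ss)) n. a_bounded r F b (nprod r (g # ss) ns G))" by blast
qed

lemma fock_op_nord:
  assumes "\<not> star g" "\<forall>s\<in>set ss. star s" "ss \<noteq> []"
  shows "fock_op r (nord r (g # ss) n)"
  unfolding nord_eq_fsum by (rule admissible_fock_op[OF r admissible_nprod[OF assms]])

section \<open>Single contractions of normally ordered products\<close>

lemma nprod_pair:
  "nprod r [g, s] [m, n] G =
     plus_part r g m (field_distr r s n G) + field_distr r s n (minus_part r g m G)"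
  by simp

text \<open>The modes of \<open>\<alpha>\<^sup>*\<close> commute with each other, so only their position relative to the first factor matters.\<close>
lemma nprod_triple:
  assumes "star s" "star s'"
  shows "nprod r [g, s, s'] [m, n, n'] G =
    plus_part r g m (field_distr r s n (field_distr r s' n' G)) +
    field_distr r s n (field_distr r s' n' (minus_part r g m G))"
proof -
  have "nprod r [s, s'] [n, n'] H = field_distr r s n (field_distr r s' n' H)" for H
  proof -
    have "field_distr r s' n' (minus_part r s n H) = minus_part r s n (field_distr r s' n' H)"
      using alphaS_alphaS_commute[OF r assms(2,1)] linear_opD(3)[OF linear_op_field[OF r]]
      by (auto simp: minus_part_def)
    then show ?thesis unfolding nprod_pair using plus_minus by metis
  qed
  then show ?thesis by (simp del: nprod.simps(1) add: nprod.simps(2)[of r g s "[s']"])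
qed

text \<open>The plus and the minus part of the first factor receive the same scalar and recombine to the full mode,
  so the contraction of a normally ordered product is normally ordered.\<close>
lemma contract_nprod_pair:
  assumes "\<not> star g" "star s" "\<not> star a"
  shows "nprod r [g, s] [m, n] (field_distr r a k G) =
    field_distr r a k (nprod r [g, s] [m, n] G) +
    (if sheet s = sheet a \<and> n + k = - 1 then - field_distr r g m G else 0)"
proof -
  note lin = linear_opD[OF linear_op_field[OF r]] linear_opD[OF linear_op_parts(1)[OF r]]
    linear_opD[OF linear_op_parts(2)[OF r]]
  have "nprod r [g, s] [m, n] (field_distr r a k G) =
      plus_part r g m (field_distr r s n (field_distr r a k G)) +
      field_distr r s n (field_distr r a k (minus_part r g m G))"
    unfolding nprod_pair alpha_parts_commute(2)[OF r assms(1,3)] by (rule refl)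
  also have "\<dots> = field_distr r a k (nprod r [g, s] [m, n] G) -
      (if sheet s = sheet a \<and> n + k = - 1 then plus_part r g m G + minus_part r g m G else 0)"
    unfolding nprod_pair alphaS_alpha_commutator[OF r assms(2,3)] lin
      alpha_parts_commute(1)[OF r assms(1,3)] by (simp add: lin)
  finally show ?thesis unfolding plus_minus by simp
qed

lemma contract_nprod_triple:
  assumes "\<not> star g" "star s" "star s'" "\<not> star a"
  shows "nprod r [g, s, s'] [m, n, n'] (field_distr r a k G) =
    field_distr r a k (nprod r [g, s, s'] [m, n, n'] G) +
    ((if sheet s = sheet a \<and> n + k = - 1 then - nprod r [g, s'] [m, n'] G else 0) +
     (if sheet s' = sheet a \<and> n' + k = - 1 then - nprod r [g, s] [m, n] G else 0))"
proof -
  note lin = linear_opD[OF linear_op_field[OF r]] linear_opD[OF linear_op_parts(1)[OF r]]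
    linear_opD[OF linear_op_parts(2)[OF r]]
  let ?a = "field_distr r a k" and ?s = "field_distr r s n" and ?s' = "field_distr r s' n'"
  let ?c = "sheet s = sheet a \<and> n + k = - 1" and ?c' = "sheet s' = sheet a \<and> n' + k = - 1"
  have ss: "?s (?s' (?a H)) = ?a (?s (?s' H)) - ((if ?c then ?s' H else 0) + (if ?c' then ?s H else 0))" for H
    unfolding alphaS_alpha_commutator[OF r assms(3,4)] lin alphaS_alpha_commutator[OF r assms(2,4)] by (simp add: lin)
  have "nprod r [g, s, s'] [m, n, n'] (?a G) =
      plus_part r g m (?s (?s' (?a G))) + ?s (?s' (?a (minus_part r g m G)))"
    unfolding nprod_triple[OF assms(2,3)] alpha_parts_commute(2)[OF r assms(1,4)] by (rule refl)
  also have "\<dots> = ?a (nprod r [g, s, s'] [m, n, n'] G) +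
     ((if ?c then - nprod r [g, s'] [m, n'] G else 0) +
      (if ?c' then - nprod r [g, s] [m, n] G else 0))"
    unfolding ss nprod_triple[OF assms(2,3)] nprod_pair lin
      alpha_parts_commute(1)[OF r assms(1,4)]
    by (simp add: lin)
  finally show ?thesis .
qed

text \<open>In the sum over all indices at most one term has a contraction.\<close>
lemma contract_nord_pair:
  assumes "\<not> star g" "star s" "\<not> star a" and G: "G \<in> fock r"
  shows "nord r [g, s] n (field_distr r a k G) =
    field_distr r a k (nord r [g, s] n G) -
      (if sheet s = sheet a then field_distr r g (n + k + 1) G else 0)"
proof -
  let ?K = "\<lambda>ns. if sheet s = sheet a \<and> ns ! 1 + k = - 1 then - field_distr r g (ns ! 0) G else 0"
  have adm: "admissible r (indices (length [g, s]) n) (nprod r [g, s])"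
    using assms by (intro admissible_nprod) auto
  have "nord r [g, s] n (field_distr r a k G) =
      field_distr r a k (nord r [g, s] n G) + fsum (indices (length [g, s]) n) ?K"
    unfolding nord_eq_fsum
  proof (rule admissible_commute[OF r adm local_op_field[OF r] G fock_field[OF r G]])
    fix ns assume "ns \<in> indices (length [g, s]) n"
    then obtain i j where "ns = [i, j]" by (auto simp: indices_def length_Suc_conv)
    then show "nprod r [g, s] ns (field_distr r a k G) =
        field_distr r a k (nprod r [g, s] ns G) + ?K ns"
      using contract_nprod_pair[OF assms(1-3), of i j k G] by simp
  qed
  also have "fsum (indices (length [g, s]) n) ?K = ?K [n + k + 1, - k - 1]"
    by (rule fsum_one_term) (auto simp: indices_def length_Suc_conv)
  finally have eq: "nord r [g, s] n (field_distr r a k G) =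
      field_distr r a k (nord r [g, s] n G) + ?K [n + k + 1, - k - 1]" .
  show ?thesis unfolding eq by (cases "sheet s = sheet a") simp_all
qed

lemma contract_nord_triple:
  assumes "\<not> star g" "star s" "star s'" "\<not> star a" and G: "G \<in> fock r"
  shows "nord r [g, s, s'] n (field_distr r a k G) =
    field_distr r a k (nord r [g, s, s'] n G)
    - ((if sheet s = sheet a then nord r [g, s'] (n + k + 1) G else 0)
       + (if sheet s' = sheet a then nord r [g, s] (n + k + 1) G else 0))"
proof -
  let ?K1 = "\<lambda>ns. if sheet s = sheet a \<and> ns ! 1 + k = - 1 then - nprod r [g, s'] [ns ! 0, ns ! 2] G else 0"
  let ?K2 = "\<lambda>ns. if sheet s' = sheet a \<and> ns ! 2 + k = - 1 then - nprod r [g, s] [ns ! 0, ns ! 1] G else 0"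
  have adm: "admissible r (indices (length [g, s, s']) n) (nprod r [g, s, s'])"
    using assms by (intro admissible_nprod) auto
  have eq: "nord r [g, s, s'] n (field_distr r a k G) =
      field_distr r a k (nord r [g, s, s'] n G) +
      fsum (indices (length [g, s, s']) n) (\<lambda>ns. ?K1 ns + ?K2 ns)"
    unfolding nord_eq_fsum
  proof (rule admissible_commute[OF r adm local_op_field[OF r] G fock_field[OF r G]])
    fix ns assume "ns \<in> indices (length [g, s, s']) n"
    then obtain i j l where "ns = [i, j, l]" by (auto simp: indices_def length_Suc_conv)
    then show "nprod r [g, s, s'] ns (field_distr r a k G) =
        field_distr r a k (nprod r [g, s, s'] ns G) + (?K1 ns + ?K2 ns)"
      using contract_nprod_triple[OF assms(1-4), of i j l k G] by simp
  qed
  let ?I = "indices (length [g, s, s']) n" and ?N = "n + k + 1"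
  \<comment> \<open>Fixing the index of the contracted factor identifies the remaining terms with those of a product
    of two factors.\<close>
  have slice: "fsum ?I K = (if c then - nord r [g, t] ?N G else 0)" "fsummable ?I K"
    if t: "star t"
      and h: "inj_on h (indices (length [g, t]) ?N)" "h ` indices (length [g, t]) ?N \<subseteq> ?I"
      and out: "\<And>ns. ns \<in> ?I \<Longrightarrow> ns \<notin> h ` indices (length [g, t]) ?N \<Longrightarrow> K ns = 0"
      and on: "\<And>ns. ns \<in> indices (length [g, t]) ?N \<Longrightarrow>
        K (h ns) = (if c then - nprod r [g, t] ns G else 0)"
    for t K c and h :: "int list \<Rightarrow> int list"
  proof -
    let ?J = "indices (length [g, t]) ?N"
    have a: "admissible r ?J (nprod r [g, t])"
      using assms t by (intro admissible_nprod) auto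
    have lo: "local_op uminus"
      unfolding local_op_def
      by (intro exI[of _ "\<lambda>_. - 1"] exI[of _ "\<lambda>M. M"]) (auto simp: vec_eq_iff)
    have neg: "fsum ?J (\<lambda>ns. - nprod r [g, t] ns G) = - nord r [g, t] ?N G"
      "fsummable ?J (\<lambda>ns. - nprod r [g, t] ns G)"
      using local_op_fsum[OF lo admissible_fsummable[OF r a G]] unfolding nord_eq_fsum by simp_all
    have "fsum ?I K = fsum ?J (\<lambda>ns. K (h ns))"
      by (rule fsum_reindex[OF h out])
    also have "\<dots> = fsum ?J (\<lambda>ns. if c then - nprod r [g, t] ns G else 0)"
      by (rule fsum_cong) (rule on)
    finally show "fsum ?I K = (if c then - nord r [g, t] ?N G else 0)"
      using neg(1) by (cases c) simp_all
    have "fsummable ?J (\<lambda>ns. if c then - nprod r [g, t] ns G else 0)"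
      using neg(2) by (cases c) (simp_all add: fsummable_def)
    then have "fsummable ?J (\<lambda>ns. K (h ns))"
      by (rule fsummable_cong[THEN iffD1, rotated]) (simp add: on)
    then show "fsummable ?I K" using out by (rule fsummable_reindex)
  qed
  have 1: "fsum ?I ?K1 = (if sheet s = sheet a then - nord r [g, s'] ?N G else 0)" "fsummable ?I ?K1"
  proof -
    let ?h = "\<lambda>ns. [ns ! 0, - k - 1, ns ! 1]" and ?J = "indices (length [g, s']) ?N"
    have inj: "inj_on ?h ?J" by (auto simp: inj_on_def indices_def length_Suc_conv)
    have im: "?h ` ?J \<subseteq> ?I" by (auto simp: indices_def length_Suc_conv)
    have out: "?K1 ns = 0" if i: "ns \<in> ?I" "ns \<notin> ?h ` ?J" for ns
    proof -
      obtain i j l where ns: "ns = [i, j, l]" "i + (j + l) = n"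
        using i(1) by (auto simp: indices_def length_Suc_conv)
      have "ns = ?h [i, l] \<and> [i, l] \<in> ?J" if "j + k = - 1"
        using that ns by (auto simp: indices_def)
      then have "j + k \<noteq> - 1" using i(2) by blast
      then show ?thesis using ns by simp
    qed
    have on: "?K1 (?h ns) = (if sheet s = sheet a then - nprod r [g, s'] ns G else 0)"
      if "ns \<in> ?J" for ns
      using that by (auto simp: indices_def length_Suc_conv)
    show "fsum ?I ?K1 = (if sheet s = sheet a then - nord r [g, s'] ?N G else 0)" "fsummable ?I ?K1"
      by (rule slice[OF assms(3) inj im out on]; assumption)+
  qed
  have 2: "fsum ?I ?K2 = (if sheet s' = sheet a then - nord r [g, s] ?N G else 0)" "fsummable ?I ?K2"
  proof -
    let ?h = "\<lambda>ns. [ns ! 0, ns ! 1, - k - 1]" and ?J = "indices (length [g, s]) ?N"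
    have inj: "inj_on ?h ?J" by (auto simp: inj_on_def indices_def length_Suc_conv)
    have im: "?h ` ?J \<subseteq> ?I" by (auto simp: indices_def length_Suc_conv)
    have out: "?K2 ns = 0" if i: "ns \<in> ?I" "ns \<notin> ?h ` ?J" for ns
    proof -
      obtain i j l where ns: "ns = [i, j, l]" "i + (j + l) = n"
        using i(1) by (auto simp: indices_def length_Suc_conv)
      have "ns = ?h [i, j] \<and> [i, j] \<in> ?J" if "l + k = - 1"
        using that ns by (auto simp: indices_def)
      then have "l + k \<noteq> - 1" using i(2) by blast
      then show ?thesis using ns by simp
    qed
    have on: "?K2 (?h ns) = (if sheet s' = sheet a then - nprod r [g, s] ns G else 0)"
      if "ns \<in> ?J" for ns
      using that by (auto simp: indices_def length_Suc_conv)
    show "fsum ?I ?K2 = (if sheet s' = sheet a then - nord r [g, s] ?N G else 0)" "fsummable ?I ?K2"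
      by (rule slice[OF assms(2) inj im out on]; assumption)+
  qed
  show ?thesis
    unfolding eq fsum_add[OF 1(2) 2(2)] 1(1) 2(1) by auto
qed

end

section \<open>Operators on the Heisenberg variables\<close>

definition restrict_to :: "(monomial \<Rightarrow> bool) \<Rightarrow> series \<Rightarrow> series" where
  "restrict_to P G = (\<lambda>M. if P M then G M else 0)"

definition x_local :: "(monomial \<Rightarrow> bool) \<Rightarrow> bool" where
  "x_local P \<longleftrightarrow> (\<forall>M v. \<not> is_x v \<longrightarrow> P (M + single v 1) = P M)"

definition x_free :: "monomial \<Rightarrow> bool" where
  "x_free M \<longleftrightarrow> (\<forall>v. is_x v \<longrightarrow> lookup M v = 0)"

lemma x_local_x_free: "x_local x_free"
  by (auto simp: x_local_def x_free_def lookup_add lookup_single when_def)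

lemma x_local_weight: "x_local (\<lambda>M. weight r M = w)"
proof -
  have "weight r (single v 1) = 0" if "\<not> is_x v" for v
    using that a_creation_is_x by (auto simp: weight_single aS_creation_def simp del: One_nat_def)
  then show ?thesis by (simp add: x_local_def weight_add del: One_nat_def)
qed

lemma weight_part_eq_restrict: "weight_part r w = restrict_to (\<lambda>M. weight r M = w)"
  by (simp add: weight_part_def restrict_to_def fun_eq_iff)

text \<open>Operators that act on the factor \<open>C[y] \<otimes> V\<close> only. Commuting with the restriction to every set of
  monomials that is described by the \<open>x\<close>-variables says that their exponents are not changed; it
  yields bounds on exponents as well as homogeneity.\<close>
definition y_op :: "nat \<Rightarrow> (series \<Rightarrow> series) \<Rightarrow> bool" where
  "y_op r A \<longleftrightarrow> linear_op A \<and> (\<forall>G\<in>fock r. A G \<in> fock r) \<and>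
     (\<forall>v G. is_x v \<longrightarrow> A (vmul v G) = vmul v (A G) \<and> A (vder v G) = vder v (A G)) \<and>
     (\<forall>P G. x_local P \<longrightarrow> A (restrict_to P G) = restrict_to P (A G))"

lemma vmul_restrict_to:
  assumes "x_local P" "\<not> is_x v"
  shows "vmul v (restrict_to P G) = restrict_to P (vmul v G)"
proof
  fix M
  have "P (M - single v 1) = P M" if "lookup M v \<noteq> 0"
  proof -
    have "M = (M - single v 1) + single v 1"
      using minus_plus_single[OF that] by simp
    then show ?thesis using assms unfolding x_local_def by metis
  qed
  then show "vmul v (restrict_to P G) M = restrict_to P (vmul v G) M"
    by (auto simp: restrict_to_def vmul_def)
qed

lemma vder_restrict_to:
  assumes "x_local P" "\<not> is_x v"
  shows "vder v (restrict_to P G) = restrict_to P (vder v G)"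
  using assms by (auto simp: fun_eq_iff restrict_to_def vder_def x_local_def)

lemma restrict_to_linear: "linear_op (restrict_to P)"
  by (auto simp: linear_op_def restrict_to_def fun_eq_iff)

lemma B_op_linear: "linear_op (B_op \<mu> \<nu> \<kappa>)"
  by (auto simp: linear_op_def B_op_def fun_eq_iff matrix_vector_right_distrib vector_scalar_commute)

lemma B_op_commute: "B_op \<mu> \<nu> \<kappa> (vmul v G) = vmul v (B_op \<mu> \<nu> \<kappa> G)"
  "B_op \<mu> \<nu> \<kappa> (vder v G) = vder v (B_op \<mu> \<nu> \<kappa> G)"
  subgoal by (rule ext) (simp add: B_op_def vmul_def)
  subgoal unfolding B_op_def vder_def vector_scalar_commute by (rule refl)
  done

lemma dprod_eq_fsum:
  "dprod A B n = (\<lambda>G. fsum (indices 2 n) (\<lambda>ns. pair_prod A B ns G))"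
  by (rule ext) (simp only: dprod_def diag_eq_fsum)

context
  fixes r :: nat
  assumes r: "r \<in> {0, 1}"
begin

lemma y_op_vmul: "\<not> is_x v \<Longrightarrow> y_op r (vmul v)"
  unfolding y_op_def
  by (intro conjI ballI allI impI linear_op_vmul fock_vmul[OF r] vmul_commute vmul_restrict_to)
     (auto simp: vder_vmul)

lemma y_op_vder: "\<not> is_x v \<Longrightarrow> y_op r (vder v)"
  unfolding y_op_def
  by (intro conjI ballI allI impI linear_op_vder fock_vder[OF r] vder_commute vder_restrict_to)
     (auto simp: vder_vmul)

lemma y_op_vscale: "y_op r (vscale c)"
  unfolding y_op_def
  by (intro conjI ballI allI impI linear_op_simple(1) fock_vscale[OF r])
     (auto simp: vmul_linear vder_linear linear_opD[OF restrict_to_linear])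

lemma y_op_comp: "y_op r A \<Longrightarrow> y_op r B \<Longrightarrow> y_op r (\<lambda>G. A (B G))"
  unfolding y_op_def by (auto simp: linear_op_def)

lemma y_op_add: "y_op r A \<Longrightarrow> y_op r B \<Longrightarrow> y_op r (\<lambda>G. A G + B G)"
  unfolding y_op_def
  by (intro conjI ballI allI impI linear_op_simple(5) fock_add[OF r])
     (simp_all only: vmul_linear vder_linear linear_opD[OF restrict_to_linear])

lemma y_op_diff: "y_op r A \<Longrightarrow> y_op r B \<Longrightarrow> y_op r (\<lambda>G. A G - B G)"
  unfolding y_op_def
  by (intro conjI ballI allI impI linear_op_simple(6) fock_diff[OF r])
     (simp_all only: vmul_linear vder_linear linear_opD[OF restrict_to_linear])

lemma y_op_uminus: "y_op r A \<Longrightarrow> y_op r (- A)"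
  unfolding y_op_def
  by (intro conjI ballI allI impI linear_op_simple(3))
     (simp_all only: vmul_linear vder_linear linear_opD[OF restrict_to_linear] uminus_apply
       fock_uminus[OF r])

lemma y_op_vscale_comp: "y_op r A \<Longrightarrow> y_op r (\<lambda>G. vscale c (A G))"
  by (rule y_op_comp[OF y_op_vscale])

lemma y_op_B_op: "y_op r (B_op \<mu> \<nu> \<kappa>)"
  unfolding y_op_def
proof (intro conjI ballI allI impI B_op_linear B_op_commute)
  show "B_op \<mu> \<nu> \<kappa> G \<in> fock r" if "G \<in> fock r" for G
    by (rule fock_support[OF r that]) (auto simp: B_op_def)
  show "B_op \<mu> \<nu> \<kappa> (restrict_to P G) = restrict_to P (B_op \<mu> \<nu> \<kappa> G)" for P G
    by (auto simp: B_op_def restrict_to_def fun_eq_iff)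
qed

lemma yvar_not_x [simp]: "\<not> is_x (yvar k)" "\<not> is_x (y1var k)"
  by (simp_all add: yvar_def y1var_def)

lemma y_op_beta: "y_op r (beta chi0 lam n)"
  unfolding beta_def rho_b_def
  by (auto intro!: y_op_uminus y_op_vmul y_op_vscale y_op_vscale_comp y_op_vder)

lemma y_op_beta1: "y_op r (beta1 b chi0 \<mu> \<nu> \<kappa> n)"
proof -
  let ?m = "- n - 1"
  consider "?m \<le> - 2" | "?m = - 1" | "?m \<ge> 0" by linarith
  then show ?thesis
  proof cases
    case 1
    then have "beta1 b chi0 \<mu> \<nu> \<kappa> n = vmul (y1var (- ?m))"
      unfolding beta1_def by (intro ext) (simp add: rho_b1_def)
    then show ?thesis by (simp only:) (intro y_op_vmul, simp)
  next
    case 2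
    then have "beta1 b chi0 \<mu> \<nu> \<kappa> n =
        (\<lambda>G. vmul (y1var 1) G - vscale chi0 (vder (y1var 2) G) + B_op \<mu> \<nu> \<kappa> G)"
      unfolding beta1_def by (intro ext) (simp add: rho_b1_def)
    then show ?thesis
      by (simp only:) (intro y_op_add y_op_diff y_op_vmul y_op_vscale_comp y_op_vder y_op_B_op; simp)
  next
    case 3
    then have "beta1 b chi0 \<mu> \<nu> \<kappa> n = (\<lambda>G. vscale (- chi0)
            (vscale (of_int (2 * ?m + 1)) (vder (y1var (?m + 1)) G)
             - vscale (4 * of_int (?m + 1) * b) (vder (y1var (?m + 2)) G)
             + vscale (of_int (2 * ?m + 3)) (vder (y1var (?m + 3)) G)))"
      unfolding beta1_def rho_b1_def by (intro ext) (simp only: vscale_distribs, simp)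
    then show ?thesis
      by (simp only:) (intro y_op_add y_op_diff y_op_vscale_comp y_op_vder; simp)
  qed
qed

lemma y_opD:
  assumes "y_op r A"
  shows "linear_op A" "G \<in> fock r \<Longrightarrow> A G \<in> fock r"
    "is_x v \<Longrightarrow> A (vmul v G) = vmul v (A G)" "is_x v \<Longrightarrow> A (vder v G) = vder v (A G)"
    "x_local P \<Longrightarrow> A (restrict_to P G) = restrict_to P (A G)"
  using assms unfolding y_op_def by blast+

lemma y_op_fock_op: "y_op r A \<Longrightarrow> fock_op r A"
  using fock_op_linear_op y_opD by blast

lemma y_op_field: "y_op r A \<Longrightarrow> A (field_distr r g n G) = field_distr r g n (A G)"
  unfolding field_distr_eq[OF r]
  by (cases "in_plus r g n"; cases "star g")
     (simp_all only: if_True if_False uminus_apply[of "vder v" for v] y_opD(3,4) mode_var_is_x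
       linear_opD(4)[OF y_opD(1)])

lemma y_op_a_bounded:
  assumes "y_op r A" "a_bounded r F B G"
  shows "a_bounded r F B (A G)"
proof -
  define P where "P M \<longleftrightarrow> (\<forall>v. a_creation r v \<longrightarrow>
     lookup M v \<le> B \<and> (lookup M v \<noteq> 0 \<longrightarrow> v \<in> F))" for M
  have "x_local P"
    unfolding x_local_def
  proof (intro allI impI)
    fix M w assume "\<not> is_x w"
    then have "lookup (M + single w (1::nat)) v = lookup M v"
      if "a_creation r v" for v
      using a_creation_is_x[OF that] by (auto simp: lookup_add lookup_single when_def)
    then show "P (M + single w 1) = P M" unfolding P_def by simp
  qed
  moreover have "restrict_to P G = G"
    using assms(2) by (auto simp: restrict_to_def P_def a_bounded_def fun_eq_iff)
  ultimately have "A G = restrict_to P (A G)" using y_opD(5)[OF assms(1)] by metis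
  then have "P M" if "A G M \<noteq> 0" for M
    using that unfolding restrict_to_def by metis
  then show ?thesis unfolding a_bounded_def P_def by blast
qed

end

text \<open>In the usual ordering the products of \<open>\<beta>\<close> and \<open>\<alpha>\<^sup>*\<close> make sense for the following reason: the
  coefficients of \<open>\<beta>(z)\<close> at very negative powers of \<open>z\<close> multiply by \<open>y\<close>-variables of large index, which
  do not occur in a given \<open>y\<close>-part; those of \<open>\<beta>\<^sup>1(z)\<close> differentiate with respect to \<open>y\<^sup>1\<close>-variables of
  large index, which do not occur in the finitely many monomials of that \<open>y\<close>-part.\<close>
definition y_cutoff :: "distr \<Rightarrow> bool" where
  "y_cutoff B \<longleftrightarrow> (\<forall>G\<in>fock 0. \<forall>N. \<exists>i0. \<forall>i<i0. \<forall>v M. is_x v \<longrightarrow> y_part 0 M = N \<longrightarrow> B i (vmul v G) M = 0)"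

lemma Y_bound:
  assumes "finite K"
  shows "\<exists>B. \<forall>k. Y k \<in> K \<or> Y1 k \<in> K \<longrightarrow> k \<le> B"
proof -
  have "finite (Y -` K \<union> Y1 -` K)"
    using assms by (intro finite_UnI finite_vimageI) (auto simp: inj_def)
  then obtain B where "\<forall>k\<in>Y -` K \<union> Y1 -` K. k \<le> B" using finite_nat_set_iff_bounded_le by blast
  then show ?thesis by (intro exI[of _ B]) auto
qed

lemma y_cutoff_beta: "y_cutoff (beta chi0 lam)"
  unfolding y_cutoff_def
proof (intro ballI allI)
  fix G N
  show "\<exists>i0. \<forall>i<i0. \<forall>v M. is_x v \<longrightarrow> y_part 0 M = N \<longrightarrow> beta chi0 lam i (vmul v G) M = 0"
  proof (cases "\<exists>M0. y_part 0 M0 = N")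
    case True
    then obtain M0 where M0: "y_part 0 M0 = N" by blast
    from Y_bound[OF finite_keys[of M0]] obtain K where
      K: "\<forall>k. Y k \<in> keys M0 \<or> Y1 k \<in> keys M0 \<longrightarrow> k \<le> K" ..
    have "beta chi0 lam i (vmul v G) M = 0" if i: "i < - int K - 5" and M: "y_part 0 M = N" for i v M
    proof -
      have "Y (nat (- i - 2)) \<notin> keys M0" using K i by fastforce
      then have "y_part 0 M0 (Y (nat (- i - 2))) = 0"
        by (simp add: y_part_def mon_part_def in_keys_iff)
      moreover have "y_part 0 M (Y (nat (- i - 2))) = y_part 0 M0 (Y (nat (- i - 2)))"
        using M M0 by simp
      moreover have "yvar (- i - 1) = Y (nat (- i - 2))" by (simp add: yvar_def)
      ultimately have "lookup M (yvar (- i - 1)) = 0"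
        by (simp add: y_part_def mon_part_def)
      then show ?thesis using i by (simp add: beta_def rho_b_def vmul_def[of "yvar (- i - 1)"])
    qed
    then show ?thesis by (intro exI[of _ "- int K - 5"]) blast
  qed blast
qed

lemma y_cutoff_beta1: "y_cutoff (beta1 b chi0 \<mu> \<nu> \<kappa>)"
  unfolding y_cutoff_def
proof (intro ballI allI)
  fix G N assume G: "G \<in> fock 0"
  let ?A = "{M. G M \<noteq> 0 \<and> y_part 0 M = N}"
  have "finite (\<Union>M\<in>?A. keys M)"
    using G fock_iff[of 0 G] by auto
  from Y_bound[OF this] obtain K where
    K: "\<forall>k. Y k \<in> (\<Union>M\<in>?A. keys M) \<or> Y1 k \<in> (\<Union>M\<in>?A. keys M) \<longrightarrow> k \<le> K" ..
  have zero: "vder (y1var k) (vmul v G) M = 0"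
    if k: "k > int K + 2" and M: "y_part 0 M = N" and v: "is_x v" for k v M
  proof (rule ccontr)
    let ?y = "single (y1var k) (1::nat)" and ?v = "single v (1::nat)"
    assume "vder (y1var k) (vmul v G) M \<noteq> 0"
    then have nz: "lookup (M + ?y) v \<noteq> 0" "G (M + ?y - ?v) \<noteq> 0"
      by (auto simp: vder_def vmul_def split: if_splits)
    have "M + ?y = (M + ?y - ?v) + ?v" using minus_plus_single[OF nz(1)] by simp
    moreover have "\<not> is_y v" "\<not> is_y (y1var k)" using v by (cases v; simp add: y1var_def)+
    ultimately have "y_part 0 (M + ?y - ?v) = y_part 0 M"
      using y_part_add_single_other by metis
    then have "M + ?y - ?v \<in> ?A" using nz(2) M by blast
    moreover have "y1var k \<in> keys (M + ?y - ?v)"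
    proof -
      have "v \<noteq> y1var k" using v by (auto simp: y1var_def)
      then show ?thesis by (simp add: in_keys_iff lookup_add lookup_minus lookup_single)
    qed
    ultimately have "nat (k - 1) \<le> K" using K unfolding y1var_def by blast
    then show False using k by linarith
  qed
  have "beta1 b chi0 \<mu> \<nu> \<kappa> i (vmul v G) M = 0"
    if i: "i < - int K - 5" and M: "y_part 0 M = N" and v: "is_x v" for i v M
  proof -
    have "vder (y1var (- i)) (vmul v G) M = 0" "vder (y1var (- i + 1)) (vmul v G) M = 0"
      "vder (y1var (- i + 2)) (vmul v G) M = 0"
      using i by (intro zero M v; linarith)+
    then show ?thesis using i by (simp add: beta1_def rho_b1_def algebra_simps)
  qed
  then show "\<exists>i0. \<forall>i<i0. \<forall>v M. is_x v \<longrightarrow> y_part 0 M = N \<longrightarrow> beta1 b chi0 \<mu> \<nu> \<kappa> i (vmul v G) M = 0"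
    by (intro exI[of _ "- int K - 5"]) blast
qed

context
  fixes r :: nat and B :: distr
  assumes r: "r \<in> {0, 1}" and B: "\<And>n. y_op r (B n)" and cutoff: "y_cutoff B"
begin

text \<open>An annihilating mode of \<open>\<alpha>\<^sup>*\<close> differentiates with respect to one of finitely many variables. A
  creating one has a nonnegative index, and the cutoff bounds this index from above.\<close>
lemma admissible_pair_prod:
  assumes s: "star s"
  shows "admissible r (indices 2 n) (pair_prod B (field_distr r s))"
  unfolding admissible_def
proof (intro conjI allI ballI)
  show "linear_op (pair_prod B (field_distr r s) ns)" for ns
  proof (cases "\<exists>i j. ns = [i, j]")
    case True
    then obtain i j where "ns = [i, j]" by blast
    then have "pair_prod B (field_distr r s) ns = (\<lambda>G. B i (field_distr r s j G))" by (auto intro: ext)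
    then show ?thesis
      using linear_op_simple(4)[OF y_opD(1)[OF r B] linear_op_field[OF r]] by simp
  next
    case False
    have "pair_prod B (field_distr r s) ns G = 0" for G
      using False by (cases "(B, field_distr r s, ns, G)" rule: pair_prod.cases) auto
    then show ?thesis unfolding linear_op_def by (metis add.right_neutral vscale_simps(1))
  qed
next
  fix G ns assume G: "G \<in> fock r" and "ns \<in> indices 2 n"
  then obtain i j where "ns = [i, j]" by (auto simp: indices_2)
  then show "pair_prod B (field_distr r s) ns G \<in> fock r"
    by (simp add: y_opD(2)[OF r B] fock_field[OF r] G)
next
  fix G N assume G: "G \<in> fock r"
  obtain F b where F: "finite F" "a_bounded r F b G" using G unfolding fock_iff[OF r] by blast
  obtain C where C: "C \<ge> 0" "\<And>g n. mode_var g n \<in> F \<Longrightarrow> \<bar>n\<bar> \<le> C" using mode_bound[OF F(1)] by blast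
  have "\<exists>D. \<forall>i<D. \<forall>v M. r = 0 \<longrightarrow> is_x v \<longrightarrow> y_part r M = N \<longrightarrow> B i (vmul v G) M = 0"
    using cutoff G unfolding y_cutoff_def by (cases "r = 0") auto
  then obtain D where
    D: "\<And>i v M. r = 0 \<Longrightarrow> i < D \<Longrightarrow> is_x v \<Longrightarrow> y_part r M = N \<Longrightarrow> B i (vmul v G) M = 0" by blast
  let ?C = "C + \<bar>n - D\<bar>"
  have "\<bar>j\<bar> \<le> ?C" if M: "y_part r M = N" and nz: "B (n - j) (field_distr r s j G) M \<noteq> 0" for j M
  proof (cases "in_plus r s j")
    case False
    have "field_distr r s j G \<noteq> 0"
      using nz linear_opD(3)[OF y_opD(1)[OF r B]] by auto
    then have "vder (mode_var s j) G \<noteq> 0"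
      using False s by (simp add: field_distr_eq[OF r])
    then obtain M' where "vder (mode_var s j) G M' \<noteq> 0" by (auto simp: fun_eq_iff)
    then have "G (M' + single (mode_var s j) 1) \<noteq> 0" by (auto simp: vder_def)
    moreover have "a_creation r (mode_var s j)" using False s mode_var_creation[OF r] by blast
    ultimately have "mode_var s j \<in> F"
      using a_boundedD[OF F(2)] by (fastforce simp: lookup_add)
    then show ?thesis using C(2) by force
  next
    case True
    then have r0: "r = 0" "j \<ge> 0" using s by (cases s; auto simp: in_plus_def split: if_splits)+
    have "B (n - j) (vmul (mode_var s j) G) M \<noteq> 0"
      using nz True by (simp add: field_distr_eq[OF r])
    then have "\<not> n - j < D" using D[OF r0(1) _ _ M] by auto
    then show ?thesis using r0 C(1) by linarith
  qed
  then have "{ns \<in> indices 2 n. \<exists>M. y_part r M = N \<and> pair_prod B (field_distr r s) ns G M \<noteq> 0} \<subseteq>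
      (\<lambda>j. [n - j, j]) ` {- ?C..?C}"
    unfolding indices_2 by (force simp: abs_le_iff)
  then show "finite {ns \<in> indices 2 n. \<exists>M. y_part r M = N \<and> pair_prod B (field_distr r s) ns G M \<noteq> 0}"
    by (rule finite_subset) simp
next
  fix G assume G: "G \<in> fock r"
  obtain F b where F: "finite F" "a_bounded r F b G" using G unfolding fock_iff[OF r] by blast
  have "a_bounded r F b (pair_prod B (field_distr r s) ns G)" if ns: "ns \<in> indices 2 n" for ns
  proof -
    obtain i j where "ns = [i, j]" using ns by (auto simp: indices_2)
    then show ?thesis
      by (simp add: y_op_a_bounded[OF r B] a_bounded_star_field[OF r s] F)
  qed
  then show "\<exists>F b. finite F \<and> (\<forall>ns\<in>indices 2 n. a_bounded r F b (pair_prod B (field_distr r s) ns G))"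
    using F(1) by blast
qed

lemma fock_op_dprod: "star s \<Longrightarrow> fock_op r (dprod B (field_distr r s) n)"
  unfolding dprod_eq_fsum by (rule admissible_fock_op[OF r admissible_pair_prod])

lemma contract_dprod:
  assumes "star s" "\<not> star a" and G: "G \<in> fock r"
  shows "dprod B (field_distr r s) n (field_distr r a k G) =
    field_distr r a k (dprod B (field_distr r s) n G) -
      (if sheet s = sheet a then B (n + k + 1) G else 0)"
proof -
  let ?K = "\<lambda>ns. if sheet s = sheet a \<and> ns ! 1 + k = - 1 then - B (ns ! 0) G else 0"
  have "dprod B (field_distr r s) n (field_distr r a k G) =
      field_distr r a k (dprod B (field_distr r s) n G) + fsum (indices 2 n) ?K"
    unfolding dprod_eq_fsum
  proof (rule admissible_commute[OF r admissible_pair_prod[OF assms(1)] local_op_field[OF r] G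
        fock_field[OF r G]])
    fix ns assume "ns \<in> indices 2 n"
    then obtain i j where ns: "ns = [i, j]" by (auto simp: indices_2)
    have eq: "B i (field_distr r s j (field_distr r a k G)) =
        field_distr r a k (B i (field_distr r s j G)) - B i (if sheet s = sheet a \<and> j + k = - 1 then G else 0)"
      unfolding alphaS_alpha_commutator[OF r assms(1,2)] linear_opD[OF y_opD(1)[OF r B]] y_op_field[OF r B]
      by (rule refl)
    then show "pair_prod B (field_distr r s) ns (field_distr r a k G) =
        field_distr r a k (pair_prod B (field_distr r s) ns G) + ?K ns"
      unfolding ns pair_prod.simps eq
      using linear_opD(3)[OF y_opD(1)[OF r B]] by (cases "sheet s = sheet a \<and> j + k = - 1") auto
  qed
  also have "fsum (indices 2 n) ?K = ?K [n + k + 1, - k - 1]"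
    by (rule fsum_one_term) (simp add: indices_def, auto simp: indices_2)
  finally have eq: "dprod B (field_distr r s) n (field_distr r a k G) =
      field_distr r a k (dprod B (field_distr r s) n G) + ?K [n + k + 1, - k - 1]" .
  show ?thesis unfolding eq by (cases "sheet s = sheet a") simp_all
qed

end

section \<open>The Heisenberg relations\<close>

lemma yvar_inject: "m > 0 \<Longrightarrow> n > 0 \<Longrightarrow> yvar m = yvar n \<longleftrightarrow> m = n"
  "m > 0 \<Longrightarrow> n > 0 \<Longrightarrow> y1var m = y1var n \<longleftrightarrow> m = n"
  by (auto simp: yvar_def y1var_def)

lemma rho_b_cases:
  "m > 0 \<Longrightarrow> rho_b chi0 lam m G = - vmul (yvar m) G"
  "m < 0 \<Longrightarrow> rho_b chi0 lam m G = vscale (2 * of_int m * chi0) (vder (yvar (- m)) G)"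
  "rho_b chi0 lam 0 G = vscale lam G"
  by (simp_all add: rho_b_def)

lemma rho_b_commutator:
  "rho_b chi0 lam m (rho_b chi0 lam n G) =
     rho_b chi0 lam n (rho_b chi0 lam m G) +
     vscale (if m + n = 0 then - 2 * of_int m * chi0 else 0) G"
proof -
  consider "m > 0 \<and> n > 0" | "m > 0 \<and> n < 0" | "m < 0 \<and> n > 0" | "m < 0 \<and> n < 0" | "m = 0" | "n = 0"
    by linarith
  then show ?thesis
  proof cases
    case 1
    then show ?thesis
      by (simp add: rho_b_cases vmul_linear vmul_commute[of "yvar m"])
  next
    case 2
    have eq: "yvar (- n) = yvar m \<longleftrightarrow> n = - m" using 2 by (subst yvar_inject) auto
    show ?thesis
    proof (cases "n = - m")
      case True
      with 2 show ?thesis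
        by (simp only: rho_b_cases vmul_linear vder_linear vder_vmul vscale_distribs vscale_simps)
           (rule ext, auto simp: vec_eq_iff algebra_simps)
    next
      case False
      then have "m + n \<noteq> 0" by simp
      with 2 False eq show ?thesis
        by (simp only: rho_b_cases vmul_linear vder_linear vder_vmul vscale_distribs vscale_simps)
           (rule ext, auto simp: vec_eq_iff algebra_simps)
    qed
  next
    case 3
    have eq: "yvar (- m) = yvar n \<longleftrightarrow> n = - m" using 3 by (subst yvar_inject) auto
    show ?thesis
    proof (cases "n = - m")
      case True
      with 3 show ?thesis
        by (simp only: rho_b_cases vmul_linear vder_linear vder_vmul vscale_distribs vscale_simps)
           (rule ext, auto simp: vec_eq_iff algebra_simps)
    next
      case False
      then have "m + n \<noteq> 0" by simp
      with 3 False eq show ?thesis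
        by (simp only: rho_b_cases vmul_linear vder_linear vder_vmul vscale_distribs vscale_simps)
           (rule ext, auto simp: vec_eq_iff algebra_simps)
    qed
  next
    case 4
    then show ?thesis
      by (simp add: rho_b_cases vder_linear vder_commute[of "yvar (- m)"] mult.commute)
  next
    case 5
    then show ?thesis
      by (cases "n > 0"; cases "n < 0") (auto simp: rho_b_cases vmul_linear vder_linear vscale_distribs mult.commute)
  next
    case 6
    then show ?thesis
      by (cases "m > 0"; cases "m < 0") (auto simp: rho_b_cases vmul_linear vder_linear vscale_distribs mult.commute)
  qed
qed

lemma rho_b1_cases:
  "m \<le> - 2 \<Longrightarrow> rho_b1 b chi0 \<mu> \<nu> \<kappa> m G = vmul (y1var (- m)) G"
  "rho_b1 b chi0 \<mu> \<nu> \<kappa> (- 1) G =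
     vmul (y1var 1) G + vscale (- chi0) (vder (y1var 2) G) + B_op \<mu> \<nu> \<kappa> G"
  "m \<ge> 0 \<Longrightarrow> rho_b1 b chi0 \<mu> \<nu> \<kappa> m G =
     vscale (- chi0 * of_int (2 * m + 1)) (vder (y1var (m + 1)) G) +
     (vscale (chi0 * (4 * of_int (m + 1) * b)) (vder (y1var (m + 2)) G) +
      vscale (- chi0 * of_int (2 * m + 3)) (vder (y1var (m + 3)) G))"
  by (auto simp: rho_b1_def fun_eq_iff vec_eq_iff algebra_simps)

text \<open>Twice the residue of \<open>t\<^sup>m u d(t\<^sup>n u)\<close>, see \<open>res_pair_basis\<close>.\<close>
definition b1_bracket :: "complex \<Rightarrow> int \<Rightarrow> int \<Rightarrow> complex" where
  "b1_bracket b m n = (if m + n = - 3 then of_int (2 * n + 3) else 0) -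
     (if m + n = - 2 then 4 * of_int (n + 1) * b else 0) +
     (if m + n = - 1 then of_int (2 * n + 1) else 0)"

lemma b1_bracket_antisym: "b1_bracket b n m = - b1_bracket b m n"
proof -
  consider "n = - 3 - m" | "n = - 2 - m" | "n = - 1 - m" | "m + n \<notin> {- 3, - 2, - 1}" by force
  then show ?thesis
  proof cases
    case 4
    then show ?thesis by (auto simp: b1_bracket_def)
  qed (hypsubst, simp add: b1_bracket_def algebra_simps)+
qed

lemma linear_op_rho_b1: "linear_op (rho_b1 b chi0 \<mu> \<nu> \<kappa> m)"
  using y_opD(1)[of 0, OF _ y_op_beta1[of 0 b chi0 \<mu> \<nu> \<kappa> "- m - 1"]] by (simp add: beta1_def[abs_def])

text \<open>For \<open>m = -1\<close> the only contribution is that of the term with \<open>\<partial>/\<partial>y\<^sup>1\<close> of index \<open>-2\<close>, in accordance with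
  \<open>b1_bracket\<close>.\<close>
lemma rho_b1_vmul:
  assumes "m \<ge> - 1" "k \<ge> 1"
  shows "rho_b1 b chi0 \<mu> \<nu> \<kappa> m (vmul (y1var k) G) =
    vmul (y1var k) (rho_b1 b chi0 \<mu> \<nu> \<kappa> m G) + vscale (chi0 * b1_bracket b m (- k)) G"
proof (cases "m = - 1")
  case True
  have eq: "y1var 2 = y1var k \<longleftrightarrow> k = 2" "y1var k = y1var 1 \<longleftrightarrow> k = 1"
    using assms by (subst yvar_inject; auto)+
  have br: "b1_bracket b (- 1) (- k) = (if k = 2 then - 1 else 0)"
    using assms by (auto simp: b1_bracket_def)
  show ?thesis unfolding True br rho_b1_cases vder_vmul eq B_op_commute
    by (simp only: vmul_linear vscale_distribs vmul_commute[of "y1var k" "y1var 1"])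
       (rule ext, auto simp: vec_eq_iff algebra_simps)
next
  case False
  then have m: "m \<ge> 0" using assms by simp
  have eq: "y1var (m + 1) = y1var k \<longleftrightarrow> k = m + 1" "y1var (m + 2) = y1var k \<longleftrightarrow> k = m + 2"
    "y1var (m + 3) = y1var k \<longleftrightarrow> k = m + 3"
    using assms m by (subst yvar_inject; auto)+
  have br: "b1_bracket b m (- k) = (if k = m + 1 then - of_int (2 * m + 1) else 0) +
      (if k = m + 2 then 4 * of_int (m + 1) * b else 0) -
      (if k = m + 3 then of_int (2 * m + 3) else 0)"
    by (auto simp: b1_bracket_def algebra_simps)
  show ?thesis unfolding br rho_b1_cases(3)[OF m] vder_vmul eq
    by (simp only: vmul_linear vscale_distribs)
       (rule ext, auto simp: vec_eq_iff algebra_simps)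
qed

lemma rho_b1_vder:
  assumes "m \<ge> 0"
  shows "rho_b1 b chi0 \<mu> \<nu> \<kappa> m (vder v G) = vder v (rho_b1 b chi0 \<mu> \<nu> \<kappa> m G)"
    and "rho_b1 b chi0 \<mu> \<nu> \<kappa> m (B_op \<mu> \<nu> \<kappa> G) = B_op \<mu> \<nu> \<kappa> (rho_b1 b chi0 \<mu> \<nu> \<kappa> m G)"
  unfolding rho_b1_cases(3)[OF assms]
  by (simp_all only: vder_linear vder_commute[of v] linear_opD[OF B_op_linear] B_op_commute)

lemma rho_b1_commutator:
  "rho_b1 b chi0 \<mu> \<nu> \<kappa> m (rho_b1 b chi0 \<mu> \<nu> \<kappa> n G) =
     rho_b1 b chi0 \<mu> \<nu> \<kappa> n (rho_b1 b chi0 \<mu> \<nu> \<kappa> m G) + vscale (chi0 * b1_bracket b m n) G"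
proof -
  let ?b = "rho_b1 b chi0 \<mu> \<nu> \<kappa>"
  \<comment> \<open>Both sides are antisymmetric in the two modes.\<close>
  have *: "?b m (?b n G) = ?b n (?b m G) + vscale (chi0 * b1_bracket b m n) G" if "n \<le> m" for m n
  proof -
    have "m \<le> - 2 \<or> m \<ge> - 1 \<and> n \<le> - 2 \<or> m = - 1 \<and> n = - 1 \<or> m \<ge> 0 \<and> n = - 1 \<or> m \<ge> 0 \<and> n \<ge> 0"
      using that by presburger
    then consider "m \<le> - 2" | "m \<ge> - 1" "n \<le> - 2" | "m = - 1" "n = - 1" | "m \<ge> 0" "n = - 1"
      | "m \<ge> 0" "n \<ge> 0" by blast
    then show ?thesis
    proof cases
      case 1
      then have "b1_bracket b m n = 0" "n \<le> - 2" using that by (auto simp: b1_bracket_def)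
      then show ?thesis using 1 by (simp add: rho_b1_cases vmul_commute)
    next
      case 2
      then show ?thesis using rho_b1_vmul[of m "- n" b chi0 \<mu> \<nu> \<kappa> G] by (simp only: rho_b1_cases) simp
    next
      case 3
      then have "b1_bracket b m n = 0" by (simp add: b1_bracket_def)
      with 3 show ?thesis by simp
    next
      case 4
      show ?thesis
        unfolding 4(2) rho_b1_cases(2) linear_opD[OF linear_op_rho_b1] rho_b1_vder[OF 4(1)]
        using rho_b1_vmul[of m 1 b chi0 \<mu> \<nu> \<kappa> G] 4(1)
        by (simp only:) simp
    next
      case 5
      then have "b1_bracket b m n = 0" by (auto simp: b1_bracket_def)
      moreover have "?b m (?b n G) = ?b n (?b m G)"
        unfolding rho_b1_cases(3)[OF 5(2), of b chi0 \<mu> \<nu> \<kappa> G]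
          rho_b1_cases(3)[OF 5(2), of b chi0 \<mu> \<nu> \<kappa> "?b m G"]
          linear_opD[OF linear_op_rho_b1] rho_b1_vder[OF 5(1)] by (rule refl)
      ultimately show ?thesis by simp
    qed
  qed
  show ?thesis
  proof (cases "n \<le> m")
    case False
    then show ?thesis
      using *[of m n] b1_bracket_antisym[of b n m] by (simp only: vscale_distribs mult_minus_right) simp
  qed (rule *)
qed

lemma rho_b_rho_b1_commute:
  "rho_b chi0 lam m (rho_b1 b chi0 \<mu> \<nu> \<kappa> n G) = rho_b1 b chi0 \<mu> \<nu> \<kappa> n (rho_b chi0 lam m G)"
proof -
  have ne: "yvar k \<noteq> y1var l" "y1var l \<noteq> yvar k" for k l by (simp_all add: yvar_def y1var_def)
  have v: "vmul (yvar k) (rho_b1 b chi0 \<mu> \<nu> \<kappa> n G) = rho_b1 b chi0 \<mu> \<nu> \<kappa> n (vmul (yvar k) G)"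
    and d: "vder (yvar k) (rho_b1 b chi0 \<mu> \<nu> \<kappa> n G) = rho_b1 b chi0 \<mu> \<nu> \<kappa> n (vder (yvar k) G)" for k
  proof -
    consider "n \<le> - 2" | "n = - 1" | "n \<ge> 0" by linarith
    note n = this
    from n show "vmul (yvar k) (rho_b1 b chi0 \<mu> \<nu> \<kappa> n G) = rho_b1 b chi0 \<mu> \<nu> \<kappa> n (vmul (yvar k) G)"
    proof cases
      case 1
      then show ?thesis by (simp add: rho_b1_cases vmul_commute)
    next
      case 2
      show ?thesis unfolding 2 rho_b1_cases vmul_linear vder_vmul B_op_commute
        using ne by (simp add: vmul_commute[of "yvar k"])
    next
      case 3
      show ?thesis unfolding rho_b1_cases(3)[OF 3] vmul_linear vder_vmul using ne by simp
    qed
    from n show "vder (yvar k) (rho_b1 b chi0 \<mu> \<nu> \<kappa> n G) = rho_b1 b chi0 \<mu> \<nu> \<kappa> n (vder (yvar k) G)"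
    proof cases
      case 1
      then show ?thesis using ne by (simp add: rho_b1_cases vder_vmul)
    next
      case 2
      show ?thesis unfolding 2 rho_b1_cases vder_linear vder_vmul B_op_commute
        using ne by (simp add: vder_commute[of "yvar k"])
    next
      case 3
      show ?thesis unfolding rho_b1_cases(3)[OF 3] vder_linear by (simp only: vder_commute[of "yvar k"])
    qed
  qed
  consider "m > 0" | "m < 0" | "m = 0" by linarith
  then show ?thesis
    by cases (simp_all only: rho_b_cases v d linear_opD[OF linear_op_rho_b1])
qed

section \<open>Weights of the summed operators\<close>

text \<open>A vector of \<open>fock 0\<close> may have components of infinitely many weights, hence the formulation with
  \<open>weight_part\<close>.\<close>
definition homogeneous :: "nat \<Rightarrow> int \<Rightarrow> (series \<Rightarrow> series) \<Rightarrow> bool" where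
  "homogeneous r k T \<longleftrightarrow> (\<forall>G\<in>fock r. \<forall>w. T (weight_part r w G) = weight_part r (w + k) (T G))"

lemma homogeneous_add:
  "homogeneous r k S \<Longrightarrow> homogeneous r k T \<Longrightarrow> homogeneous r k (\<lambda>G. S G + T G)"
  unfolding homogeneous_def by (simp only: linear_opD[OF weight_part_linear]) simp

lemma homogeneous_diff:
  "homogeneous r k S \<Longrightarrow> homogeneous r k T \<Longrightarrow> homogeneous r k (\<lambda>G. S G - T G)"
  unfolding homogeneous_def by (simp only: linear_opD[OF weight_part_linear]) simp

lemma homogeneous_vscale: "homogeneous r k S \<Longrightarrow> homogeneous r k (\<lambda>G. vscale c (S G))"
  unfolding homogeneous_def by (simp only: linear_opD[OF weight_part_linear]) simp

lemma homogeneous_scalar: "homogeneous r 0 (vscale c)"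
  unfolding homogeneous_def by (simp only: linear_opD[OF weight_part_linear]) simp

lemma homogeneous_zero: "homogeneous r k (\<lambda>G. 0)"
  unfolding homogeneous_def linear_opD(3)[OF weight_part_linear] by simp

lemma homogeneous_sum:
  assumes "\<And>i. i \<in> I \<Longrightarrow> homogeneous r k (T i)"
  shows "homogeneous r k (\<lambda>G. \<Sum>i\<in>I. T i G)"
  using assms
proof (induction I rule: infinite_finite_induct)
  case (insert i I)
  then have "homogeneous r k (\<lambda>G. T i G + (\<Sum>i\<in>I. T i G))" by (intro homogeneous_add) auto
  then show ?case unfolding sum.insert[OF insert(1,2)] .
next
  case empty
  show ?case unfolding sum.empty by (rule homogeneous_zero)
next
  case (infinite I)
  show ?case unfolding sum.infinite[OF infinite(1)] by (rule homogeneous_zero)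
qed

lemma homogeneous_comp:
  assumes "homogeneous r k S" "homogeneous r l T" "\<And>G. G \<in> fock r \<Longrightarrow> T G \<in> fock r"
  shows "homogeneous r (k + l) (\<lambda>G. S (T G))"
  using assms unfolding homogeneous_def by (simp add: ac_simps)

lemma homogeneous_fsum:
  assumes "\<And>i G w. i \<in> I \<Longrightarrow> D i (weight_part r w G) = weight_part r (w + k) (D i G)"
  shows "homogeneous r k (\<lambda>G. fsum I (\<lambda>i. D i G))"
  unfolding homogeneous_def
proof (intro ballI allI ext)
  fix G w M
  have "fsum I (\<lambda>i. D i (weight_part r w G)) = fsum I (\<lambda>i. weight_part r (w + k) (D i G))"
    by (rule fsum_cong) (rule assms)
  then show "fsum I (\<lambda>i. D i (weight_part r w G)) M = weight_part r (w + k) (fsum I (\<lambda>i. D i G)) M"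
    by (auto simp: fsum_def weight_part_def)
qed

context
  fixes r :: nat
  assumes r: "r \<in> {0, 1}"
begin

lemma homogeneous_y_op: "y_op r A \<Longrightarrow> homogeneous r 0 A"
  unfolding homogeneous_def weight_part_eq_restrict by (simp add: y_opD(5)[OF r] x_local_weight)

lemma homogeneous_star: "star s \<Longrightarrow> homogeneous r 1 (field_distr r s n)"
  unfolding homogeneous_def by (simp add: weight_part_field[OF r])

lemma homogeneous_nord: "homogeneous r (\<Sum>g\<leftarrow>gs. if star g then 1 else - 1) (nord r gs n)"
  unfolding nord_eq_fsum by (rule homogeneous_fsum) (rule weight_part_nprod[OF r])

lemma homogeneous_dprod:
  assumes "\<And>n. y_op r (B n)" "star s"
  shows "homogeneous r 1 (dprod B (field_distr r s) n)"
proof -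
  have y: "B i (weight_part r w G) = weight_part r w (B i G)" for i w G
    unfolding weight_part_eq_restrict by (rule y_opD(5)[OF r assms(1) x_local_weight])
  have "homogeneous r 1 (\<lambda>G. fsum (indices 2 n) (\<lambda>ns. pair_prod B (field_distr r s) ns G))"
  proof (rule homogeneous_fsum)
    fix ns G w assume "ns \<in> indices 2 n"
    then obtain i j where "ns = [i, j]" by (auto simp: indices_2)
    then show "pair_prod B (field_distr r s) ns (weight_part r w G) =
        weight_part r (w + 1) (pair_prod B (field_distr r s) ns G)"
      using assms(2) by (simp add: weight_part_field[OF r] y)
  qed
  then show ?thesis unfolding dprod_eq_fsum .
qed

section \<open>Double contractions at the vacuum\<close>

text \<open>A factor that multiplies would leave an \<open>x\<close>-variable behind, so both factors have to differentiate.\<close>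
lemma nord_pair_at_x_free:
  assumes "\<not> star g" "star s" "x_free M"
  shows "nord r [g, s] n U M = (if r = 0
    then - (\<Sum>m\<in>{n + 1..- 1}.
      U (M + single (mode_var g m) 1 + single (mode_var s (n - m)) 1))
    else 0)"
proof -
  have z: "lookup M (mode_var g' m) = 0" for g' m
    using assms(3) by (simp add: x_free_def)
  have term_value: "nprod r [g, s] [m, j] U M = (if in_plus r g m \<or> in_plus r s j then 0
      else - U (M + single (mode_var g m) 1 + single (mode_var s j) 1))"
    for m j
  proof -
    have ne: "mode_var g m \<noteq> mode_var s j" if "\<not> in_plus r g m" "\<not> in_plus r s j"
      using that assms mode_var_creation(1)[OF r] by metis
    show ?thesis
    proof (cases "in_plus r g m")
      case True
      then have "nprod r [g, s] [m, j] U = vmul (mode_var g m) (field_distr r s j U) + field_distr r s j 0"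
        by (simp add: plus_part_def minus_part_def field_distr_eq[OF r, of g])
      then show ?thesis using True z by (simp add: linear_opD(3)[OF linear_op_field[OF r]] vmul_def)
    next
      case False
      then have eq: "nprod r [g, s] [m, j] U = field_distr r s j (vder (mode_var g m) U)"
        using assms by (simp add: plus_part_def minus_part_def field_distr_eq[OF r, of g])
      show ?thesis
      proof (cases "in_plus r s j")
        case True
        then show ?thesis unfolding eq using z by (simp add: field_distr_eq[OF r] vmul_def)
      next
        case False
        then show ?thesis unfolding eq using z ne \<open>\<not> in_plus r g m\<close> assms
          by (simp add: field_distr_eq[OF r] vder_def lookup_add lookup_single ac_simps)
      qed
    qed
  qed
  have eq: "nord r [g, s] n U = fsum (indices (length [g, s]) n) (\<lambda>ns. nprod r [g, s] ns U)"
    by (simp only: nord_eq_fsum)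
  have ind: "indices (length [g, s]) n = (\<lambda>m. [m, n - m]) ` UNIV"
    by (auto simp: indices_def length_Suc_conv image_iff)
  show ?thesis
  proof (cases "r = 0")
    case False
    then have "in_plus r g m" for m using assms(1) by (cases g) (auto simp: in_plus_def)
    then have "nprod r [g, s] ns U M = 0" if "ns \<in> indices (length [g, s]) n" for ns
      using that term_value unfolding ind by auto
    then show ?thesis using False unfolding eq by (simp add: fsum_eq_0)
  next
    case True
    then have ip: "in_plus r g' m \<longleftrightarrow> m \<ge> 0" for g' m by (simp add: in_plus_def)
    have "fsum (indices (length [g, s]) n) (\<lambda>ns. nprod r [g, s] ns U) M =
        (\<Sum>ns\<in>(\<lambda>m. [m, n - m]) ` {n + 1..- 1}. nprod r [g, s] ns U M)"
      unfolding ind by (rule fsum_eq_sum) (auto simp: term_value ip split: if_splits simp del: nprod.simps)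
    also have "\<dots> = (\<Sum>m\<in>{n + 1..- 1}. nprod r [g, s] [m, n - m] U M)"
      by (subst sum.reindex) (auto simp: inj_on_def)
    also have "\<dots> = (\<Sum>m\<in>{n + 1..- 1}. - U (M + single (mode_var g m) 1 +
        single (mode_var s (n - m)) 1))"
      by (rule sum.cong) (auto simp: term_value ip simp del: nprod.simps)
    finally show ?thesis unfolding eq using True by (simp add: sum_negf)
  qed
qed

text \<open>Derivatives kill \<open>G\<close>, so both factors have to multiply, and the variables that are present determine
  their indices.\<close>
lemma nord_pair_on_x_free:
  assumes r0: "r = 0" and g: "\<not> star g" "star s" "\<not> star g'" "star s'"
    and G: "\<And>M. G M \<noteq> 0 \<Longrightarrow> x_free M" and M: "x_free M" and neg: "m < 0" "j < 0"
  shows "nord r [g', s'] n G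
      (M + single (mode_var g m) 1 + single (mode_var s j) 1) =
    (if sheet g' = sheet s \<and> sheet s' = sheet g \<and> n = - m - j - 2 then G M else 0)"
proof -
  let ?e = "\<lambda>v. single v (1::nat)"
  let ?v = "mode_var g m" and ?w = "mode_var s j"
  let ?L = "M + ?e ?v + ?e ?w"
  have ip: "in_plus r h i \<longleftrightarrow> i \<ge> 0" for h i using r0 by (simp add: in_plus_def)
  have cr: "a_creation r ?w" "aS_creation r ?v" "?v \<noteq> ?w"
    using mode_var_creation[OF r, of g m] mode_var_creation[OF r, of s j] g neg ip
    by (auto simp: aS_creation_def)
  have z: "lookup M (mode_var h i) = 0" for h i
    using M by (simp add: x_free_def)
  have der: "vder (mode_var h i) G = 0" for h i
  proof
    fix N
    have "\<not> x_free (N + ?e (mode_var h i))"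
      unfolding x_free_def by (auto simp: lookup_add intro!: exI[of _ "mode_var h i"])
    then have "G (N + ?e (mode_var h i)) = 0" using G by blast
    then show "vder (mode_var h i) G N = 0 N" by (simp add: vder_def)
  qed
  have term_value: "nprod r [g', s'] [i, l] G ?L =
      (if sheet g' = sheet s \<and> sheet s' = sheet g \<and> i = - j - 1 \<and> l = - m - 1 then G M else 0)" for i l
  proof (cases "i \<ge> 0 \<and> l \<ge> 0")
    case False
    have "nprod r [g', s'] [i, l] G = 0"
    proof (cases "i \<ge> 0")
      case True
      then have "nprod r [g', s'] [i, l] G = vmul (mode_var g' i) (- vder (mode_var s' l) G) + field_distr r s' l 0"
        using False g by (simp add: plus_part_def minus_part_def field_distr_eq[OF r] ip)
      then show ?thesis unfolding der using linear_opD(3)[OF linear_op_field[OF r]]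
        by (simp add: vmul_linear)
    next
      case False
      then have "nprod r [g', s'] [i, l] G = field_distr r s' l (vder (mode_var g' i) G)"
        using g by (simp add: plus_part_def minus_part_def field_distr_eq[OF r, of g'] ip)
      then show ?thesis unfolding der using linear_opD(3)[OF linear_op_field[OF r]] by simp
    qed
    moreover have "\<not> (i = - j - 1 \<and> l = - m - 1)" using False neg by auto
    ultimately show ?thesis by auto
  next
    case True
    let ?v' = "mode_var s' l" and ?w' = "mode_var g' i"
    have "nprod r [g', s'] [i, l] G = vmul ?w' (vmul ?v' G) + field_distr r s' l 0"
      using True g by (simp add: plus_part_def minus_part_def field_distr_eq[OF r] ip)
    then have eq: "nprod r [g', s'] [i, l] G = vmul ?w' (vmul ?v' G)"
      using linear_opD(3)[OF linear_op_field[OF r]] by simp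
    have cr': "a_creation r ?w'" "aS_creation r ?v'"
      using mode_var_creation[OF r, of g' i] mode_var_creation[OF r, of s' l] g True ip by auto
    have w: "?w' = ?w \<longleftrightarrow> sheet g' = sheet s \<and> i = - j - 1"
      using mode_var_star_eq[OF g(2,3), of j i] by (auto simp: eq_commute[of "?w'"])
    have v: "?v' = ?v \<longleftrightarrow> sheet s' = sheet g \<and> l = - m - 1"
      using mode_var_star_eq[OF g(4,1), of l m] by auto
    have ne: "?w' \<noteq> ?v" "?v' \<noteq> ?w" using cr cr' by (auto simp: aS_creation_def)
    show ?thesis
    proof (cases "?w' = ?w \<and> ?v' = ?v")
      case True
      have "?L - ?e ?w - ?e ?v = M" by simp
      then show ?thesis unfolding eq using True w v cr(3)
        by (simp add: vmul_def lookup_add lookup_minus lookup_single)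
    next
      case False
      then have "lookup ?L ?w' = 0 \<or> lookup (?L - ?e ?w') ?v' = 0"
        using ne z by (auto simp: lookup_add lookup_minus lookup_single when_def)
      then show ?thesis unfolding eq using False w v by (auto simp: vmul_def)
    qed
  qed
  have eq: "nord r [g', s'] n G = fsum (indices (length [g', s']) n) (\<lambda>ns. nprod r [g', s'] ns G)"
    by (simp only: nord_eq_fsum)
  let ?S = "if n = - m - j - 2 then {[- j - 1, - m - 1]} else {}"
  have "fsum (indices (length [g', s']) n) (\<lambda>ns. nprod r [g', s'] ns G) ?L =
      (\<Sum>ns\<in>?S. nprod r [g', s'] ns G ?L)"
    by (rule fsum_eq_sum)
       (auto simp: term_value indices_def length_Suc_conv split: if_splits simp del: nprod.simps One_nat_def)
  also have "\<dots> = (if sheet g' = sheet s \<and> sheet s' = sheet g \<and> n = - m - j - 2 then G M else 0)"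
    by (simp add: term_value del: nprod.simps One_nat_def)
  finally show ?thesis unfolding eq .
qed

lemma of_int_vec: "(of_int k :: complex^2) $ i = of_int k"
  by (cases k rule: int_cases2) (simp_all add: of_nat_index)

text \<open>What the inner product creates is annihilated by the outer one; the factor counts the ways to
  distribute the mode number \<open>-n-1\<close> of the outer product to two annihilating modes. In the natural
  ordering the modes of \<open>\<alpha>\<close> never annihilate.\<close>
lemma vacuum_double_contraction:
  assumes "\<not> star g" "star s" "\<not> star g'" "star s'"
    and "\<And>M. G M \<noteq> 0 \<Longrightarrow> x_free M" "x_free M"
  shows "nord r [g, s] n (nord r [g', s'] n' G) M =
    (if r = 0 \<and> sheet g' = sheet s \<and> sheet s' = sheet g \<and> n + n' = - 2
     then - of_int (max 0 (- n - 1)) else 0) *s G M"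
proof (cases "r = 0")
  case True
  have "(\<Sum>m\<in>{n + 1..- 1}. nord r [g', s'] n' G
        (M + single (mode_var g m) 1 + single (mode_var s (n - m)) 1)) =
      (\<Sum>m\<in>{n + 1..- 1}. if sheet g' = sheet s \<and> sheet s' = sheet g \<and> n + n' = - 2 then G M else 0)"
  proof (rule sum.cong[OF refl])
    fix m assume "m \<in> {n + 1..- 1}"
    then have neg: "m < 0" "n - m < 0" by auto
    show "nord r [g', s'] n' G
        (M + single (mode_var g m) 1 + single (mode_var s (n - m)) 1) =
      (if sheet g' = sheet s \<and> sheet s' = sheet g \<and> n + n' = - 2 then G M else 0)"
      by (subst nord_pair_on_x_free[OF True assms neg]) auto
  qed
  also have "\<dots> = (if sheet g' = sheet s \<and> sheet s' = sheet g \<and> n + n' = - 2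
     then of_int (max 0 (- n - 1)) else 0) *s G M"
    by (auto simp: vec_eq_iff max_def of_nat_nat of_int_vec)
  finally show ?thesis
    unfolding nord_pair_at_x_free[OF assms(1,2,6)] using True by (auto simp: vec_eq_iff)
next
  case False
  then show ?thesis unfolding nord_pair_at_x_free[OF assms(1,2,6)] by simp
qed

end

section \<open>The residue pairing on the coordinate ring\<close>

lemma lookup_pscale [simp]: "lookup (pscale c p) k = c * lookup p k"
  by (simp add: pscale_def map.rep_eq when_def)

lemma pscale_eq_mult: "pscale c (p :: laurent) = single 0 c * p"
  unfolding pscale_def by (rule mult_map_scale_conv_mult)

lemma pscale_0 [simp]: "pscale 0 p = 0" and pscale_1 [simp]: "pscale 1 p = p"
  and pscale_zero [simp]: "pscale c 0 = 0"
  by (auto intro!: poly_mapping_eqI)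

lemma poly_mapping_induct [case_names zero single add]:
  assumes "P 0" "\<And>k c. P (single k c)" "\<And>p q. P p \<Longrightarrow> P q \<Longrightarrow> P (p + q)"
  shows "P (p :: 'a \<Rightarrow>\<^sub>0 'b::comm_monoid_add)"
proof -
  have "P (\<Sum>k\<in>S. single k (lookup p k))" if "finite S" for S
    using that by (induction S) (simp_all add: assms)
  moreover have "(\<Sum>k\<in>keys p. single k (lookup p k)) = p"
    by (rule poly_mapping_eqI)
       (auto simp: lookup_sum lookup_single when_def in_keys_iff sum.delta)
  ultimately show ?thesis by (metis finite_keys)
qed

lemma lookup_lderiv: "lookup (lderiv p) k = of_int (k + 1) * lookup p (k + 1)"
proof -
  have "lookup (lderiv p) k =
      (\<Sum>j\<in>keys p. if j = k + 1 then of_int j * lookup p j else 0)"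
    unfolding lderiv_def lookup_sum lookup_single when_def by (intro sum.cong) auto
  then show ?thesis by (simp add: sum.delta in_keys_iff)
qed

lemma lderiv_add: "lderiv (p + q) = lderiv p + lderiv q"
  by (rule poly_mapping_eqI) (simp add: lookup_lderiv lookup_add algebra_simps)

lemma lderiv_zero [simp]: "lderiv 0 = 0"
  by (rule poly_mapping_eqI) (simp add: lookup_lderiv)

lemma lderiv_single: "lderiv (single m c) = single (m - 1) (of_int m * c)"
  by (rule poly_mapping_eqI) (auto simp: lookup_lderiv lookup_single when_def)

lemma lderiv_mult: "lderiv (p * q) = lderiv p * q + p * lderiv q"
proof (induction p rule: poly_mapping_induct)
  case (single m c)
  show ?case
  proof (induction q rule: poly_mapping_induct)
    case (single n d)
    show ?case
      by (simp add: mult_single lderiv_single algebra_simps flip: single_add)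
  qed (simp_all add: lderiv_add algebra_simps)
qed (simp_all add: lderiv_add algebra_simps)

lemma lderiv_pscale: "lderiv (pscale c p) = pscale c (lderiv p)"
  by (rule poly_mapping_eqI) (simp add: lookup_lderiv)

lemma rmul_add:
  "rmul b (p + p') q = rmul b p q + rmul b p' q" "rmul b q (p + p') = rmul b q p + rmul b q p'"
  by (simp_all add: rmul_def algebra_simps)

lemma rmul_rscale:
  "rmul b (rscale c p) q = rscale c (rmul b p q)" "rmul b q (rscale c p) = rscale c (rmul b q p)"
  by (simp_all add: rmul_def rscale_def pscale_eq_mult algebra_simps)

lemma rmul_commute: "rmul b p q = rmul b q p"
  by (simp add: rmul_def algebra_simps)

lemma rmul_assoc: "rmul b (rmul b p q) s = rmul b p (rmul b q s)"
  by (simp add: rmul_def algebra_simps)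

lemma rmul_rone: "rmul b rone p = p"
  by (simp add: rmul_def rone_def)

lemma rscale_simps:
  "rscale 0 p = 0" "rscale 1 p = p" "rscale c 0 = 0" "rscale c (p + q) = rscale c p + rscale c q"
  by (auto simp: rscale_def prod_eq_iff intro!: poly_mapping_eqI)
     (simp_all add: lookup_add algebra_simps)

lemma rmul_zero: "rmul b 0 q = 0" "rmul b q 0 = 0"
  by (simp_all add: rmul_def zero_prod_def)

lemma rmul_basis:
  "rmul b (tpow m) (tpow n) = tpow (m + n)"
  "rmul b (tpow m) (tupow n) = tupow (m + n)"
  "rmul b (tupow m) (tpow n) = tupow (m + n)"
  "rmul b (tupow m) (tupow n) = tpow (m + n + 3) + rscale (- 2 * b) (tpow (m + n + 2)) + tpow (m + n + 1)"
  by (simp_all add: rmul_def tpow_def tupow_def mult_single curve_def rscale_def pscale_eq_mult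
      algebra_simps)

lemma coord_induct [case_names zero tpow tupow add]:
  assumes "P 0" "\<And>c m. P (rscale c (tpow m))" "\<And>c m. P (rscale c (tupow m))"
    "\<And>p q. P p \<Longrightarrow> P q \<Longrightarrow> P (p + q)"
  shows "P p"
proof -
  have "P (p0, 0)" for p0
  proof (induction p0 rule: poly_mapping_induct)
    case (single m c)
    then show ?case using assms(2)[of c m] by (simp add: rscale_def tpow_def pscale_eq_mult mult_single)
  next
    case (add p q)
    then show ?case using assms(4)[of "(p, 0)" "(q, 0)"] by simp
  qed (use assms(1) in \<open>simp add: zero_prod_def\<close>)
  moreover have "P (0, p1)" for p1
  proof (induction p1 rule: poly_mapping_induct)
    case (single m c)
    then show ?case using assms(3)[of c m] by (simp add: rscale_def tupow_def pscale_eq_mult mult_single)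
  next
    case (add p q)
    then show ?case using assms(4)[of "(0, p)" "(0, q)"] by simp
  qed (use assms(1) in \<open>simp add: zero_prod_def\<close>)
  ultimately show ?thesis using assms(4)[of "(fst p, 0)" "(0, snd p)"] by simp
qed

text \<open>The part without \<open>u\<close> of \<open>p dq / dt\<close>; recall \<open>u du = P' / 2 dt\<close> for \<open>P = u\<^sup>2\<close>.\<close>
definition res_poly :: "complex \<Rightarrow> coord \<Rightarrow> coord \<Rightarrow> laurent" where
  "res_poly b p q = fst p * lderiv (fst q) + curve b * snd p * lderiv (snd q) +
     pscale (1 / 2) (lderiv (curve b) * snd p * snd q)"

definition res_pair :: "complex \<Rightarrow> coord \<Rightarrow> coord \<Rightarrow> complex" where
  "res_pair b p q = lookup (res_poly b p q) (- 1)"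

lemma res_pair_add:
  "res_pair b (p + p') q = res_pair b p q + res_pair b p' q"
  "res_pair b p (q + q') = res_pair b p q + res_pair b p q'"
  by (simp_all add: res_pair_def res_poly_def lderiv_add algebra_simps lookup_add)

lemma res_pair_rscale:
  "res_pair b (rscale c p) q = c * res_pair b p q"
  "res_pair b p (rscale c q) = c * res_pair b p q"
proof -
  have "res_poly b (rscale c p) q = pscale c (res_poly b p q)"
    "res_poly b p (rscale c q) = pscale c (res_poly b p q)"
    by (simp_all add: res_poly_def rscale_def lderiv_pscale)
       (simp_all add: pscale_eq_mult algebra_simps)
  then show "res_pair b (rscale c p) q = c * res_pair b p q"
    "res_pair b p (rscale c q) = c * res_pair b p q" by (simp_all add: res_pair_def)
qed

lemma res_pair_zero [simp]: "res_pair b 0 q = 0" "res_pair b p 0 = 0"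
  using res_pair_rscale(1)[of b 0 0 q] res_pair_rscale(2)[of b p 0 0] by (simp_all add: rscale_simps)

lemma res_pair_leibniz:
  "res_pair b p (rmul b q s) = res_pair b (rmul b p q) s + res_pair b (rmul b p s) q"
proof -
  obtain p0 p1 q0 q1 s0 s1 where [simp]: "p = (p0, p1)" "q = (q0, q1)" "s = (s0, s1)"
    by (cases p; cases q; cases s) blast
  let ?P = "curve b" and ?d = lderiv and ?h = "single 0 (1 / 2) :: laurent"
  \<comment> \<open>The derivative of \<open>u\<^sup>2 = P\<close> contributes \<open>x\<close> on the left, and on the right one half of \<open>x\<close> for each
    of the two factors \<open>u\<close>; the remaining terms agree.\<close>
  define x where "x = p0 * (?d ?P * q1 * s1)"
  define y where "y = p0 * (?d q0 * s0 + q0 * ?d s0 + ?P * (?d q1 * s1 + q1 * ?d s1)) +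
      ?P * p1 * (?d q0 * s1 + q0 * ?d s1 + ?d q1 * s0 + q1 * ?d s0) +
      ?h * (?d ?P * p1 * (q0 * s1 + q1 * s0))"
  have half: "?h * x + ?h * x = x"
    by (simp flip: distrib_right single_add)
  have "res_poly b p (rmul b q s) = y + x"
    by (simp add: res_poly_def rmul_def pscale_eq_mult lderiv_add lderiv_mult x_def y_def
        algebra_simps)
  moreover have "res_poly b (rmul b p q) s + res_poly b (rmul b p s) q = y + (?h * x + ?h * x)"
    unfolding x_def y_def
    by (simp add: res_poly_def rmul_def pscale_eq_mult algebra_simps)
  ultimately have "res_poly b p (rmul b q s) = res_poly b (rmul b p q) s + res_poly b (rmul b p s) q"
    unfolding half by (rule trans[OF _ sym])
  then show ?thesis by (simp only: res_pair_def lookup_add)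
qed

lemma res_pair_exact: "res_pair b rone q = 0"
  by (simp add: res_pair_def res_poly_def rone_def lookup_lderiv)

lemma res_pair_antisym: "res_pair b q p = - res_pair b p q"
  using res_pair_leibniz[of b rone p q] by (simp add: res_pair_exact rmul_rone add_eq_0_iff)

lemma lookup_curve:
  "lookup (curve b) k = (if k = 3 then 1 else 0) + (if k = 2 then - 2 * b else 0) + (if k = 1 then 1 else 0)"
  by (simp add: curve_def lookup_add lookup_single when_def)

lemma lookup_single_mult:
  "lookup (single (m::int) c * p) k = c * lookup p (k - m)"
proof (induction p rule: poly_mapping_induct)
  case (single n d)
  show ?case by (auto simp: mult_single lookup_single when_def)
qed (simp_all add: lookup_add algebra_simps)

lemma res_pair_basis:
  "res_pair b (tpow m) (tpow n) = (if m + n = 0 then of_int n else 0)"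
  "res_pair b (tpow m) (tupow n) = 0"
  "res_pair b (tupow m) (tpow n) = 0"
  "2 * res_pair b (tupow m) (tupow n) = b1_bracket b m n"
proof -
  show "res_pair b (tpow m) (tpow n) = (if m + n = 0 then of_int n else 0)"
    by (auto simp: res_pair_def res_poly_def tpow_def lderiv_single mult_single lookup_single when_def)
  show "res_pair b (tpow m) (tupow n) = 0" "res_pair b (tupow m) (tpow n) = 0"
    by (simp_all add: res_pair_def res_poly_def tpow_def tupow_def)
  have "res_pair b (tupow m) (tupow n) =
      of_int n * lookup (curve b) (- m - n) +
      1 / 2 * of_int (- m - n) * lookup (curve b) (- m - n)"
  proof -
    have 1: "curve b * single m 1 * single (n - 1) (of_int n) =
        single (m + n - 1) (of_int n) * curve b"
      by (simp add: mult.assoc mult_single mult.commute[of "curve b"] mult.commute[of "lderiv (curve b)"] add_diff_eq)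
    have 2: "lderiv (curve b) * single m 1 * single n 1 =
        single (m + n) 1 * lderiv (curve b)"
      by (simp add: mult.assoc mult_single mult.commute[of "curve b"] mult.commute[of "lderiv (curve b)"] add_diff_eq)
    show ?thesis
      unfolding res_pair_def res_poly_def tupow_def
      by (simp add: lderiv_single lookup_add 1 2 lookup_single_mult lookup_lderiv)
  qed
  then have "2 * res_pair b (tupow m) (tupow n) = of_int (n - m) * lookup (curve b) (- m - n)"
    by (simp add: algebra_simps)
  also have "\<dots> = b1_bracket b m n"
  proof -
    consider "m = - 3 - n" | "m = - 2 - n" | "m = - 1 - n" | "m + n \<notin> {- 3, - 2, - 1}" by force
    then show ?thesis
    proof cases
      case 4
      then have "- m - n \<noteq> 3" "- m - n \<noteq> 2" "- m - n \<noteq> 1" by auto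
      then show ?thesis using 4 by (simp add: lookup_curve b1_bracket_def)
    qed (hypsubst, simp add: lookup_curve b1_bracket_def algebra_simps)+
  qed
  finally show "2 * res_pair b (tupow m) (tupow n) = b1_bracket b m n" .
qed

section \<open>The residue on differentials modulo exact forms\<close>

text \<open>On differentials modulo exact forms this becomes the functional with value \<open>1\<close> at \<open>\<omega>\<^sub>0\<close> and \<open>0\<close> at
  \<open>\<omega>\<^sub>+\<close> and \<open>\<omega>\<^sub>-\<close>, see \<open>res_omega\<close>.\<close>
definition res_form :: "complex \<Rightarrow> form \<Rightarrow> complex" where
  "res_form b w = (\<Sum>k\<in>keys w. lookup w k * res_pair b (fst k) (snd k))"

lemma res_form_add: "res_form b (w + w') = res_form b w + res_form b w'"
  unfolding res_form_def
  by (rule setsum_keys_plus_distrib[where f = "\<lambda>k c. c * res_pair b (fst k) (snd k)"])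
     (auto simp: algebra_simps)

lemma res_form_pscale: "res_form b (pscale c w) = c * res_form b w"
proof -
  have "res_form b (pscale c w) = (\<Sum>k\<in>keys w. c * lookup w k * res_pair b (fst k) (snd k))"
    unfolding res_form_def by (intro sum.mono_neutral_cong_left) (auto simp: in_keys_iff)
  then show ?thesis by (simp add: res_form_def sum_distrib_left mult.assoc)
qed

lemma pscale_uminus: "pscale (- 1) w = - w"
  by (rule poly_mapping_eqI) simp

lemma res_form_diff: "res_form b (w - w') = res_form b w - res_form b w'"
  using res_form_add[of b w "- w'"] res_form_pscale[of b "- 1" w'] by (simp add: pscale_uminus)

lemma res_form_dform [simp]: "res_form b (dform p q) = res_pair b p q"
  by (simp add: res_form_def dform_def)

lemma res_form_zero [simp]: "res_form b 0 = 0"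
  by (simp add: res_form_def)

lemma res_form_trivial: "w \<in> trivial_forms b \<Longrightarrow> res_form b w = 0"
  by (induction rule: trivial_forms.induct)
     (simp_all add: res_form_add res_form_diff res_form_pscale res_pair_add res_pair_rscale
       res_pair_leibniz res_pair_exact)

lemma trivial_forms_diff:
  assumes "v \<in> trivial_forms b" "w \<in> trivial_forms b"
  shows "v - w \<in> trivial_forms b"
  using trivial_forms.add[OF assms(1) trivial_forms.scale[OF assms(2), of "- 1"]]
  by (simp add: pscale_uminus)

lemma cls_eq_iff: "cls b w = cls b w' \<longleftrightarrow> w - w' \<in> trivial_forms b"
proof
  assume "cls b w = cls b w'"
  moreover have "w \<in> cls b w" by (simp add: cls_def trivial_forms.zero)
  ultimately show "w - w' \<in> trivial_forms b" by (simp add: cls_def)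
next
  assume w: "w - w' \<in> trivial_forms b"
  have "v - w \<in> trivial_forms b \<longleftrightarrow> v - w' \<in> trivial_forms b" for v
    using trivial_forms.add[of "v - w" b "w - w'"] trivial_forms_diff[of "v - w'" b "w - w'"] w by auto
  then show "cls b w = cls b w'" by (auto simp: cls_def)
qed

definition res_cls :: "complex \<Rightarrow> form set \<Rightarrow> complex" where
  "res_cls b c = res_form b (SOME w. w \<in> c)"

lemma res_cls_cls [simp]: "res_cls b (cls b w) = res_form b w"
proof -
  have "w \<in> cls b w" by (simp add: cls_def trivial_forms.zero)
  then have "(SOME v. v \<in> cls b w) \<in> cls b w" by (rule someI)
  then have "res_form b ((SOME v. v \<in> cls b w) - w) = 0"
    by (intro res_form_trivial) (simp add: cls_def)
  then show ?thesis by (simp add: res_cls_def res_form_diff)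
qed

lemma cls_add: "(\<Union>w\<in>cls b v. \<Union>w'\<in>cls b v'. cls b (w + w')) = cls b (v + v')"
proof -
  have "cls b (w + w') = cls b (v + v')" if "w \<in> cls b v" "w' \<in> cls b v'" for w w'
    unfolding cls_eq_iff using trivial_forms.add[of "w - v" b "w' - v'"] that
    by (simp add: cls_def algebra_simps)
  moreover have "v \<in> cls b v" "v' \<in> cls b v'" by (simp_all add: cls_def trivial_forms.zero)
  ultimately show ?thesis by blast
qed

lemma cls_scale: "(\<Union>w\<in>cls b v. cls b (pscale s w)) = cls b (pscale s v)"
proof -
  have "cls b (pscale s w) = cls b (pscale s v)" if "w \<in> cls b v" for w
  proof -
    have "pscale s w - pscale s v = pscale s (w - v)"
      by (rule poly_mapping_eqI) (simp add: lookup_minus algebra_simps)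
    then show ?thesis
      unfolding cls_eq_iff using trivial_forms.scale[of "w - v" b s] that by (simp add: cls_def)
  qed
  moreover have "v \<in> cls b v" by (simp_all add: cls_def trivial_forms.zero)
  ultimately show ?thesis by blast
qed

lemma res_omega:
  "res_cls b (omega_zero b) = 1" "res_cls b (omega_plus b) = 0" "res_cls b (omega_minus b) = 0"
  by (simp_all add: omega_zero_def omega_plus_def omega_minus_def res_pair_basis)

lemma sl2_table:
  "sl2_br i j k = (case (i, j, k) of
     (SH, SE, SE) \<Rightarrow> 2 | (SE, SH, SE) \<Rightarrow> - 2 | (SH, SF, SF) \<Rightarrow> - 2 | (SF, SH, SF) \<Rightarrow> 2
   | (SE, SF, SH) \<Rightarrow> 1 | (SF, SE, SH) \<Rightarrow> - 1 | _ \<Rightarrow> 0)"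
  "sl2_form i j = (case (i, j) of (SH, SH) \<Rightarrow> 2 | (SE, SF) \<Rightarrow> 1 | (SF, SE) \<Rightarrow> 1 | _ \<Rightarrow> 0)"
  by (cases i; cases j; cases k;
      simp add: sl2_br_def sl2_form_def trace_def matrix_matrix_mult_def sum_2)+

section \<open>Operators commuting with the modes of \<open>\<alpha>\<close> and \<open>\<alpha>\<^sup>1\<close>\<close>

lemma weight_no_a:
  assumes "\<And>v. a_creation r v \<Longrightarrow> lookup M v = 0"
  shows "weight r M \<ge> 0" "weight r M = 0 \<Longrightarrow> x_free M"
proof -
  let ?s = "\<lambda>v. (if aS_creation r v then 1 else if a_creation r v then - 1 else 0) * int (lookup M v)"
  have pos: "?s v \<ge> 0" for v using assms[of v] by auto
  then show "weight r M \<ge> 0" unfolding weight_def by (intro sum_nonneg)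
  assume "weight r M = 0"
  then have *: "\<forall>v\<in>keys M. ?s v = 0"
    unfolding weight_def using pos by (subst (asm) sum_nonneg_eq_0_iff) auto
  show "x_free M"
    unfolding x_free_def
  proof (intro allI impI)
    fix v assume "is_x v"
    then show "lookup M v = 0"
      using bspec[OF *, of v] assms[of v]
      by (cases "a_creation r v"; cases "v \<in> keys M") (auto simp: aS_creation_def in_keys_iff)
  qed
qed

lemma weight_no_aS:
  assumes "\<And>v. aS_creation r v \<Longrightarrow> lookup M v = 0"
  shows "weight r M \<le> 0" "weight r M = 0 \<Longrightarrow> x_free M"
proof -
  let ?s = "\<lambda>v. (if aS_creation r v then 1 else if a_creation r v then - 1 else 0) * int (lookup M v)"
  have neg: "- ?s v \<ge> 0" for v using assms[of v] by auto
  have eq: "- weight r M = (\<Sum>v\<in>keys M. - ?s v)"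
    unfolding weight_def by (simp add: sum_negf)
  show "weight r M \<le> 0" using sum_nonneg[of "keys M" "\<lambda>v. - ?s v"] neg eq by simp
  assume "weight r M = 0"
  then have *: "\<forall>v\<in>keys M. - ?s v = 0"
    using eq neg by (subst sum_nonneg_eq_0_iff[symmetric]) auto
  show "x_free M"
    unfolding x_free_def
  proof (intro allI impI)
    fix v assume "is_x v"
    then show "lookup M v = 0"
      using bspec[OF *, of v] assms[of v]
      by (cases "aS_creation r v"; cases "v \<in> keys M") (auto simp: aS_creation_def in_keys_iff)
  qed
qed

lemma is_x_mode_var:
  assumes "is_x v"
  obtains g n where "\<not> star g" "v = mode_var g n"
proof (cases v)
  case (X m)
  then show ?thesis by (intro that[of Alpha "- m - 1"]) (auto simp: mode_var_def)
next
  case (X1 m)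
  then show ?thesis by (intro that[of Alpha1 "- m - 1"]) (auto simp: mode_var_def)
qed (use assms in auto)

context
  fixes r :: nat
  assumes r: "r \<in> {0, 1}"
begin

text \<open>An operator \<open>C\<close> that commutes with all modes of \<open>\<alpha>\<close> and \<open>\<alpha>\<^sup>1\<close> is linear over the variables by which these
  multiply, so it suffices to consider vectors \<open>G\<close> without such variables. If \<open>G\<close> is homogeneous of
  weight \<open>d\<close>, then by induction on \<open>d\<close> all derivatives of \<open>C G\<close> with respect to the other \<open>x\<close>-variables
  vanish, since \<open>C\<close> commutes with them. Hence \<open>C G\<close> contains only \<open>x\<close>-variables of weight \<open>-1\<close>, and has
  no components of positive weight. Its weight is \<open>d + k\<close>, so it is zero unless \<open>d = k = 0\<close>; in this case
  neither \<open>G\<close> nor \<open>C G\<close> contains \<open>x\<close>-variables, and the hypothesis \<open>base\<close> takes over.\<close>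
context
  fixes C :: "series \<Rightarrow> series" and k :: int
  assumes C: "fock_op r C"
    and comm: "\<And>g n G. \<not> star g \<Longrightarrow> G \<in> fock r \<Longrightarrow> C (field_distr r g n G) = field_distr r g n (C G)"
    and homog: "homogeneous r k C" and k: "k \<ge> 0"
    and base: "\<And>G M. k = 0 \<Longrightarrow> G \<in> fock r \<Longrightarrow> (\<And>M. G M \<noteq> 0 \<Longrightarrow> x_free M) \<Longrightarrow> x_free M \<Longrightarrow> C G M = 0"
begin

lemma commute_creation: "a_creation r v \<Longrightarrow> G \<in> fock r \<Longrightarrow> C (vmul v G) = vmul v (C G)"
proof -
  assume v: "a_creation r v" and G: "G \<in> fock r"
  obtain g n where g: "\<not> star g" "v = mode_var g n" using is_x_mode_var a_creation_is_x[OF v] by blast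
  then have "in_plus r g n" using v mode_var_creation[OF r] by blast
  then have "field_distr r g n = vmul v" using g by (simp add: field_distr_eq[OF r])
  then show "C (vmul v G) = vmul v (C G)" using comm[OF g(1) G, of n] by simp
qed

lemma commute_annihilation: "aS_creation r v \<Longrightarrow> G \<in> fock r \<Longrightarrow> C (vder v G) = vder v (C G)"
proof -
  assume v: "aS_creation r v" and G: "G \<in> fock r"
  obtain g n where g: "\<not> star g" "v = mode_var g n" using is_x_mode_var v aS_creation_def by metis
  then have "\<not> in_plus r g n" using v mode_var_creation[OF r] by blast
  then have "field_distr r g n = vder v" using g by (simp add: field_distr_eq[OF r])
  then show "C (vder v G) = vder v (C G)" using comm[OF g(1) G, of n] by simp
qed

lemma no_aS_of_vder:
  assumes "\<And>v. aS_creation r v \<Longrightarrow> vder v H = 0" "H M \<noteq> 0" "aS_creation r v"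
  shows "lookup M v = 0"
proof (rule ccontr)
  assume nz: "lookup M v \<noteq> 0"
  let ?M = "M - single v 1"
  have eq: "?M + single v 1 = M" using nz by (rule minus_plus_single)
  have "vder v H ?M = of_nat (lookup ?M v + 1) *s H M"
    unfolding vder_def eq by (rule refl)
  moreover have "of_nat (lookup ?M v + 1) \<noteq> (0 :: complex)"
    by (metis add_is_0 of_nat_eq_0_iff one_neq_zero)
  ultimately have "vder v H ?M \<noteq> 0" using assms(2) by (metis vector_mul_eq_0)
  then show False using assms(1)[OF assms(3)] by simp
qed

lemma vanish_step:
  assumes G: "G \<in> fock r" "weight_part r (int d) G = G"
    "\<And>M v. G M \<noteq> 0 \<Longrightarrow> a_creation r v \<Longrightarrow> lookup M v = 0"
    and IH: "\<And>v. aS_creation r v \<Longrightarrow> C (vder v G) = 0"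
  shows "C G = 0"
proof
  fix M
  show "C G M = 0 M"
  proof (rule ccontr)
    assume "C G M \<noteq> 0 M"
    then have nz: "C G M \<noteq> 0" by simp
    have "vder v (C G) = 0" if "aS_creation r v" for v
      using commute_annihilation[OF that G(1)] IH[OF that] by metis
    then have no: "\<And>v. aS_creation r v \<Longrightarrow> lookup M v = 0"
      using no_aS_of_vder[of "C G" M] nz by blast
    have "C G = weight_part r (int d + k) (C G)"
      using homog G(1,2) unfolding homogeneous_def by metis
    then have "weight r M = int d + k" using nz by (metis weight_part_def)
    then have d: "d = 0" "k = 0" "weight r M = 0"
      using weight_no_aS(1)[of r M, OF no] k by auto
    have "x_free N" if "G N \<noteq> 0" for N
    proof -
      have "weight r N = 0" using fun_cong[OF G(2), of N] that d by (simp add: weight_part_def split: if_splits)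
      then show ?thesis using weight_no_a(2) G(3)[OF that] by blast
    qed
    then have "C G M = 0" using base[OF d(2) G(1)] weight_no_aS(2)[of r M, OF no d(3)] by blast
    then show False using nz by simp
  qed
qed

lemma vanish_homogeneous:
  assumes "G \<in> fock r" "weight_part r (int d) G = G"
    "\<And>M v. G M \<noteq> 0 \<Longrightarrow> a_creation r v \<Longrightarrow> lookup M v = 0"
  shows "C G = 0"
  using assms
proof (induction d arbitrary: G)
  case (0 G)
  show ?case
  proof (rule vanish_step[OF 0])
    fix v assume v: "aS_creation r v"
    have "vder v G = 0"
    proof
      fix M
      show "vder v G M = 0 M"
      proof (rule ccontr)
        let ?M = "M + single v 1"
        assume "vder v G M \<noteq> 0 M"
        then have nz: "G ?M \<noteq> 0" by (auto simp: vder_def)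
        have "weight r ?M = 0"
          using fun_cong[OF 0(2), of ?M] nz by (simp add: weight_part_def split: if_splits)
        then have "x_free ?M" using weight_no_a(2) 0(3)[OF nz] by blast
        then show False using v by (auto simp: x_free_def aS_creation_def lookup_add)
      qed
    qed
    then show "C (vder v G) = 0" using fock_opD(3)[OF r C 0(1)] by simp
  qed
next
  case (Suc d G)
  show ?case
  proof (rule vanish_step[OF Suc.prems])
    fix v assume v: "aS_creation r v"
    show "C (vder v G) = 0"
    proof (rule Suc.IH)
      show "vder v G \<in> fock r" by (rule fock_vder[OF r Suc.prems(1)])
      have "vder v G = weight_part r (int (Suc d) - weight r (single v 1)) (vder v G)"
        using weight_part_vder Suc.prems(2) by metis
      moreover have "weight r (single v 1) = 1" using v unfolding weight_single by simp
      ultimately show "weight_part r (int d) (vder v G) = vder v G" by simp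
      fix M w assume "vder v G M \<noteq> 0" and w: "a_creation r w"
      then have "G (M + single v 1) \<noteq> 0" by (auto simp: vder_def)
      from Suc.prems(3)[OF this w] show "lookup M w = 0" by (simp add: lookup_add)
    qed
  qed
qed

text \<open>A coefficient of \<open>C G\<close> depends only on one of the possibly infinitely many homogeneous components of \<open>G\<close>.\<close>
lemma vanish_no_a:
  assumes G: "G \<in> fock r"
    and no: "\<And>M v. G M \<noteq> 0 \<Longrightarrow> a_creation r v \<Longrightarrow> lookup M v = 0"
  shows "C G = 0"
proof
  fix M
  let ?w = "weight r M - k"
  have H: "weight_part r ?w G \<in> fock r" by (rule fock_weight_part[OF r G])
  have "C (weight_part r ?w G) = 0"
  proof (cases "?w \<ge> 0")
    case True
    show ?thesis
    proof (rule vanish_homogeneous[OF H])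
      show "weight_part r (int (nat ?w)) (weight_part r ?w G) = weight_part r ?w G"
        using True by (auto simp: weight_part_def fun_eq_iff)
      show "lookup N v = 0" if "weight_part r ?w G N \<noteq> 0" "a_creation r v" for N v
        using no that by (auto simp: weight_part_def split: if_splits)
    qed
  next
    case False
    have "weight_part r ?w G N = 0" for N
    proof (cases "G N = 0")
      case False
      then have "weight r N \<ge> 0" using weight_no_a(1) no by blast
      then show ?thesis using \<open>\<not> ?w \<ge> 0\<close> by (auto simp: weight_part_def)
    qed (simp add: weight_part_def)
    then have "weight_part r ?w G = 0" by (auto simp: fun_eq_iff)
    then show ?thesis using fock_opD(3)[OF r C G] by simp
  qed
  moreover have "C (weight_part r ?w G) = weight_part r (?w + k) (C G)"
    using homog G unfolding homogeneous_def by blast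
  ultimately have "weight_part r (?w + k) (C G) M = 0" by (metis zero_fun_apply)
  then show "C G M = 0 M" by (simp add: weight_part_def)
qed

lemma vanish_bounded:
  assumes "finite F" "G \<in> fock r" "a_bounded r F B G"
  shows "C G = 0"
  using assms
proof (induction F arbitrary: G rule: finite_induct)
  case empty
  then show ?case by (intro vanish_no_a) (auto simp: a_bounded_def)
next
  case (insert v F G)
  show ?case
  proof (cases "a_creation r v")
    case False
    have "a_bounded r F B G"
      by (rule a_boundedI) (use a_boundedD[OF insert.prems(2)] False in blast)
    then show ?thesis using insert.IH insert.prems(1) by blast
  next
    case v: True
    \<comment> \<open>Induction on the exponent of \<open>v\<close>, splitting off the part without \<open>v\<close>.\<close>
    have "C H = 0" if "H \<in> fock r" "a_bounded r (insert v F) B H"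
      "\<And>M. H M \<noteq> 0 \<Longrightarrow> lookup M v \<le> d" for d H
      using that
    proof (induction d arbitrary: H)
      case (0 H)
      have "a_bounded r F B H"
        by (rule a_boundedI) (use a_boundedD[OF 0(2)] 0(3) in fastforce)
      then show ?case using insert.IH 0(1) by blast
    next
      case (Suc d H)
      define H0 where "H0 = (\<lambda>M. if lookup M v = 0 then H M else 0)"
      define H1 where "H1 = (\<lambda>M. H (M + single v 1))"
      have H1: "H1 \<in> fock r" by (rule fock_shift[OF r Suc.prems(1), of _ v]) (simp add: H1_def)
      have H0: "H0 \<in> fock r"
        by (rule fock_support[OF r Suc.prems(1)]) (auto simp: H0_def split: if_splits)
      have split: "H = H0 + vmul v H1"
      proof
        fix M
        show "H M = (H0 + vmul v H1) M"
          by (cases "lookup M v = 0") (simp_all add: H0_def H1_def vmul_def minus_plus_single del: One_nat_def)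
      qed
      have "a_bounded r F B H0"
      proof (rule a_boundedI)
        fix M w assume nz: "H0 M \<noteq> 0" and w: "a_creation r w"
        then have "H M \<noteq> 0" "lookup M v = 0" by (auto simp: H0_def split: if_splits)
        then show "lookup M w \<le> B \<and> (lookup M w \<noteq> 0 \<longrightarrow> w \<in> F)"
          using a_boundedD[OF Suc.prems(2) _ w, of M] by auto
      qed
      then have "C H0 = 0" using insert.IH H0 by blast
      moreover have "C H1 = 0"
      proof (rule Suc.IH[OF H1])
        show "a_bounded r (insert v F) B H1"
        proof (rule a_boundedI)
          fix M w assume nz: "H1 M \<noteq> 0" and w: "a_creation r w"
          then have "H (M + single v 1) \<noteq> 0" by (simp add: H1_def)
          from a_boundedD[OF Suc.prems(2) this w]
          show "lookup M w \<le> B \<and> (lookup M w \<noteq> 0 \<longrightarrow> w \<in> insert v F)"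
            by (auto simp: lookup_add)
        qed
        show "lookup M v \<le> d" if "H1 M \<noteq> 0" for M
          using Suc.prems(3)[of "M + single v 1"] that by (simp add: H1_def lookup_add)
      qed
      ultimately have "C H0 + C (vmul v H1) = 0"
        unfolding commute_creation[OF v H1] by (simp add: vmul_linear)
      then show ?case
        unfolding split using fock_opD(5)[OF r C H0 fock_vmul[OF r H1]] by metis
    qed
    then show ?thesis using insert.prems a_boundedD[OF insert.prems(2) _ v] by blast
  qed
qed

lemma vanish: "G \<in> fock r \<Longrightarrow> C G = 0"
  using vanish_bounded fock_iff[OF r] by metis

end

end

section \<open>Linear families of operators indexed by the coordinate ring\<close>

definition coord_linear :: "(coord \<Rightarrow> series) \<Rightarrow> bool" where
  "coord_linear T \<longleftrightarrow> (\<forall>p q. T (p + q) = T p + T q) \<and> (\<forall>c p. T (rscale c p) = vscale c (T p))"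

lemma coord_linearD:
  assumes "coord_linear T"
  shows "T (p + q) = T p + T q" "T (rscale c p) = vscale c (T p)" "T 0 = 0"
proof -
  show "T (p + q) = T p + T q" using assms unfolding coord_linear_def by blast
  show sc: "T (rscale c p) = vscale c (T p)" for c p
    using assms unfolding coord_linear_def by blast
  show "T 0 = 0" using sc[of 0 0] by (simp add: rscale_simps)
qed

definition lin :: "(int \<Rightarrow> series \<Rightarrow> series) \<Rightarrow> (int \<Rightarrow> series \<Rightarrow> series) \<Rightarrow> coord \<Rightarrow> series \<Rightarrow> series" where
  "lin A0 A1 p G =
     (\<Sum>m\<in>keys (fst p). vscale (lookup (fst p) m) (A0 m G)) +
     (\<Sum>m\<in>keys (snd p). vscale (lookup (snd p) m) (A1 m G))"

lemma lin_basis: "lin A0 A1 (tpow m) G = A0 m G" "lin A0 A1 (tupow m) G = A1 m G"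
  by (simp_all add: lin_def tpow_def tupow_def)

lemma coord_linear_lin: "coord_linear (\<lambda>p. lin A0 A1 p G)"
proof -
  have add: "(\<Sum>m\<in>keys (p + q). vscale (lookup (p + q) m) (A m G)) =
      (\<Sum>m\<in>keys p. vscale (lookup p m) (A m G)) +
      (\<Sum>m\<in>keys q. vscale (lookup q m) (A m G))"
    for p q :: laurent and A :: "int \<Rightarrow> series \<Rightarrow> series"
    by (rule setsum_keys_plus_distrib[where f = "\<lambda>m c. vscale c (A m G)"])
       (simp_all only: vscale_simps vscale_distribs)
  have sc: "(\<Sum>m\<in>keys (pscale c p). vscale (lookup (pscale c p) m) (A m G)) =
      vscale c (\<Sum>m\<in>keys p. vscale (lookup p m) (A m G))"
    for c and p :: laurent and A :: "int \<Rightarrow> series \<Rightarrow> series"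
  proof -
    have "(\<Sum>m\<in>keys (pscale c p). vscale (lookup (pscale c p) m) (A m G)) =
        (\<Sum>m\<in>keys p. vscale (c * lookup p m) (A m G))"
      by (intro sum.mono_neutral_cong_left) (auto simp: in_keys_iff)
    then show ?thesis unfolding vscale_sum vscale_simps .
  qed
  show ?thesis
    unfolding coord_linear_def lin_def fst_add snd_add rscale_def fst_conv snd_conv add sc
    by (simp only: vscale_distribs ac_simps simp_thms)
qed

lemma homogeneous_lin:
  assumes "\<And>m. homogeneous r k (A0 m)" "\<And>m. homogeneous r k (A1 m)"
  shows "homogeneous r k (lin A0 A1 p)"
  unfolding lin_def[abs_def]
  by (intro homogeneous_add homogeneous_sum homogeneous_vscale assms)

context
  fixes r :: nat
  assumes r: "r \<in> {0, 1}"
begin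

lemma fock_op_lin:
  assumes "\<And>m. fock_op r (A0 m)" "\<And>m. fock_op r (A1 m)"
  shows "fock_op r (lin A0 A1 p)"
  unfolding lin_def[abs_def]
  by (intro fock_op_add[OF r] fock_op_sum[OF r] fock_op_vscale[OF r] assms)

text \<open>With \<open>\<pi>\<close> a restriction, this also serves for identities that hold only at certain monomials.\<close>
lemma commutator_bilinear:
  assumes A: "\<And>G. coord_linear (\<lambda>p. A p G)" "\<And>p. fock_op r (A p)"
    and B: "\<And>G. coord_linear (\<lambda>q. B q G)" "\<And>q. fock_op r (B q)"
    and R: "\<And>q. coord_linear (\<lambda>p. R p q)" "\<And>p. coord_linear (\<lambda>q. R p q)"
    and \<pi>: "linear_op \<pi>" and G: "G \<in> fock r"
    and basis: "\<And>p q. p \<in> range tpow \<union> range tupow \<Longrightarrow> q \<in> range tpow \<union> range tupow \<Longrightarrow>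
      \<pi> (A p (B q G)) = \<pi> (B q (A p G)) + R p q"
  shows "\<pi> (A p (B q G)) = \<pi> (B q (A p G)) + R p q"
proof -
  note A1 = coord_linearD[OF A(1)] and B1 = coord_linearD[OF B(1)]
  have inA: "A p G \<in> fock r" and inB: "B q G \<in> fock r" for p q
    using fock_opD(1)[OF r A(2) G] fock_opD(1)[OF r B(2) G] by blast+
  note AG = fock_opD[OF r A(2) inB] and BG = fock_opD[OF r B(2) inA]
  note simps = A1 B1 AG(2) AG(5)[OF inB] BG(2) BG(5)[OF inA] linear_opD[OF \<pi>]
    coord_linearD[OF R(1)] coord_linearD[OF R(2)] vscale_distribs
  have q: "\<pi> (A p (B q G)) = \<pi> (B q (A p G)) + R p q" if p: "p \<in> range tpow \<union> range tupow" for p q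
  proof (induction q rule: coord_induct)
    case zero
    show ?case
      unfolding B1 fock_opD(3)[OF r A(2) G] coord_linearD(3)[OF R(2)] linear_opD(3)[OF \<pi>] by simp
  next
    case (tpow c m)
    have "tpow m \<in> range tpow \<union> range tupow" by simp
    from basis[OF p this] show ?case by (simp only: simps)
  next
    case (tupow c m)
    have "tupow m \<in> range tpow \<union> range tupow" by simp
    from basis[OF p this] show ?case by (simp only: simps)
  next
    case (add q q')
    then show ?case by (simp only: simps) (simp only: ac_simps)
  qed
  show ?thesis
  proof (induction p rule: coord_induct)
    case zero
    show ?case
      unfolding A1 fock_opD(3)[OF r B(2) G] coord_linearD(3)[OF R(1)] linear_opD(3)[OF \<pi>] by simp
  next
    case (tpow c m)
    have "tpow m \<in> range tpow \<union> range tupow" by simp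
    from q[OF this] show ?case by (simp only: simps)
  next
    case (tupow c m)
    have "tupow m \<in> range tpow \<union> range tupow" by simp
    from q[OF this] show ?case by (simp only: simps)
  next
    case (add p p')
    then show ?case by (simp only: simps) (simp only: ac_simps)
  qed
qed

end

section \<open>Jacobi identities\<close>

text \<open>The difference of the two sides is the residue of \<open>s d(p q) + p q ds\<close>, which is exact.\<close>
lemma res_pair_cyclic:
  "res_pair b p (rmul b q s) + res_pair b q (rmul b p s) = res_pair b (rmul b p q) s"
  using res_pair_leibniz[of b p q s] res_pair_leibniz[of b q p s] res_pair_leibniz[of b s p q]
    res_pair_antisym[of b "rmul b p q" s] rmul_commute[of b]
  by simp

lemma rmul_left_commute: "rmul b p (rmul b q s) = rmul b q (rmul b p s)"
  by (metis rmul_assoc rmul_commute)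

text \<open>The brackets with \<open>F\<close>, and \<open>[H, H]\<close> on vectors without \<open>x\<close>-variables, determine the remaining ones: the deviation of a bracket from its expected value
  commutes with \<open>F\<close> by the Jacobi identity, and \<open>vanish\<close> applies to it.\<close>
context
  fixes r :: nat and b lev :: complex and E H F :: "coord \<Rightarrow> series \<Rightarrow> series"
  assumes r: "r \<in> {0, 1}"
    and ops: "\<And>p. fock_op r (E p)" "\<And>p. fock_op r (H p)" "\<And>p. fock_op r (F p)"
    and homog: "\<And>p. homogeneous r 1 (E p)" "\<And>p. homogeneous r 0 (H p)"
    and alpha: "\<And>g n. \<not> star g \<Longrightarrow> \<exists>q. \<forall>G. field_distr r g n G = - F q G"
    and HF: "\<And>p q G. G \<in> fock r \<Longrightarrow> H p (F q G) = F q (H p G) + vscale (- 2) (F (rmul b p q) G)"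
    and EF: "\<And>p q G. G \<in> fock r \<Longrightarrow>
      E p (F q G) = F q (E p G) + (H (rmul b p q) G + vscale (lev * res_pair b p q) G)"
    and vacuum: "\<And>p q G M. G \<in> fock r \<Longrightarrow> (\<And>M. G M \<noteq> 0 \<Longrightarrow> x_free M) \<Longrightarrow> x_free M \<Longrightarrow>
      H p (H q G) M = H q (H p G) M + (2 * lev * res_pair b p q) *s G M"
begin

lemma op_rules:
  assumes "G \<in> fock r"
  shows "E p G \<in> fock r" "H p G \<in> fock r" "F p G \<in> fock r" "vscale c G \<in> fock r"
    "G' \<in> fock r \<Longrightarrow> G + G' \<in> fock r"
    "E p (vscale c G) = vscale c (E p G)" "H p (vscale c G) = vscale c (H p G)"
    "F p (vscale c G) = vscale c (F p G)"
    "G' \<in> fock r \<Longrightarrow> E p (G + G') = E p G + E p G'"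
    "G' \<in> fock r \<Longrightarrow> H p (G + G') = H p G + H p G'"
    "G' \<in> fock r \<Longrightarrow> F p (G + G') = F p G + F p G'"
    "G' \<in> fock r \<Longrightarrow> E p (G - G') = E p G - E p G'"
    "G' \<in> fock r \<Longrightarrow> H p (G - G') = H p G - H p G'"
    "G' \<in> fock r \<Longrightarrow> F p (G - G') = F p G - F p G'" "G' \<in> fock r \<Longrightarrow> G - G' \<in> fock r"
  by (rule fock_opD(1)[OF r ops(1) assms] fock_opD(1)[OF r ops(2) assms] fock_opD(1)[OF r ops(3) assms]
      fock_vscale[OF r assms] fock_add[OF r assms] fock_diff[OF r assms]
      fock_opD(2)[OF r ops(1) assms] fock_opD(2)[OF r ops(2) assms] fock_opD(2)[OF r ops(3) assms]
      fock_opD(5)[OF r ops(1) assms] fock_opD(5)[OF r ops(2) assms] fock_opD(5)[OF r ops(3) assms]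
      fock_opD(6)[OF r ops(1) assms] fock_opD(6)[OF r ops(2) assms]
      fock_opD(6)[OF r ops(3) assms]; assumption)+

lemma commutes_with_alpha:
  assumes C: "fock_op r C" "\<And>s G. G \<in> fock r \<Longrightarrow> C (F s G) = F s (C G)"
    and g: "\<not> star g" "G \<in> fock r"
  shows "C (field_distr r g n G) = field_distr r g n (C G)"
proof -
  obtain q where q: "\<forall>G. field_distr r g n G = - F q G" using alpha[OF g(1)] by blast
  have "C (- F q G) = - C (F q G)" by (rule fock_opD(4)[OF r C(1)]) (rule op_rules(3)[OF g(2)])
  also have "\<dots> = - F q (C G)" using C(2)[OF g(2)] by simp
  finally show ?thesis unfolding q[rule_format] .
qed

lemma relation_HH:
  assumes G: "G \<in> fock r"
  shows "H p (H q G) = H q (H p G) + vscale (2 * lev * res_pair b p q) G"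
proof -
  define C where "C G = H p (H q G) - H q (H p G) - vscale (2 * lev * res_pair b p q) G" for G
  have op: "fock_op r C"
    unfolding C_def[abs_def]
    by (intro fock_op_diff[OF r] fock_op_comp[OF r ops(2) ops(2)]
        fock_op_linear_op[OF linear_op_simple(1) fock_vscale[OF r]])
  have hom: "homogeneous r 0 C"
    unfolding C_def[abs_def]
    using homogeneous_comp[OF homog(2) homog(2) op_rules(2)]
    by (intro homogeneous_diff homogeneous_scalar) simp_all
  have "C (F s G) = F s (C G)" if "G \<in> fock r" for s G
    unfolding C_def using that
    by (simp only: op_rules HF rmul_left_commute[of b q p s] vscale_distribs(1,2))
       (rule ext, simp add: vec_eq_iff algebra_simps)
  then have comm: "C (field_distr r g n G) = field_distr r g n (C G)" if "\<not> star g" "G \<in> fock r" for g n G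
    using commutes_with_alpha[OF op] that by blast
  have "C G M = 0" if "G \<in> fock r" "\<And>M. G M \<noteq> 0 \<Longrightarrow> x_free M" "x_free M" for G M
    using vacuum[OF that, of p q] by (simp add: C_def)
  then have "C G = 0"
    by (intro vanish[OF r op comm hom _ _ G]) auto
  then show ?thesis by (simp add: C_def algebra_simps)
qed

text \<open>The deviation raises the weight by one, so nothing has to be checked on vectors without
  \<open>x\<close>-variables. In its commutator with \<open>F\<close> the central terms cancel by \<open>res_pair_cyclic\<close>.\<close>
lemma relation_HE:
  assumes G: "G \<in> fock r"
  shows "H p (E q G) = E q (H p G) + vscale 2 (E (rmul b p q) G)"
proof -
  define C where "C G = H p (E q G) - E q (H p G) - vscale 2 (E (rmul b p q) G)" for G
  have op: "fock_op r C"
    unfolding C_def[abs_def]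
    by (intro fock_op_diff[OF r] fock_op_comp[OF r ops(2) ops(1)] fock_op_comp[OF r ops(1) ops(2)]
        fock_op_vscale[OF r] ops)
  have hom: "homogeneous r 1 C"
    unfolding C_def[abs_def]
    using homogeneous_comp[OF homog(2,1) op_rules(1)] homogeneous_comp[OF homog(1,2) op_rules(2)]
    by (intro homogeneous_diff homogeneous_vscale homog) simp_all
  have "C (F s G) = F s (C G)" if "G \<in> fock r" for s G
    unfolding C_def using that
    by (simp only: op_rules HF EF relation_HH[of _ p] rmul_left_commute[of b q p s] rmul_assoc
          vscale_distribs(1,2) res_pair_cyclic[of b p q s, symmetric])
       (rule ext, simp add: vec_eq_iff algebra_simps)
  then have comm: "C (field_distr r g n G) = field_distr r g n (C G)" if "\<not> star g" "G \<in> fock r" for g n G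
    using commutes_with_alpha[OF op] that by blast
  have "C G = 0"
    by (rule vanish[OF r op comm hom _ _ G]) auto
  then show ?thesis by (simp add: C_def algebra_simps)
qed

lemma relation_EE:
  assumes G: "G \<in> fock r"
  shows "E p (E q G) = E q (E p G)"
proof -
  define C where "C G = E p (E q G) - E q (E p G)" for G
  have op: "fock_op r C"
    unfolding C_def[abs_def] by (intro fock_op_diff[OF r] fock_op_comp[OF r ops(1) ops(1)])
  have hom: "homogeneous r 2 C"
    unfolding C_def[abs_def]
    using homogeneous_comp[OF homog(1,1) op_rules(1)]
    by (intro homogeneous_diff) simp_all
  have "C (F s G) = F s (C G)" if "G \<in> fock r" for s G
  proof -
    have eq: "rmul b (rmul b p s) q = rmul b (rmul b q s) p"
      by (metis rmul_assoc rmul_commute)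
    show ?thesis
      unfolding C_def using that
      by (simp only: op_rules HF EF relation_HE eq vscale_distribs(1,2))
         (rule ext, simp add: vec_eq_iff algebra_simps)
  qed
  then have comm: "C (field_distr r g n G) = field_distr r g n (C G)" if "\<not> star g" "G \<in> fock r" for g n G
    using commutes_with_alpha[OF op] that by blast
  have "C G = 0"
    by (rule vanish[OF r op comm hom _ _ G]) auto
  then show ?thesis by (simp add: C_def algebra_simps)
qed

end

lemma lie_repD:
  assumes rep: "lie_rep L W \<theta>" and g: "g \<in> lie_carrier L" and G: "G \<in> W"
  shows "\<theta> g G \<in> W" "\<theta> (lie_scale L c g) G = vscale c (\<theta> g G)"
    "h \<in> lie_carrier L \<Longrightarrow> \<theta> (lie_add L g h) G = \<theta> g G + \<theta> h G"
    "h \<in> lie_carrier L \<Longrightarrow> \<theta> (lie_bracket L g h) G = \<theta> g (\<theta> h G) - \<theta> h (\<theta> g G)"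
  using rep[unfolded lie_rep_def] g G by blast+

section \<open>The currents\<close>

lemma lmult_add: "lmult (p + q) A n G = lmult p A n G + lmult q A n G"
  unfolding lmult_def
  by (rule setsum_keys_plus_distrib[where f = "\<lambda>k c. vscale c (A (n - k) G)"])
     (simp_all only: vscale_simps vscale_distribs)

lemma lmult_single: "lmult (single k c) A n G = vscale c (A (n - k) G)"
  by (cases "c = 0") (simp_all add: lmult_def)

lemma lmult_curve:
  "lmult (curve b) A n G = A (n - 3) G + (vscale (- 2 * b) (A (n - 2) G) + A (n - 1) G)"
  unfolding curve_def lmult_add lmult_single vscale_simps by (simp only: ac_simps)

lemma lderiv_curve:
  "lderiv (curve b) =
     single 2 3 + single 1 (- 4 * b) + single 0 1"
  by (simp add: curve_def lderiv_add lderiv_single)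

lemma lmult_lderiv_curve:
  "lmult (lderiv (curve b)) A n G =
     vscale 3 (A (n - 2) G) + (vscale (- 4 * b) (A (n - 1) G) + A n G)"
  unfolding lderiv_curve lmult_add lmult_single vscale_simps by (simp add: ac_simps)

lemma X_neq [simp]: "X \<noteq> X1" "X1 \<noteq> X"
  by (metis var.distinct(1))+

locale currents =
  fixes r :: nat and b chi0 lam \<mu> \<nu> \<kappa> :: complex
  assumes r: "r \<in> {0, 1}"
begin

abbreviation "fd \<equiv> field_distr r"

text \<open>The value \<open>\<kappa>\<^sub>0\<close> at \<open>\<omega>\<^sub>0\<close>; the \<open>4\<close> comes from the double contractions of the two pairs
  \<open>\<alpha>, \<alpha>\<^sup>*\<close> and \<open>\<alpha>\<^sup>1, \<alpha>\<^bsup>1*\<^esup>\<close>.\<close>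
definition level :: complex where
  "level = chi0 + (if r = 0 then 4 else 0)"

definition h0 :: distr where
  "h0 = dscale 2 (nord r [Alpha, AlphaS] + nord r [Alpha1, Alpha1S]) + beta chi0 lam"

definition h1 :: distr where
  "h1 = dscale 2 (nord r [Alpha1, AlphaS] + lmult (curve b) (nord r [Alpha, Alpha1S])) +
     beta1 b chi0 \<mu> \<nu> \<kappa>"

definition e0 :: distr where
  "e0 = nord r [Alpha, AlphaS, AlphaS]
                + lmult (curve b) (nord r [Alpha, Alpha1S, Alpha1S])
                + dscale 2 (nord r [Alpha1, AlphaS, Alpha1S])
                + dprod (beta chi0 lam) (fd AlphaS) + dprod (beta1 b chi0 \<mu> \<nu> \<kappa>) (fd Alpha1S)
                + dscale level (dz (fd AlphaS))"

definition e1 :: distr where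
  "e1 = nord r [Alpha1, AlphaS, AlphaS]
                + lmult (curve b) (nord r [Alpha1, Alpha1S, Alpha1S]
                           + dscale 2 (nord r [Alpha, AlphaS, Alpha1S]))
                + dprod (beta1 b chi0 \<mu> \<nu> \<kappa>) (fd AlphaS) + lmult (curve b) (dprod (beta chi0 lam) (fd Alpha1S))
                + dscale level (lmult (curve b) (dz (fd Alpha1S)))
                + dscale (level / 2) (lmult (lderiv (curve b)) (fd Alpha1S))"

lemmas y_ops = y_op_beta[OF r, of chi0 lam] y_op_beta1[OF r, of b chi0 \<mu> \<nu> \<kappa>]

lemma fock_op_field: "fock_op r (fd g n)"
  by (rule fock_op_linear_op[OF linear_op_field[OF r] fock_field[OF r]])

lemmas fock_op_dprods =
  fock_op_dprod[OF r y_ops(1) y_cutoff_beta] fock_op_dprod[OF r y_ops(2) y_cutoff_beta1]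

lemma h0_apply: "h0 n G = vscale 2 (nord r [Alpha, AlphaS] n G + nord r [Alpha1, Alpha1S] n G) + beta chi0 lam n G"
  by (simp add: h0_def dscale_def)

lemma h1_apply: "h1 n G = vscale 2 (nord r [Alpha1, AlphaS] n G +
    (nord r [Alpha, Alpha1S] (n - 3) G + (vscale (- 2 * b) (nord r [Alpha, Alpha1S] (n - 2) G) +
      nord r [Alpha, Alpha1S] (n - 1) G))) + beta1 b chi0 \<mu> \<nu> \<kappa> n G"
  unfolding h1_def plus_fun_apply dscale_def lmult_curve by (rule refl)

lemma e0_apply: "e0 n G = nord r [Alpha, AlphaS, AlphaS] n G +
    (nord r [Alpha, Alpha1S, Alpha1S] (n - 3) G +
      (vscale (- 2 * b) (nord r [Alpha, Alpha1S, Alpha1S] (n - 2) G) +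
       nord r [Alpha, Alpha1S, Alpha1S] (n - 1) G)) +
    vscale 2 (nord r [Alpha1, AlphaS, Alpha1S] n G) +
    dprod (beta chi0 lam) (fd AlphaS) n G + dprod (beta1 b chi0 \<mu> \<nu> \<kappa>) (fd Alpha1S) n G +
    vscale level (vscale (of_int (n + 1)) (fd AlphaS (n + 1) G))"
  unfolding e0_def plus_fun_apply dscale_def lmult_curve dz_def by (rule refl)

lemma e1_apply: "e1 n G = nord r [Alpha1, AlphaS, AlphaS] n G +
    (nord r [Alpha1, Alpha1S, Alpha1S] (n - 3) G + vscale 2 (nord r [Alpha, AlphaS, Alpha1S] (n - 3) G) +
      (vscale (- 2 * b) (nord r [Alpha1, Alpha1S, Alpha1S] (n - 2) G + vscale 2 (nord r [Alpha, AlphaS, Alpha1S] (n - 2) G)) +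
       (nord r [Alpha1, Alpha1S, Alpha1S] (n - 1) G + vscale 2 (nord r [Alpha, AlphaS, Alpha1S] (n - 1) G)))) +
    dprod (beta1 b chi0 \<mu> \<nu> \<kappa>) (fd AlphaS) n G +
    (dprod (beta chi0 lam) (fd Alpha1S) (n - 3) G +
      (vscale (- 2 * b) (dprod (beta chi0 lam) (fd Alpha1S) (n - 2) G) +
       dprod (beta chi0 lam) (fd Alpha1S) (n - 1) G)) +
    vscale level (vscale (of_int (n - 3 + 1)) (fd Alpha1S (n - 3 + 1) G) +
      (vscale (- 2 * b) (vscale (of_int (n - 2 + 1)) (fd Alpha1S (n - 2 + 1) G)) +
       vscale (of_int (n - 1 + 1)) (fd Alpha1S (n - 1 + 1) G))) +
    vscale (level / 2) (vscale 3 (fd Alpha1S (n - 2) G) +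
      (vscale (- 4 * b) (fd Alpha1S (n - 1) G) + fd Alpha1S n G))"
  unfolding e1_def plus_fun_apply dscale_def lmult_curve lmult_lderiv_curve dz_def by (rule refl)

lemma fock_op_currents: "fock_op r (h0 n)" "fock_op r (h1 n)" "fock_op r (e0 n)" "fock_op r (e1 n)"
proof -
  note rules = fock_op_add[OF r] fock_op_vscale[OF r] y_op_fock_op[OF r y_ops(1)] y_op_fock_op[OF r y_ops(2)]
    fock_op_nord[OF r] fock_op_dprods fock_op_field
  show "fock_op r (h0 n)" unfolding h0_apply[abs_def] by (intro rules) simp_all
  show "fock_op r (h1 n)" unfolding h1_apply[abs_def] by (intro rules) simp_all
  show "fock_op r (e0 n)" unfolding e0_apply[abs_def] by (intro rules) simp_all
  show "fock_op r (e1 n)" unfolding e1_apply[abs_def] by (intro rules) simp_all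
qed

lemma homogeneous_currents:
  "homogeneous r 0 (h0 n)" "homogeneous r 0 (h1 n)" "homogeneous r 1 (e0 n)" "homogeneous r 1 (e1 n)"
proof -
  have pair: "homogeneous r 0 (nord r [g, s] m)" if "\<not> star g" "star s" for g s m
    using homogeneous_nord[OF r, of "[g, s]" m] that by simp
  have triple: "homogeneous r 1 (nord r [g, s, s'] m)" if "\<not> star g" "star s" "star s'" for g s s' m
    using homogeneous_nord[OF r, of "[g, s, s']" m] that by simp
  note rules = homogeneous_add homogeneous_vscale pair triple homogeneous_y_op[OF r y_ops(1)] homogeneous_y_op[OF r y_ops(2)]
    homogeneous_dprod[OF r y_ops(1)] homogeneous_dprod[OF r y_ops(2)] homogeneous_star[OF r]
  show "homogeneous r 0 (h0 n)" unfolding h0_apply[abs_def] by (intro rules) simp_all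
  show "homogeneous r 0 (h1 n)" unfolding h1_apply[abs_def] by (intro rules) simp_all
  show "homogeneous r 1 (e0 n)" unfolding e0_apply[abs_def] by (intro rules) simp_all
  show "homogeneous r 1 (e1 n)" unfolding e1_apply[abs_def] by (intro rules) simp_all
qed

section \<open>Commutators of the currents with \<open>\<alpha>\<close> and \<open>\<alpha>\<^sup>1\<close>\<close>

context
  fixes G :: series
  assumes G: "G \<in> fock r"
begin

lemmas fd_linear = linear_opD[OF linear_op_field[OF r]]

lemmas contractions =
  contract_nord_pair[OF r _ _ _ G] contract_nord_triple[OF r _ _ _ _ G]
  contract_dprod[OF r y_ops(1) y_cutoff_beta _ _ G] contract_dprod[OF r y_ops(2) y_cutoff_beta1 _ _ G]
  alphaS_alpha_commutator[OF r] y_op_field[OF r y_ops(1)] y_op_field[OF r y_ops(2)]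
  star.simps sheet.simps X_neq if_True if_False simp_thms

lemma h0_alpha:
  "h0 n (fd Alpha k G) = fd Alpha k (h0 n G) + vscale (- 2) (fd Alpha (n + k + 1) G)"
  "h0 n (fd Alpha1 k G) = fd Alpha1 k (h0 n G) + vscale (- 2) (fd Alpha1 (n + k + 1) G)"
  unfolding h0_apply fd_linear
  by (simp only: contractions fd_linear vscale_distribs,
      rule ext, simp add: vec_eq_iff algebra_simps)+

lemma h1_alpha:
  "h1 n (fd Alpha k G) = fd Alpha k (h1 n G) + vscale (- 2) (fd Alpha1 (n + k + 1) G)"
  "h1 n (fd Alpha1 k G) = fd Alpha1 k (h1 n G) + vscale (- 2) (lmult (curve b) (fd Alpha) (n + k + 1) G)"
  unfolding h1_apply fd_linear lmult_curve
  by (simp only: contractions fd_linear vscale_distribs,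
      rule ext, simp add: vec_eq_iff algebra_simps)+

lemma e0_alpha:
  "e0 n (fd Alpha k G) = fd Alpha k (e0 n G) -
     (h0 (n + k + 1) G + vscale (if n + k = - 2 then level * of_int (n + 1) else 0) G)"
  "e0 n (fd Alpha1 k G) = fd Alpha1 k (e0 n G) - h1 (n + k + 1) G"
  unfolding e0_apply h0_apply h1_apply fd_linear
  by (simp only: contractions fd_linear vscale_distribs,
      rule ext, simp add: vec_eq_iff algebra_simps)+

lemma e1_alpha:
  "e1 n (fd Alpha k G) = fd Alpha k (e1 n G) - h1 (n + k + 1) G"
  unfolding e1_apply h1_apply fd_linear
  by (simp only: contractions fd_linear vscale_distribs,
      rule ext, simp add: vec_eq_iff algebra_simps)

lemma e1_alpha1:
  "e1 n (fd Alpha1 k G) = fd Alpha1 k (e1 n G) -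
     (lmult (curve b) h0 (n + k + 1) G +
      vscale (level / 2 * b1_bracket b (- n - 1) (- k - 1)) G)"
proof -
  \<comment> \<open>The form in which the scalar arises from \<open>\<kappa>\<^sub>0 P \<partial>\<alpha>\<^bsup>1*\<^esup> + \<kappa>\<^sub>0 / 2 P' \<alpha>\<^bsup>1*\<^esup>\<close>.\<close>
  have br: "b1_bracket b (- n - 1) (- k - 1) =
      (if n - 2 + k = - 1 then 2 * of_int (n - 3 + 1) + 3 else 0) +
      (if n - 1 + k = - 1 then - 4 * b * of_int (n - 2 + 1) - 4 * b else 0) +
      (if n + k = - 1 then 2 * of_int n + 1 else 0)"
  proof -
    consider "k = 1 - n" | "k = - n" | "k = - 1 - n" | "n + k \<notin> {1, 0, - 1}" by force
    then show ?thesis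
    proof cases
      case 4
      then show ?thesis by (auto simp: b1_bracket_def)
    qed (hypsubst, simp add: b1_bracket_def algebra_simps)+
  qed
  have ifs: "n - 3 + 1 + k = - 1 \<longleftrightarrow> n - 2 + k = - 1" "n - 2 + 1 + k = - 1 \<longleftrightarrow> n - 1 + k = - 1"
    "n - 1 + 1 + k = - 1 \<longleftrightarrow> n + k = - 1" by auto
  show ?thesis
    unfolding e1_apply h0_apply lmult_curve fd_linear br
    by (simp only: contractions fd_linear vscale_distribs ifs, rule ext,
        cases "n + k = 1"; cases "n + k = 0"; cases "n + k = - 1")
       (simp_all add: vec_eq_iff algebra_simps)
qed

end

section \<open>The currents on the vacuum\<close>

context
  fixes G :: series and M :: monomial
  assumes G: "G \<in> fock r" and x_free_G: "\<And>M. G M \<noteq> 0 \<Longrightarrow> x_free M" and M: "x_free M"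
begin

text \<open>The mixed terms of two \<open>h\<close>-currents do not contribute: an operator in the \<open>y\<close>-variables neither creates
  nor removes \<open>x\<close>-variables.\<close>
lemma vacuum_nord_y_op:
  assumes "y_op r A" "\<not> star g" "star s"
  shows "nord r [g, s] n (A G) M = 0"
proof -
  have "restrict_to x_free G = G"
    using x_free_G by (auto simp: restrict_to_def fun_eq_iff)
  then have AG: "A G = restrict_to x_free (A G)"
    using y_opD(5)[OF r assms(1) x_local_x_free, of G] by simp
  have "A G (M + single (mode_var g m) 1 + v) = 0" for m v
  proof -
    have "\<not> x_free (M + single (mode_var g m) 1 + v)"
      unfolding x_free_def by (auto simp: lookup_add intro!: exI[of _ "mode_var g m"])
    then show ?thesis by (subst AG) (simp add: restrict_to_def)
  qed
  then show ?thesis by (simp add: nord_pair_at_x_free[OF r assms(2,3) M] del: One_nat_def)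
qed

lemma vacuum_y_op_nord:
  assumes "y_op r A" "\<not> star g" "star s"
  shows "A (nord r [g, s] n G) M = 0"
proof -
  have "nord r [g, s] n G N = 0" if N: "x_free N" for N
  proof -
    have "G (N + single (mode_var g m) 1 + v) = 0" for m v
    proof -
      have "\<not> x_free (N + single (mode_var g m) 1 + v)"
        unfolding x_free_def by (auto simp: lookup_add intro!: exI[of _ "mode_var g m"])
      then show ?thesis using x_free_G by blast
    qed
    then show ?thesis by (simp add: nord_pair_at_x_free[OF r assms(2,3) N] del: One_nat_def)
  qed
  then have "restrict_to x_free (nord r [g, s] n G) = 0"
    by (auto simp: restrict_to_def fun_eq_iff)
  then have "restrict_to x_free (A (nord r [g, s] n G)) = 0"
    using y_opD(5)[OF r assms(1) x_local_x_free] linear_opD(3)[OF y_opD(1)[OF r assms(1)]] by metis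
  then show ?thesis using M by (metis restrict_to_def zero_fun_apply)
qed

lemma nord_pair_rules:
  assumes "\<not> star g" "star s" "G1 \<in> fock r"
  shows "nord r [g, s] n G1 \<in> fock r" "vscale c G1 \<in> fock r"
    "nord r [g, s] n (vscale c G1) = vscale c (nord r [g, s] n G1)"
    "G2 \<in> fock r \<Longrightarrow> nord r [g, s] n (G1 + G2) = nord r [g, s] n G1 + nord r [g, s] n G2"
    "G2 \<in> fock r \<Longrightarrow> G1 + G2 \<in> fock r"
proof -
  have op: "fock_op r (nord r [g, s] n)" by (rule fock_op_nord[OF r]) (use assms in auto)
  show "nord r [g, s] n G1 \<in> fock r" "nord r [g, s] n (vscale c G1) = vscale c (nord r [g, s] n G1)"
    "G2 \<in> fock r \<Longrightarrow> nord r [g, s] n (G1 + G2) = nord r [g, s] n G1 + nord r [g, s] n G2"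
    by (rule fock_opD[OF r op assms(3)]; assumption)+
  show "vscale c G1 \<in> fock r" by (rule fock_vscale[OF r assms(3)])
  show "G2 \<in> fock r \<Longrightarrow> G1 + G2 \<in> fock r" by (rule fock_add[OF r assms(3)])
qed

lemmas vacuum_rules =
  nord_pair_rules(1)[OF _ _ G] nord_pair_rules(3,4) fock_vscale[OF r] fock_add[OF r]
  y_opD(2)[OF r y_ops(1) G] y_opD(2)[OF r y_ops(2) G]
  linear_opD[OF y_opD(1)[OF r y_ops(1)]] linear_opD[OF y_opD(1)[OF r y_ops(2)]]
  vacuum_nord_y_op[OF y_ops(1)] vacuum_nord_y_op[OF y_ops(2)]
  vacuum_y_op_nord[OF y_ops(1)] vacuum_y_op_nord[OF y_ops(2)]
  vacuum_double_contraction[OF r _ _ _ _ x_free_G M]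
  plus_fun_apply vscale_apply star.simps sheet.simps X_neq simp_thms if_True if_False

lemma vacuum_h0_h0:
  "h0 n (h0 n' G) M =
     (if r = 0 \<and> n + n' = - 2 then - 8 * of_int (max 0 (- n - 1)) else 0) *s G M +
     beta chi0 lam n (beta chi0 lam n' G) M"
  unfolding h0_apply
  by (simp only: vacuum_rules) (auto simp: vec_eq_iff algebra_simps)

lemma vacuum_h0_h1:
  "h0 n (h1 n' G) M = beta chi0 lam n (beta1 b chi0 \<mu> \<nu> \<kappa> n' G) M"
  "h1 n (h0 n' G) M = beta1 b chi0 \<mu> \<nu> \<kappa> n (beta chi0 lam n' G) M"
  unfolding h0_apply h1_apply
  by (simp only: vacuum_rules, auto simp: vec_eq_iff algebra_simps)+

lemma vacuum_h1_h1:
  "h1 n (h1 n' G) M =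
     (if r = 0 then 4 *
       (if n + n' = 1 then - of_int (max 0 (- n - 1)) - of_int (max 0 (2 - n)) else
        if n + n' = 0 then 2 * b * (of_int (max 0 (- n - 1)) + of_int (max 0 (1 - n))) else
        if n + n' = - 1 then - of_int (max 0 (- n - 1)) - of_int (max 0 (- n)) else 0)
      else 0) *s G M +
     beta1 b chi0 \<mu> \<nu> \<kappa> n (beta1 b chi0 \<mu> \<nu> \<kappa> n' G) M"
proof -
  have ix: "n - j + (n' - i) = - 2 \<longleftrightarrow> n + n' = i + j - 2" "n + (n' - i) = - 2 \<longleftrightarrow> n + n' = i - 2"
    "n - j + n' = - 2 \<longleftrightarrow> n + n' = j - 2" "- (n - j) - 1 = j - 1 - n" for i j by auto
  show ?thesis
    unfolding h1_apply
    by (simp only: vacuum_rules ix) (auto simp: vec_eq_iff algebra_simps)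
qed

text \<open>Up to constant factors the double contractions in the two orders differ by
  \<open>max 0 m - max 0 (- m) = m\<close>, with \<open>m\<close> a mode number, which is the same dependence as in the Heisenberg relations; this turns \<open>\<chi>\<^sub>0\<close> into \<open>\<kappa>\<^sub>0\<close>.\<close>
lemma vacuum_commutators:
  "h0 n (h0 n' G) M = h0 n' (h0 n G) M +
     (if n + n' = - 2 then 2 * level * of_int (n + 1) else 0) *s G M"
  "h0 n (h1 n' G) M = h1 n' (h0 n G) M"
  "h1 n (h1 n' G) M = h1 n' (h1 n G) M + (level * b1_bracket b (- n - 1) (- n' - 1)) *s G M"
proof -
  have bb: "beta chi0 lam n (beta chi0 lam n' G) M = beta chi0 lam n' (beta chi0 lam n G) M +
      (if n + n' = - 2 then 2 * of_int (n + 1) * chi0 else 0) *s G M"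
    unfolding beta_def by (subst rho_b_commutator) (auto simp: vec_eq_iff algebra_simps)
  show "h0 n (h0 n' G) M = h0 n' (h0 n G) M +
     (if n + n' = - 2 then 2 * level * of_int (n + 1) else 0) *s G M"
  proof (cases "n' = - 2 - n")
    case True
    show ?thesis
    proof (cases "n \<ge> - 1")
      case n: True
      have mx: "max 0 (- n - 1) = 0" "max 0 (- (- 2 - n) - 1) = n + 1" using n by auto
      show ?thesis
        unfolding vacuum_h0_h0 bb unfolding True mx
        by (simp add: vec_eq_iff level_def algebra_simps)
    next
      case n: False
      have mx: "max 0 (- n - 1) = - n - 1" "max 0 (- (- 2 - n) - 1) = 0" using n by auto
      show ?thesis
        unfolding vacuum_h0_h0 bb unfolding True mx
        by (simp add: vec_eq_iff level_def algebra_simps)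
    qed
  next
    case False
    then have "n + n' \<noteq> - 2" "n' + n \<noteq> - 2" by auto
    then show ?thesis unfolding vacuum_h0_h0 bb by (simp add: vec_eq_iff)
  qed
  show "h0 n (h1 n' G) M = h1 n' (h0 n G) M"
    unfolding vacuum_h0_h1 beta_def beta1_def rho_b_rho_b1_commute by (rule refl)
  have bb1: "beta1 b chi0 \<mu> \<nu> \<kappa> n (beta1 b chi0 \<mu> \<nu> \<kappa> n' G) M =
      beta1 b chi0 \<mu> \<nu> \<kappa> n' (beta1 b chi0 \<mu> \<nu> \<kappa> n G) M +
      (chi0 * b1_bracket b (- n - 1) (- n' - 1)) *s G M"
    unfolding beta1_def by (subst rho_b1_commutator) simp
  show "h1 n (h1 n' G) M = h1 n' (h1 n G) M + (level * b1_bracket b (- n - 1) (- n' - 1)) *s G M"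
  proof -
    consider "n' = 1 - n" | "n' = - n" | "n' = - 1 - n" | "n + n' \<notin> {1, 0, - 1}" by force
    then show ?thesis
    proof cases
      case 1
      have mx: "max 0 (- n - 1) = max 0 (n + 1) - (n + 1)" "max 0 (2 - n) = max 0 (n - 2) - (n - 2)"
        "max 0 (- (1 - n) - 1) = max 0 (n - 2)" "max 0 (2 - (1 - n)) = max 0 (n + 1)"
        by auto
      show ?thesis unfolding vacuum_h1_h1 bb1 unfolding 1 mx
        by (simp add: vec_eq_iff level_def b1_bracket_def) (simp add: algebra_simps)?
    next
      case 2
      have mx: "max 0 (- n - 1) = max 0 (n + 1) - (n + 1)" "max 0 (1 - n) = max 0 (n - 1) - (n - 1)"
        "max 0 (- (- n) - 1) = max 0 (n - 1)" "max 0 (1 - (- n)) = max 0 (n + 1)"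
        by auto
      show ?thesis unfolding vacuum_h1_h1 bb1 unfolding 2 mx
        by (simp add: vec_eq_iff level_def b1_bracket_def) (simp add: algebra_simps)?
    next
      case 3
      have mx: "max 0 (- n - 1) = max 0 (n + 1) - (n + 1)" "max 0 (- n) = max 0 n - n"
        "max 0 (- (- 1 - n) - 1) = max 0 n" "max 0 (- (- 1 - n)) = max 0 (n + 1)"
        by auto
      show ?thesis unfolding vacuum_h1_h1 bb1 unfolding 3 mx
        by (simp add: vec_eq_iff level_def b1_bracket_def) (simp add: algebra_simps)?
    next
      case 4
      then have "n + n' \<noteq> 1" "n + n' \<noteq> 0" "n + n' \<noteq> - 1" "n' + n \<noteq> 1" "n' + n \<noteq> 0" "n' + n \<noteq> - 1"
        "b1_bracket b (- n - 1) (- n' - 1) = 0"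
        by (auto simp: b1_bracket_def)
      then show ?thesis unfolding vacuum_h1_h1 bb1 by (simp add: vec_eq_iff)
    qed
  qed
qed

end

section \<open>The representation\<close>

definition F_op :: "coord \<Rightarrow> series \<Rightarrow> series" where
  "F_op = lin (\<lambda>m G. - fd Alpha (- m - 1) G) (\<lambda>m G. - fd Alpha1 (- m - 1) G)"

definition H_op :: "coord \<Rightarrow> series \<Rightarrow> series" where
  "H_op = lin (\<lambda>m. h0 (- m - 1)) (\<lambda>m. h1 (- m - 1))"

definition E_op :: "coord \<Rightarrow> series \<Rightarrow> series" where
  "E_op = lin (\<lambda>m. e0 (- m - 1)) (\<lambda>m. e1 (- m - 1))"

lemma ops_linear: "coord_linear (\<lambda>p. F_op p G)" "coord_linear (\<lambda>p. H_op p G)" "coord_linear (\<lambda>p. E_op p G)"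
  unfolding F_op_def H_op_def E_op_def by (rule coord_linear_lin)+

lemma ops_fock: "fock_op r (F_op p)" "fock_op r (H_op p)" "fock_op r (E_op p)"
proof -
  have neg: "fock_op r (\<lambda>G. - fd g n G)" for g n
    using fock_op_vscale[OF r fock_op_field, of "- 1" g n] by (simp only: vscale_distribs vscale_simps)
  show "fock_op r (F_op p)" unfolding F_op_def by (rule fock_op_lin[OF r]) (rule neg)+
  show "fock_op r (H_op p)" "fock_op r (E_op p)"
    unfolding H_op_def E_op_def by (rule fock_op_lin[OF r]; rule fock_op_currents)+
qed

lemma ops_basis:
  "F_op (tpow m) G = - fd Alpha (- m - 1) G" "F_op (tupow m) G = - fd Alpha1 (- m - 1) G"
  "H_op (tpow m) G = h0 (- m - 1) G" "H_op (tupow m) G = h1 (- m - 1) G"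
  "E_op (tpow m) G = e0 (- m - 1) G" "E_op (tupow m) G = e1 (- m - 1) G"
  unfolding F_op_def H_op_def E_op_def lin_basis by (rule refl)+

lemma coord_linear_rmul:
  assumes "coord_linear T"
  shows "coord_linear (\<lambda>p. T (rmul b p q))" "coord_linear (\<lambda>q. T (rmul b p q))"
  using assms unfolding coord_linear_def rmul_add rmul_rscale by blast+

lemma coord_linear_res:
  "coord_linear (\<lambda>p. vscale (c * res_pair b p q) G)" "coord_linear (\<lambda>q. vscale (c * res_pair b p q) G)"
  unfolding coord_linear_def res_pair_add res_pair_rscale
  by (auto simp: fun_eq_iff vec_eq_iff algebra_simps)

lemma coord_linear_add: "coord_linear S \<Longrightarrow> coord_linear T \<Longrightarrow> coord_linear (\<lambda>p. S p + T p)"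
  unfolding coord_linear_def by (simp only: vscale_distribs ac_simps simp_thms)

lemma coord_linear_vscale: "coord_linear S \<Longrightarrow> coord_linear (\<lambda>p. vscale c (S p))"
  unfolding coord_linear_def by (simp only: vscale_distribs vscale_simps ac_simps simp_thms)

lemmas lin_rules = coord_linearD[OF ops_linear(1)] coord_linearD[OF ops_linear(2)]
  coord_linearD[OF ops_linear(3)]

lemma linear_op_id: "linear_op (\<lambda>G. G)"
  by (simp add: linear_op_def)

lemma relation_HF:
  assumes G: "G \<in> fock r"
  shows "H_op p (F_op q G) = F_op q (H_op p G) + vscale (- 2) (F_op (rmul b p q) G)"
proof (rule commutator_bilinear[OF r ops_linear(2) ops_fock(2) ops_linear(1) ops_fock(1) _ _ linear_op_id G])
  show "coord_linear (\<lambda>p. vscale (- 2) (F_op (rmul b p q) G))"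
    "coord_linear (\<lambda>q. vscale (- 2) (F_op (rmul b p q) G))" for p q
    by (intro coord_linear_vscale coord_linear_rmul ops_linear)+
  note neg = fock_opD(4)[OF r fock_op_currents(1) fock_field[OF r G]]
    fock_opD(4)[OF r fock_op_currents(2) fock_field[OF r G]]
  fix p q assume "p \<in> range tpow \<union> range tupow" "q \<in> range tpow \<union> range tupow"
  then consider m n where "p = tpow m" "q = tpow n" | m n where "p = tpow m" "q = tupow n"
    | m n where "p = tupow m" "q = tpow n" | m n where "p = tupow m" "q = tupow n" by blast
  then show "H_op p (F_op q G) = F_op q (H_op p G) + vscale (- 2) (F_op (rmul b p q) G)"
  proof cases
    case 1
    have ix: "- m - 1 + (- n - 1) + 1 = - (m + n) - 1" by simp
    show ?thesis unfolding 1 rmul_basis ops_basis neg h0_alpha[OF G] ix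
      by (simp add: vscale_distribs)
  next
    case 2
    have ix: "- m - 1 + (- n - 1) + 1 = - (m + n) - 1" by simp
    show ?thesis unfolding 2 rmul_basis ops_basis neg h0_alpha[OF G] ix
      by (simp add: vscale_distribs)
  next
    case 3
    have ix: "- m - 1 + (- n - 1) + 1 = - (m + n) - 1" by simp
    show ?thesis unfolding 3 rmul_basis ops_basis neg h1_alpha[OF G] ix
      by (simp add: vscale_distribs)
  next
    case 4
    have ix: "- m - 1 + (- n - 1) + 1 - 3 = - (m + n + 3) - 1"
      "- m - 1 + (- n - 1) + 1 - 2 = - (m + n + 2) - 1"
      "- m - 1 + (- n - 1) + 1 - 1 = - (m + n + 1) - 1" by simp_all
    show ?thesis unfolding 4 rmul_basis lin_rules ops_basis neg h1_alpha[OF G] lmult_curve ix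
      by (rule ext) (simp add: vec_eq_iff algebra_simps)
  qed
qed

lemma relation_EF:
  assumes G: "G \<in> fock r"
  shows "E_op p (F_op q G) = F_op q (E_op p G) +
    (H_op (rmul b p q) G + vscale (level * res_pair b p q) G)"
proof (rule commutator_bilinear[OF r ops_linear(3) ops_fock(3) ops_linear(1) ops_fock(1) _ _ linear_op_id G])
  show "coord_linear (\<lambda>p. H_op (rmul b p q) G + vscale (level * res_pair b p q) G)"
    "coord_linear (\<lambda>q. H_op (rmul b p q) G + vscale (level * res_pair b p q) G)" for p q
    by (intro coord_linear_add coord_linear_rmul coord_linear_res ops_linear)+
  note neg = fock_opD(4)[OF r fock_op_currents(3) fock_field[OF r G]]
    fock_opD(4)[OF r fock_op_currents(4) fock_field[OF r G]]
  fix p q assume "p \<in> range tpow \<union> range tupow" "q \<in> range tpow \<union> range tupow"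
  then consider m n where "p = tpow m" "q = tpow n" | m n where "p = tpow m" "q = tupow n"
    | m n where "p = tupow m" "q = tpow n" | m n where "p = tupow m" "q = tupow n" by blast
  then show "E_op p (F_op q G) = F_op q (E_op p G) +
    (H_op (rmul b p q) G + vscale (level * res_pair b p q) G)"
  proof cases
    case 1
    have ix: "- m - 1 + (- n - 1) + 1 = - (m + n) - 1" by simp
    have res: "level * res_pair b (tpow m) (tpow n) =
        (if - m - 1 + (- n - 1) = - 2 then level * of_int (- m - 1 + 1) else 0)"
      unfolding res_pair_basis by (cases "n = - m") auto
    show ?thesis unfolding 1 res rmul_basis ops_basis neg e0_alpha[OF G] ix
      by (rule ext) (simp add: vec_eq_iff algebra_simps)
  next
    case 2
    have ix: "- m - 1 + (- n - 1) + 1 = - (m + n) - 1" by simp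
    show ?thesis unfolding 2 rmul_basis ops_basis neg e0_alpha[OF G] ix res_pair_basis
      by (rule ext) (simp add: vec_eq_iff algebra_simps)
  next
    case 3
    have ix: "- m - 1 + (- n - 1) + 1 = - (m + n) - 1" by simp
    show ?thesis unfolding 3 rmul_basis ops_basis neg e1_alpha[OF G] ix res_pair_basis
      by (rule ext) (simp add: vec_eq_iff algebra_simps)
  next
    case 4
    have ix: "- m - 1 + (- n - 1) + 1 - 3 = - (m + n + 3) - 1"
      "- m - 1 + (- n - 1) + 1 - 2 = - (m + n + 2) - 1"
      "- m - 1 + (- n - 1) + 1 - 1 = - (m + n + 1) - 1"
      "- (- m - 1) - 1 = m" "- (- n - 1) - 1 = n" by simp_all
    have res: "level * res_pair b (tupow m) (tupow n) = level / 2 * b1_bracket b m n"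
      unfolding res_pair_basis(4)[symmetric] by simp
    show ?thesis unfolding 4 res rmul_basis lin_rules ops_basis neg e1_alpha1[OF G] lmult_curve ix
      by (rule ext) (simp add: vec_eq_iff algebra_simps)
  qed
qed

lemma vacuum_HH:
  assumes G: "G \<in> fock r" "\<And>M. G M \<noteq> 0 \<Longrightarrow> x_free M" and M: "x_free M"
  shows "H_op p (H_op q G) M = H_op q (H_op p G) M + (2 * level * res_pair b p q) *s G M"
proof -
  have "restrict_to x_free (H_op p (H_op q G)) =
      restrict_to x_free (H_op q (H_op p G)) + vscale (2 * level * res_pair b p q) G"
  proof (rule commutator_bilinear[OF r ops_linear(2) ops_fock(2) ops_linear(2) ops_fock(2) _ _
        restrict_to_linear G(1)])
    show "coord_linear (\<lambda>p. vscale (2 * level * res_pair b p q) G)"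
      "coord_linear (\<lambda>q. vscale (2 * level * res_pair b p q) G)" for p q
      by (rule coord_linear_res)+
    fix p q assume pq: "p \<in> range tpow \<union> range tupow" "q \<in> range tpow \<union> range tupow"
    show "restrict_to x_free (H_op p (H_op q G)) =
      restrict_to x_free (H_op q (H_op p G)) + vscale (2 * level * res_pair b p q) G"
    proof
      fix N
      note comm = vacuum_commutators[OF G, of N]
      show "restrict_to x_free (H_op p (H_op q G)) N =
        (restrict_to x_free (H_op q (H_op p G)) + vscale (2 * level * res_pair b p q) G) N"
      proof (cases "x_free N")
        case False
        then have "G N = 0" using G(2) by blast
        then show ?thesis using False by (simp add: restrict_to_def)
      next
        case N: True
        from pq consider m n where "p = tpow m" "q = tpow n" | m n where "p = tpow m" "q = tupow n"
          | m n where "p = tupow m" "q = tpow n" | m n where "p = tupow m" "q = tupow n" by blast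
        then have "H_op p (H_op q G) N = H_op q (H_op p G) N + (2 * level * res_pair b p q) *s G N"
        proof cases
          case 1
          have res: "2 * level * res_pair b (tpow m) (tpow n) =
              (if - m - 1 + (- n - 1) = - 2 then 2 * level * of_int (- m - 1 + 1) else 0)"
            unfolding res_pair_basis by (cases "n = - m") auto
          show ?thesis unfolding 1 ops_basis res by (rule comm(1)[OF _ N])
        next
          case 2
          show ?thesis unfolding 2 ops_basis res_pair_basis using comm(2)[OF _ N] by simp
        next
          case 3
          show ?thesis unfolding 3 ops_basis res_pair_basis using comm(2)[OF _ N] by simp
        next
          case 4
          have res: "2 * level * res_pair b (tupow m) (tupow n) =
              level * b1_bracket b (- (- m - 1) - 1) (- (- n - 1) - 1)"
            by (simp flip: res_pair_basis(4))
          show ?thesis unfolding 4 ops_basis res by (rule comm(3)[OF _ N])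
        qed
        then show ?thesis using N by (simp add: restrict_to_def)
      qed
    qed
  qed
  from fun_cong[OF this, of M] show ?thesis using M by (simp add: restrict_to_def)
qed

lemma alpha_from_F:
  assumes "\<not> star g"
  shows "\<exists>q. \<forall>G. fd g n G = - F_op q G"
proof (cases g)
  case Alpha
  show ?thesis by (intro exI[of _ "tpow (- n - 1)"]) (simp add: ops_basis Alpha)
next
  case Alpha1
  show ?thesis by (intro exI[of _ "tupow (- n - 1)"]) (simp add: ops_basis Alpha1)
qed (use assms in auto)

lemma ops_homogeneous: "homogeneous r 1 (E_op p)" "homogeneous r 0 (H_op p)"
  unfolding E_op_def H_op_def by (intro homogeneous_lin homogeneous_currents)+

lemma relations_HE:
  assumes "G \<in> fock r"
  shows "H_op p (H_op q G) = H_op q (H_op p G) + vscale (2 * level * res_pair b p q) G"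
    "H_op p (E_op q G) = E_op q (H_op p G) + vscale 2 (E_op (rmul b p q) G)"
    "E_op p (E_op q G) = E_op q (E_op p G)"
proof -
  note ops = r ops_fock(3) ops_fock(2) ops_fock(1) ops_homogeneous alpha_from_F
    relation_HF relation_EF vacuum_HH
  show "H_op p (H_op q G) = H_op q (H_op p G) + vscale (2 * level * res_pair b p q) G"
    by (rule relation_HH[OF ops assms])
  show "H_op p (E_op q G) = E_op q (H_op p G) + vscale 2 (E_op (rmul b p q) G)"
    by (rule relation_HE[OF ops assms])
  show "E_op p (E_op q G) = E_op q (E_op p G)"
    by (rule relation_EE[OF ops assms])
qed

lemma relation_FF:
  assumes G: "G \<in> fock r"
  shows "F_op p (F_op q G) = F_op q (F_op p G)"
proof -
  have "F_op p (F_op q G) = F_op q (F_op p G) + 0"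
  proof (rule commutator_bilinear[OF r ops_linear(1) ops_fock(1) ops_linear(1) ops_fock(1) _ _ linear_op_id G])
    show "coord_linear (\<lambda>p. 0)" by (simp add: coord_linear_def)
    then show "coord_linear (\<lambda>p. 0)" .
    fix p q assume "p \<in> range tpow \<union> range tupow" "q \<in> range tpow \<union> range tupow"
    then show "F_op p (F_op q G) = F_op q (F_op p G) + 0"
      by (auto simp: ops_basis linear_opD[OF linear_op_field[OF r]] alpha_alpha_commute[OF r]
          simp del: field_distr.simps)
  qed
  then show ?thesis by simp
qed

fun T_op :: "sl2 \<Rightarrow> coord \<Rightarrow> series \<Rightarrow> series" where
  "T_op SE = E_op"
| "T_op SH = H_op"
| "T_op SF = F_op"

lemma sum_sl2: "(\<Sum>k\<in>{SE, SH, SF}. f k) = f SE + (f SH + f SF)"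
  by (simp add: add.assoc)

lemma T_op_bracket:
  assumes G: "G \<in> fock r"
  shows "T_op i p (T_op j q G) - T_op j q (T_op i p G) =
    (\<Sum>k\<in>{SE, SH, SF}. vscale (sl2_br i j k) (T_op k (rmul b p q) G)) +
    vscale (level * (sl2_form i j * res_pair b p q)) G"
proof -
  note anti = res_pair_antisym[of b p q] rmul_commute[of b q p]
  show ?thesis
  proof (cases i; cases j)
    assume "i = SE" "j = SE"
    then show ?thesis
      by (simp only: T_op.simps relations_HE(3)[OF G, of p q]) (simp add: sum_sl2 sl2_table)
  next
    assume "i = SE" "j = SH"
    then show ?thesis
      by (simp only: T_op.simps relations_HE(2)[OF G, of q p] anti)
         (rule ext, simp add: sum_sl2 sl2_table vec_eq_iff)
  next
    assume "i = SE" "j = SF"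
    then show ?thesis
      by (simp only: T_op.simps relation_EF[OF G, of p q])
         (rule ext, simp add: sum_sl2 sl2_table vec_eq_iff)
  next
    assume "i = SH" "j = SE"
    then show ?thesis
      by (simp only: T_op.simps relations_HE(2)[OF G, of p q])
         (rule ext, simp add: sum_sl2 sl2_table vec_eq_iff)
  next
    assume "i = SH" "j = SH"
    then show ?thesis
      by (simp only: T_op.simps relations_HE(1)[OF G, of p q])
         (rule ext, simp add: sum_sl2 sl2_table vec_eq_iff)
  next
    assume "i = SH" "j = SF"
    then show ?thesis
      by (simp only: T_op.simps relation_HF[OF G, of p q])
         (rule ext, simp add: sum_sl2 sl2_table vec_eq_iff)
  next
    assume "i = SF" "j = SE"
    then show ?thesis
      by (simp only: T_op.simps relation_EF[OF G, of q p] anti)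
         (rule ext, simp add: sum_sl2 sl2_table vec_eq_iff)
  next
    assume "i = SF" "j = SH"
    then show ?thesis
      by (simp only: T_op.simps relation_HF[OF G, of q p] anti)
         (rule ext, simp add: sum_sl2 sl2_table vec_eq_iff)
  next
    assume "i = SF" "j = SF"
    then show ?thesis
      by (simp only: T_op.simps relation_FF[OF G, of p q]) (simp add: sum_sl2 sl2_table)
  qed
qed

lemma T_op_rules: "coord_linear (\<lambda>p. T_op k p G)" "fock_op r (T_op k p)"
  by (cases k; simp only: T_op.simps; rule ops_linear ops_fock)+

definition theta :: "ghat \<Rightarrow> series \<Rightarrow> series" where
  "theta g G = (\<Sum>k\<in>{SE, SH, SF}. T_op k (fst g k) G) + vscale (level * res_cls b (snd g)) G"

lemma theta_fock_op: "fock_op r (theta g)"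
  unfolding theta_def[abs_def]
  by (intro fock_op_add[OF r] fock_op_sum[OF r] T_op_rules
      fock_op_linear_op[OF linear_op_simple(1) fock_vscale[OF r]])

lemma theta_tensor: "theta (tensor b x p) G = T_op x p G"
  by (cases x) (simp_all only: theta_def tensor_def sum_sl2 fst_conv snd_conv sl2.distinct if_True if_False
      res_cls_cls res_form_zero mult_zero_right vscale_simps coord_linearD(3)[OF T_op_rules(1)]
      add_0_left add_0_right simp_thms)

lemma theta_central: "theta (central c) G = vscale (level * res_cls b c) G"
  by (simp only: theta_def central_def sum_sl2 fst_conv snd_conv zero_fun_apply
      coord_linearD(3)[OF T_op_rules(1)] add_0_left)

lemma coord_linear_sum: "coord_linear T \<Longrightarrow> T (\<Sum>i\<in>S. f i) = (\<Sum>i\<in>S. T (f i))"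
proof (induction S rule: infinite_finite_induct)
  case (insert i S)
  then show ?case unfolding sum.insert[OF insert(1,2)] by (metis coord_linearD(1))
qed (auto dest: coord_linearD(3))

lemma res_form_sum: "res_form b (\<Sum>i\<in>S. f i) = (\<Sum>i\<in>S. res_form b (f i))"
  by (induction S rule: infinite_finite_induct) (simp_all add: res_form_add)

abbreviation "L \<equiv> elliptic_affine b"

lemma L_simps:
  "lie_carrier L = UNIV \<times> range (cls b)"
  "lie_add L (A, cls b w) (A', cls b w') = (A + A', cls b (w + w'))"
  "lie_scale L s (A, cls b w) = ((\<lambda>i. rscale s (A i)), cls b (pscale s w))"
  "lie_bracket L (A, c) (A', c') =
     ((\<lambda>k. \<Sum>i\<in>{SE, SH, SF}. \<Sum>j\<in>{SE, SH, SF}. rscale (sl2_br i j k) (rmul b (A i) (A' j))),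
      cls b (\<Sum>i\<in>{SE, SH, SF}. \<Sum>j\<in>{SE, SH, SF}. pscale (sl2_form i j) (dform (A i) (A' j))))"
  unfolding elliptic_affine_def by (simp_all add: cls_add cls_scale Omega_mod_exact_def)

lemma theta_pair:
  "theta (A, cls b w) G = (\<Sum>k\<in>{SE, SH, SF}. T_op k (A k) G) + vscale (level * res_form b w) G"
  by (simp only: theta_def fst_conv snd_conv res_cls_cls)

lemma theta_add: "theta (lie_add L (A, cls b w) (A', cls b w')) G = theta (A, cls b w) G + theta (A', cls b w') G"
  unfolding L_simps theta_pair res_form_add plus_fun_apply[of A A'] coord_linearD(1)[OF T_op_rules(1)]
    sum.distrib distrib_left vscale_distribs by (simp only: ac_simps)

lemma theta_scale: "theta (lie_scale L s (A, cls b w)) G = vscale s (theta (A, cls b w) G)"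
  unfolding L_simps theta_pair res_form_pscale coord_linearD(2)[OF T_op_rules(1)]
    vscale_distribs vscale_sum vscale_simps by (simp only: ac_simps)

lemma theta_bracket:
  assumes G: "G \<in> fock r"
  shows "theta (lie_bracket L (A, cls b w) (A', cls b w')) G =
    theta (A, cls b w) (theta (A', cls b w') G) - theta (A', cls b w') (theta (A, cls b w) G)"
proof -
  let ?S = "{SE, SH, SF}"
  let ?T = "\<lambda>i. T_op i (A i)" and ?T' = "\<lambda>i. T_op i (A' i)"
  let ?s = "level * res_form b w" and ?s' = "level * res_form b w'"
  have mem: "T_op i p G \<in> fock r" for i p by (rule fock_opD(1)[OF r T_op_rules(2) G])
  have prod: "theta (B, cls b v) (theta (B', cls b v') G) =
      (\<Sum>i\<in>?S. \<Sum>j\<in>?S. T_op i (B i) (T_op j (B' j) G)) +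
      (vscale (level * res_form b v') (\<Sum>i\<in>?S. T_op i (B i) G) +
       (vscale (level * res_form b v) (\<Sum>j\<in>?S. T_op j (B' j) G) +
        vscale (level * res_form b v * (level * res_form b v')) G))" for B B' v v'
  proof -
    have in1: "(\<Sum>j\<in>?S. T_op j (B' j) G) \<in> fock r" by (intro fock_sum[OF r] mem)
    have in2: "vscale c G \<in> fock r" for c by (rule fock_vscale[OF r G])
    have "T_op i (B i) ((\<Sum>j\<in>?S. T_op j (B' j) G) + vscale (level * res_form b v') G) =
        (\<Sum>j\<in>?S. T_op i (B i) (T_op j (B' j) G)) + vscale (level * res_form b v') (T_op i (B i) G)" for i
      unfolding fock_opD(5)[OF r T_op_rules(2) in1 in2] fock_opD(2)[OF r T_op_rules(2) G]
        fock_op_sum_fock[OF r T_op_rules(2) mem] by (rule refl)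
    then show ?thesis
      unfolding theta_pair vscale_distribs vscale_simps vscale_sum
      by (simp only: sum.distrib ac_simps)
  qed
  have "theta (lie_bracket L (A, cls b w) (A', cls b w')) G =
     (\<Sum>k\<in>?S. \<Sum>i\<in>?S. \<Sum>j\<in>?S. vscale (sl2_br i j k) (T_op k (rmul b (A i) (A' j)) G)) +
     vscale (level * (\<Sum>i\<in>?S. \<Sum>j\<in>?S. sl2_form i j * res_pair b (A i) (A' j))) G"
    unfolding L_simps theta_pair coord_linear_sum[OF T_op_rules(1)]
      coord_linearD(2)[OF T_op_rules(1)] res_form_sum res_form_pscale res_form_dform by (rule refl)
  also have "(\<Sum>k\<in>?S. \<Sum>i\<in>?S. \<Sum>j\<in>?S. vscale (sl2_br i j k) (T_op k (rmul b (A i) (A' j)) G)) =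
      (\<Sum>i\<in>?S. \<Sum>j\<in>?S. \<Sum>k\<in>?S. vscale (sl2_br i j k) (T_op k (rmul b (A i) (A' j)) G))"
    by (subst sum.swap, rule sum.cong[OF refl], rule sum.swap)
  also have "vscale (level * (\<Sum>i\<in>?S. \<Sum>j\<in>?S. sl2_form i j * res_pair b (A i) (A' j))) G =
      (\<Sum>i\<in>?S. \<Sum>j\<in>?S. vscale (level * (sl2_form i j * res_pair b (A i) (A' j))) G)"
    by (simp only: sum_sl2 distrib_left vscale_distribs)
  also have "(\<Sum>i\<in>?S. \<Sum>j\<in>?S. \<Sum>k\<in>?S. vscale (sl2_br i j k) (T_op k (rmul b (A i) (A' j)) G)) +
      (\<Sum>i\<in>?S. \<Sum>j\<in>?S. vscale (level * (sl2_form i j * res_pair b (A i) (A' j))) G) =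
      (\<Sum>i\<in>?S. \<Sum>j\<in>?S. ?T i (?T' j G) - ?T' j (?T i G))"
    unfolding T_op_bracket[OF G] sum.distrib by (rule refl)
  also have "\<dots> = (\<Sum>i\<in>?S. \<Sum>j\<in>?S. ?T i (?T' j G)) - (\<Sum>j\<in>?S. \<Sum>i\<in>?S. ?T' j (?T i G))"
    unfolding sum_subtractf by (subst (3) sum.swap) (rule refl)
  finally show ?thesis
    unfolding prod by (simp add: mult.commute)
qed

lemma theta_lie_rep: "lie_rep L (fock r) theta"
  unfolding lie_rep_def
proof (intro conjI ballI allI)
  fix g h c G H
  show "G \<in> fock r \<Longrightarrow> theta g G \<in> fock r" "G \<in> fock r \<Longrightarrow> theta g (vscale c G) = vscale c (theta g G)"
    "G \<in> fock r \<Longrightarrow> H \<in> fock r \<Longrightarrow> theta g (G + H) = theta g G + theta g H"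
    by (rule fock_opD[OF r theta_fock_op]; assumption)+
  assume g: "g \<in> lie_carrier L"
  then obtain A w where gA: "g = (A, cls b w)" by (auto simp: L_simps)
  show "theta (lie_scale L c g) G = vscale c (theta g G)"
    unfolding gA by (rule theta_scale)
  assume h: "h \<in> lie_carrier L"
  then obtain A' w' where hA: "h = (A', cls b w')" by (auto simp: L_simps)
  show "theta (lie_add L g h) G = theta g G + theta h G"
    unfolding gA hA by (rule theta_add)
  show "G \<in> fock r \<Longrightarrow> theta (lie_bracket L g h) G = theta g (theta h G) - theta h (theta g G)"
    unfolding gA hA by (rule theta_bracket)
qed

text \<open>The currents determine the action of the centre, because \<open>[e \<otimes> p, f \<otimes> q]\<close> is
  \<open>h \<otimes> p q\<close> plus the class of \<open>p dq\<close>.\<close>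
lemma representation_unique:
  assumes rep1: "lie_rep L (fock r) \<theta>" and rep2: "lie_rep L (fock r) \<theta>'"
    and cur: "\<And>x n G. G \<in> fock r \<Longrightarrow> \<theta> (current b x n) G = \<theta>' (current b x n) G"
    and cur1: "\<And>x n G. G \<in> fock r \<Longrightarrow> \<theta> (current1 b x n) G = \<theta>' (current1 b x n) G"
    and g: "g \<in> lie_carrier L" and G: "G \<in> fock r"
  shows "\<theta> g G = \<theta>' g G"
proof -
  define agree where "agree g \<longleftrightarrow> g \<in> lie_carrier L \<and> (\<forall>G\<in>fock r. \<theta> g G = \<theta>' g G)" for g
  have agree_add: "agree (lie_add L g h)" if "agree g" "agree h" for g h
  proof -
    have "lie_add L g h \<in> lie_carrier L"
      using that unfolding agree_def by (auto simp: L_simps)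
    then show ?thesis
      using that lie_repD(3)[OF rep1] lie_repD(3)[OF rep2] unfolding agree_def by simp
  qed
  have scale: "agree (lie_scale L c g)" if "agree g" for g c
  proof -
    have "lie_scale L c g \<in> lie_carrier L"
      using that unfolding agree_def by (auto simp: L_simps)
    then show ?thesis
      using that lie_repD(2)[OF rep1] lie_repD(2)[OF rep2] unfolding agree_def by simp
  qed
  have tensor_carrier: "tensor b x p \<in> lie_carrier L" for x p
    by (simp add: tensor_def L_simps)
  have central_carrier: "central (cls b w) \<in> lie_carrier L" for w
    by (simp add: central_def L_simps)
  have tensor: "agree (tensor b x p)" for x p
  proof (induction p rule: coord_induct)
    case zero
    have "tensor b x 0 = lie_scale L 0 (current b x 0)"
      by (auto simp: tensor_def current_def L_simps rscale_simps fun_eq_iff)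
    moreover have "agree (current b x 0)"
      using cur tensor_carrier unfolding agree_def current_def by blast
    ultimately show ?case using scale by metis
  next
    case (tpow c m)
    have "tensor b x (rscale c (tpow m)) = lie_scale L c (current b x (- m - 1))"
      by (auto simp: tensor_def current_def L_simps rscale_simps fun_eq_iff)
    moreover have "agree (current b x (- m - 1))"
      using cur tensor_carrier unfolding agree_def current_def by blast
    ultimately show ?case using scale by metis
  next
    case (tupow c m)
    have "tensor b x (rscale c (tupow m)) = lie_scale L c (current1 b x (- m - 1))"
      by (auto simp: tensor_def current1_def L_simps rscale_simps fun_eq_iff)
    moreover have "agree (current1 b x (- m - 1))"
      using cur1 tensor_carrier unfolding agree_def current1_def by blast
    ultimately show ?case using scale by metis
  next
    case (add p q)
    have "tensor b x (p + q) = lie_add L (tensor b x p) (tensor b x q)"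
      by (auto simp: tensor_def L_simps fun_eq_iff)
    then show ?case using agree_add add by metis
  qed
  have central_dform: "agree (central (cls b (dform p q)))" for p q
    unfolding agree_def
  proof (intro conjI ballI central_carrier)
    fix G assume G: "G \<in> fock r"
    let ?e = "tensor b SE p" and ?f = "tensor b SF q" and ?h = "tensor b SH (rmul b p q)"
    \<comment> \<open>The symbol \<open>0 d0\<close> arising from the vanishing components is nonzero in the free space, but trivial.\<close>
    have br: "lie_bracket L ?e ?f = lie_add L ?h (central (cls b (dform p q)))"
    proof -
      have "dform (rscale 0 0) 0 - pscale 0 (dform 0 0) \<in> trivial_forms b"
        by (rule trivial_forms.left_scale)
      then have "pscale 2 (dform 0 0) + dform 0 0 \<in> trivial_forms b"
        by (intro trivial_forms.add trivial_forms.scale) (simp_all add: rscale_simps)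
      then have "cls b (dform p q + (pscale 2 (dform 0 0) + dform 0 0)) = cls b (dform p q)"
        by (simp add: cls_eq_iff)
      moreover have "rscale (sl2_br SE SF k) (rmul b p q) = (if k = SH then rmul b p q else 0)" for k
        by (cases k) (simp_all add: sl2_table rscale_simps)
      ultimately show ?thesis
        by (simp add: tensor_def central_def L_simps fun_eq_iff sl2_table(2) rscale_simps rmul_zero)
    qed
    have val: "\<psi> (central (cls b (dform p q))) G = \<psi> ?e (\<psi> ?f G) - \<psi> ?f (\<psi> ?e G) - \<psi> ?h G"
      if "lie_rep L (fock r) \<psi>" for \<psi>
    proof -
      have "\<psi> (lie_bracket L ?e ?f) G = \<psi> ?e (\<psi> ?f G) - \<psi> ?f (\<psi> ?e G)"
        "\<psi> (lie_add L ?h (central (cls b (dform p q)))) G = \<psi> ?h G + \<psi> (central (cls b (dform p q))) G"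
        by (rule lie_repD[OF that tensor_carrier G] tensor_carrier central_carrier)+
      then show ?thesis unfolding br by (metis add_diff_cancel_left')
    qed
    have eq: "\<theta> (tensor b x s) H = \<theta>' (tensor b x s) H" if "H \<in> fock r" for x s H
      using tensor that unfolding agree_def by blast
    show "\<theta> (central (cls b (dform p q))) G = \<theta>' (central (cls b (dform p q))) G"
      unfolding val[OF rep1] val[OF rep2] eq[OF G]
        eq[OF lie_repD(1)[OF rep2 tensor_carrier G]] by (rule refl)
  qed
  have central: "agree (central (cls b w))" for w
  proof (induction w rule: poly_mapping_induct)
    case zero
    have "central (cls b 0) = tensor b SE 0" by (auto simp: central_def tensor_def fun_eq_iff)
    then show ?case using tensor by metis
  next
    case (single k c)
    obtain p q where k: "k = (p, q)" by (cases k)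
    have "single k c = pscale c (dform p q)"
      unfolding k by (rule poly_mapping_eqI) (simp add: dform_def lookup_single when_def)
    then have "central (cls b (single k c)) = lie_scale L c (central (cls b (dform p q)))"
      by (simp add: central_def L_simps rscale_simps fun_eq_iff)
    then show ?case using scale central_dform by metis
  next
    case (add v w)
    have "central (cls b (v + w)) = lie_add L (central (cls b v)) (central (cls b w))"
      by (simp add: central_def L_simps)
    then show ?case using agree_add add by metis
  qed
  obtain A w where gA: "g = (A, cls b w)" using g by (auto simp: L_simps)
  have "g = lie_add L (lie_add L (tensor b SE (A SE)) (tensor b SH (A SH)))
      (lie_add L (tensor b SF (A SF)) (central (cls b w)))"
    unfolding gA tensor_def central_def L_simps prod.inject
  proof (intro conjI ext)
    show "A k = ((\<lambda>i. if i = SE then A SE else 0) + (\<lambda>i. if i = SH then A SH else 0) +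
        ((\<lambda>i. if i = SF then A SF else 0) + 0)) k" for k
      by (cases k) auto
  qed simp
  then have "agree g" using agree_add tensor central by metis
  then show ?thesis using G unfolding agree_def by blast
qed

lemma theta_formulas:
  assumes G: "G \<in> fock r"
  shows "theta (central (omega_plus b)) G = 0" "theta (central (omega_minus b)) G = 0"
    "theta (central (omega_zero b)) G = vscale level G"
    "theta (current b SF n) G = (- fd Alpha) n G" "theta (current1 b SF n) G = (- fd Alpha1) n G"
    "theta (current b SH n) G = h0 n G" "theta (current1 b SH n) G = h1 n G"
    "theta (current b SE n) G = e0 n G" "theta (current1 b SE n) G = e1 n G"
  by (simp_all only: theta_central res_omega mult_zero_right mult_1_right vscale_simps current_def
      current1_def theta_tensor T_op.simps ops_basis uminus_apply)
     (simp_all del: field_distr.simps)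

end

lemma diag_defined_nprod:
  assumes "r \<in> {0, 1}" "\<not> star g" "\<forall>s\<in>set ss. star s" "ss \<noteq> []"
  shows "diag_defined r (length (g # ss)) (nprod r (g # ss))"
  by (intro diag_defined_of_admissible admissible_nprod assms)

lemma diag_defined_pair_prod:
  assumes r: "r \<in> {0, 1}" and "star s"
  shows "diag_defined r 2 (pair_prod (beta chi0 lam) (field_distr r s))"
    "diag_defined r 2 (pair_prod (beta1 b chi0 \<mu> \<nu> \<kappa>) (field_distr r s))"
  by (intro diag_defined_of_admissible[OF r] admissible_pair_prod[OF r] y_op_beta[OF r] y_op_beta1[OF r]
      y_cutoff_beta y_cutoff_beta1 assms)+

theorem theorem5p1:
  fixes r :: nat and b chi0 lam \<mu> \<nu> \<kappa> :: complex
  assumes "r \<in> {0, 1}"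
  shows
    "let L = elliptic_affine b;
         \<kappa>0 = chi0 + (if r = 0 then 4 else 0);
         P = curve b;
         \<alpha> = field_distr r Alpha;
         \<alpha>1 = field_distr r Alpha1;
         \<alpha>S = field_distr r AlphaS;
         \<alpha>1S = field_distr r Alpha1S;
         \<beta> = beta chi0 lam;
         \<beta>1 = beta1 b chi0 \<mu> \<nu> \<kappa>;
         formulas = (\<lambda>\<theta> :: ghat \<Rightarrow> series \<Rightarrow> series. \<forall>G\<in>fock r.
           \<theta> (central (omega_plus b)) G = 0 \<and>
           \<theta> (central (omega_minus b)) G = 0 \<and>
           \<theta> (central (omega_zero b)) G = vscale \<kappa>0 G \<and>
           (\<forall>n.
             \<theta> (current b SF n) G = (- \<alpha>) n G \<and>
             \<theta> (current1 b SF n) G = (- \<alpha>1) n G \<and>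
             \<theta> (current b SH n) G =
               (dscale 2 (nord r [Alpha, AlphaS] + nord r [Alpha1, Alpha1S]) + \<beta>) n G \<and>
             \<theta> (current1 b SH n) G =
               (dscale 2 (nord r [Alpha1, AlphaS] + lmult P (nord r [Alpha, Alpha1S])) + \<beta>1) n G \<and>
             \<theta> (current1 b SE n) G =
               (nord r [Alpha1, AlphaS, AlphaS]
                + lmult P (nord r [Alpha1, Alpha1S, Alpha1S]
                           + dscale 2 (nord r [Alpha, AlphaS, Alpha1S]))
                + dprod \<beta>1 \<alpha>S + lmult P (dprod \<beta> \<alpha>1S)
                + dscale \<kappa>0 (lmult P (dz \<alpha>1S))
                + dscale (\<kappa>0 / 2) (lmult (lderiv P) \<alpha>1S)) n G \<and>
             \<theta> (current b SE n) G =
               (nord r [Alpha, AlphaS, AlphaS]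
                + lmult P (nord r [Alpha, Alpha1S, Alpha1S])
                + dscale 2 (nord r [Alpha1, AlphaS, Alpha1S])
                + dprod \<beta> \<alpha>S + dprod \<beta>1 \<alpha>1S
                + dscale \<kappa>0 (dz \<alpha>S)) n G))
     in (\<forall>gs \<in> {[Alpha, AlphaS], [Alpha1, Alpha1S], [Alpha1, AlphaS], [Alpha, Alpha1S],
                [Alpha1, AlphaS, AlphaS], [Alpha1, Alpha1S, Alpha1S], [Alpha, AlphaS, Alpha1S],
                [Alpha, AlphaS, AlphaS], [Alpha, Alpha1S, Alpha1S], [Alpha1, AlphaS, Alpha1S]}.
           diag_defined r (length gs) (nprod r gs)) \<and>
        (\<forall>B \<in> {\<beta>, \<beta>1}. \<forall>A \<in> {\<alpha>S, \<alpha>1S}. diag_defined r 2 (pair_prod B A)) \<and>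
        (\<exists>\<theta>. lie_rep L (fock r) \<theta> \<and> formulas \<theta> \<and>
             (\<forall>\<theta>'. lie_rep L (fock r) \<theta>' \<and> formulas \<theta>' \<longrightarrow>
                   (\<forall>g\<in>lie_carrier L. \<forall>G\<in>fock r. \<theta>' g G = \<theta> g G)))"
proof -
  interpret currents r b chi0 lam \<mu> \<nu> \<kappa> by unfold_locales (rule assms)
  show ?thesis
    unfolding Let_def level_def[symmetric] h0_def[symmetric] h1_def[symmetric]
      e0_def[symmetric] e1_def[symmetric]
  proof (intro conjI)
    show "\<forall>gs \<in> {[Alpha, AlphaS], [Alpha1, Alpha1S], [Alpha1, AlphaS], [Alpha, Alpha1S],
                [Alpha1, AlphaS, AlphaS], [Alpha1, Alpha1S, Alpha1S], [Alpha, AlphaS, Alpha1S],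
                [Alpha, AlphaS, AlphaS], [Alpha, Alpha1S, Alpha1S], [Alpha1, AlphaS, Alpha1S]}.
           diag_defined r (length gs) (nprod r gs)"
      by (intro ballI, elim insertE emptyE; hypsubst; rule diag_defined_nprod[OF assms]; simp)
    show "\<forall>B \<in> {beta chi0 lam, beta1 b chi0 \<mu> \<nu> \<kappa>}. \<forall>A \<in> {fd AlphaS, fd Alpha1S}.
        diag_defined r 2 (pair_prod B A)"
      using diag_defined_pair_prod[OF assms] by auto
    let ?formulas = "\<lambda>\<theta> :: ghat \<Rightarrow> series \<Rightarrow> series. \<forall>G\<in>fock r.
           \<theta> (central (omega_plus b)) G = 0 \<and>
           \<theta> (central (omega_minus b)) G = 0 \<and>
           \<theta> (central (omega_zero b)) G = vscale level G \<and>
           (\<forall>n. \<theta> (current b SF n) G = (- fd Alpha) n G \<and>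
             \<theta> (current1 b SF n) G = (- fd Alpha1) n G \<and>
             \<theta> (current b SH n) G = h0 n G \<and> \<theta> (current1 b SH n) G = h1 n G \<and>
             \<theta> (current1 b SE n) G = e1 n G \<and> \<theta> (current b SE n) G = e0 n G)"
    show "\<exists>\<theta>. lie_rep L (fock r) \<theta> \<and> ?formulas \<theta> \<and>
        (\<forall>\<theta>'. lie_rep L (fock r) \<theta>' \<and> ?formulas \<theta>' \<longrightarrow>
           (\<forall>g\<in>lie_carrier L. \<forall>G\<in>fock r. \<theta>' g G = \<theta> g G))"
    proof (intro exI[of _ theta] conjI allI impI ballI theta_lie_rep theta_formulas; (assumption)?)
      fix \<theta>' g G
      assume \<theta>': "lie_rep L (fock r) \<theta>' \<and> ?formulas \<theta>'" and g: "g \<in> lie_carrier L" and G: "G \<in> fock r"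
      have "\<theta>' (current b x n) G = theta (current b x n) G" "\<theta>' (current1 b x n) G = theta (current1 b x n) G"
        if "G \<in> fock r" for x n G
        using \<theta>' that theta_formulas(4-9)[OF that, of n] by (cases x; metis)+
      then show "\<theta>' g G = theta g G"
        using representation_unique[OF _ theta_lie_rep _ _ g G] \<theta>' by blast
    qed
  qed
qed

end
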